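(* Up to Poisson modular isomorphism, the only distinct admissible Poisson brackets on the algebra $\mathcal{M}_*^{\leq\infty}$ of quasimodular forms are $\{\cdot,\cdot\}_1$, $\langle\cdot,\cdot\rangle_1$ and the family $(\cdot,\cdot)_\alpha$ for $\alpha\in\mathbb{C}$. That is, every admissible Poisson bracket on $\mathcal{M}_*^{\leq\infty}$ is Poisson modular isomorphic to one of the brackets $\{\cdot,\cdot\}_1$, $\langle\cdot,\cdot\rangle_1$, $(\cdot,\cdot)_\alpha$ ($\alpha\in\mathbb{C}$), and no two different brackets in this list are Poisson modular isomorphic.
   Context: Modular forms are for $\mathrm{SL}(2,\mathbb{Z})$. The Eisenstein series are $E_2=1-24\sum_{n\ge1}\sigma_1(n)q^n$, $E_4=1+240\sum_{n\ge1}\sigma_3(n)q^n$, $E_6=1-504\sum_{n\ge1}\sigma_5(n)q^n$, with $q=e^{2\pi i z}$; they are algebraically independent over $\mathbb{C}$. The algebra of modular forms is $\mathcal{M}_*=\mathbb{C}[E_4,E_6]$, and the algebra of quasimodular forms is $\mathcal{M}_*^{\leq\infty}=\mathbb{C}[E_2,E_4,E_6]$, graded by the weight ($E_j$ has weight $j$). $\mathcal{M}_k$ is the space of modular forms of weight $k$ (weight-$k$ part of $\mathcal{M}_*$), and $\mathcal{M}_k^{\leq s}=\bigoplus_{j=0}^s\mathcal{M}_{k-2j}E_2^j$ is the space of quasimodular forms of weight $k$ and depth (degree in $E_2$) at most $s$. $\Delta=E_4^3-E_6^2$. $D=\frac{1}{2\pi i}\frac{d}{dz}$, and $\mathrm{RC}_1$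 is the first Rankin-Cohen bracket on $\mathcal{M}_*$, i.e. the bilinear extension of $\mathrm{RC}_1(f,g)=kfD(g)-\ell gD(f)$ for $f\in\mathcal{M}_k$, $g\in\mathcal{M}_\ell$ (so $\mathrm{RC}_1(E_4,E_6)=-2\Delta$). A Poisson bracket on a commutative $\mathbb{C}$-algebra is a bilinear skew-symmetric map satisfying the Leibniz rule in each argument and the Jacobi identity. A Poisson bracket $b$ on $\mathcal{M}_*^{\leq\infty}$ is admissible if (1) its restriction to $\mathcal{M}_*$ is $\mathrm{RC}_1$, and (2) $b(\mathcal{M}_k^{\leq s},\mathcal{M}_\ell^{\leq t})\subset\mathcal{M}_{k+\ell+2}^{\leq s+t}$ for all even $k,\ell$ and all integers $s,t\ge 0$. A Poisson isomorphism (algebra isomorphism intertwining the brackets) $\varphi:(\mathcal{M}_*^{\leq\infty},b_1)\to(\mathcal{M}_*^{\leq\infty},b_2)$ is modular if $\varphi(\mathcal{M}_* )\subset\mathcal{M}_*$; two brackets $b_1,b_2$ are Poisson modular isomorphic if such a $\varphi$ exists. The Poisson brackets of the statement are determined by their values on generators: $\{E_4,E_6\}_1=-2\Delta$, $\{E_2,E_4\}_1=-\frac13(2E_6E_2-E_4^2)$, $\{E_2,E_6\}_1=-\frac12(2E_4^2E_2-E_4E_6)$; $\langle E_4,E_6\rangle_1=-2\Delta$, $\langle E_2,E_4\rangle_1=4E_6E_2+E_4^2$, $\langle E_2,E_6\rangle_1=6E_4^2E_2-2E_4E_6$; $(E_4,E_6)_\alpha=-2\Delta$, $(E_2,E_4)_\alpha=\alpha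 E_6E_2$, $(E_2,E_6)_\alpha=\frac32\alpha E_4^2E_2$. *)

theory Defs
  imports "HOL-Complex_Analysis.Complex_Analysis" "HOL-Library.Function_Algebras"
begin

section \<open>Modular and quasimodular forms for the full modular group\<close>

text \<open>
  Forms are functions on the upper half plane.  Making the half plane a type gives
  \<^typ>\<open>'a \<Rightarrow> complex\<close> at that type its pointwise commutative ring structure, with no need to fix
  values outside the half plane.
\<close>

typedef uhp = "{z::complex. 0 < Im z}"
  by (rule exI[of _ \<i>]) simp

type_synonym uhp_fun = "uhp \<Rightarrow> complex"

definition cscale :: "complex \<Rightarrow> ('a \<Rightarrow> complex) \<Rightarrow> 'a \<Rightarrow> complex" where
  "cscale c f = (\<lambda>z. c * f z)"

interpretation cfun: vector_space cscale
  by unfold_locales (auto simp: cscale_def fun_eq_iff algebra_simps)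

definition nome :: uhp_fun where
  "nome z = exp (2 * of_real pi * \<i> * Rep_uhp z)"

definition divisor_sigma :: "nat \<Rightarrow> nat \<Rightarrow> nat" where
  "divisor_sigma k n = (\<Sum>d | d dvd n. d ^ k)"

definition E2 :: uhp_fun where
  "E2 z = 1 - 24 * (\<Sum>n. of_nat (divisor_sigma 1 (Suc n)) * nome z ^ Suc n)"

definition E4 :: uhp_fun where
  "E4 z = 1 + 240 * (\<Sum>n. of_nat (divisor_sigma 3 (Suc n)) * nome z ^ Suc n)"

definition E6 :: uhp_fun where
  "E6 z = 1 - 504 * (\<Sum>n. of_nat (divisor_sigma 5 (Suc n)) * nome z ^ Suc n)"

definition Delta :: uhp_fun where
  "Delta = E4 ^ 3 - E6 ^ 2"

text \<open>
  The half plane is open, so \<^const>\<open>deriv\<close> at a point of it does not see the arbitrary values of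
  \<^const>\<open>Abs_uhp\<close> outside.
\<close>

definition D :: "uhp_fun \<Rightarrow> uhp_fun" where
  "D f = (\<lambda>z. deriv (\<lambda>w. f (Abs_uhp w)) (Rep_uhp z) / (2 * of_real pi * \<i>))"

definition modular_algebra :: "uhp_fun set" where
  "modular_algebra = cfun.span {E4 ^ a * E6 ^ b | a b. True}"

definition quasimodular_algebra :: "uhp_fun set" where
  "quasimodular_algebra = cfun.span {E2 ^ c * E4 ^ a * E6 ^ b | a b c. True}"

text \<open>
  Weights are integers, so that the space of modular forms of negative weight is zero (as is that
  of odd weight).
\<close>

definition modular_forms :: "int \<Rightarrow> uhp_fun set" where
  "modular_forms k = cfun.span {E4 ^ a * E6 ^ b | a b. 4 * int a + 6 * int b = k}"

definition quasimodular_forms :: "int \<Rightarrow> nat \<Rightarrow> uhp_fun set" where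
  "quasimodular_forms k s =
     {\<Sum>j\<le>s. h j * E2 ^ j | h. \<forall>j\<le>s. h j \<in> modular_forms (k - 2 * int j)}"

definition RC1 :: "int \<Rightarrow> int \<Rightarrow> uhp_fun \<Rightarrow> uhp_fun \<Rightarrow> uhp_fun" where
  "RC1 k l f g = of_int k * f * D g - of_int l * g * D f"


section \<open>Poisson brackets\<close>

definition poisson_bracket_on ::
    "('a \<Rightarrow> complex) set \<Rightarrow> (('a \<Rightarrow> complex) \<Rightarrow> ('a \<Rightarrow> complex) \<Rightarrow> ('a \<Rightarrow> complex)) \<Rightarrow> bool" where
  "poisson_bracket_on A b \<longleftrightarrow>
     (\<forall>f\<in>A. \<forall>g\<in>A. b f g \<in> A) \<and>
     (\<forall>f\<in>A. \<forall>g\<in>A. \<forall>h\<in>A. b (f + g) h = b f h + b g h) \<and>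
     (\<forall>f\<in>A. \<forall>g\<in>A. \<forall>h\<in>A. b f (g + h) = b f g + b f h) \<and>
     (\<forall>c. \<forall>f\<in>A. \<forall>g\<in>A. b (cscale c f) g = cscale c (b f g)) \<and>
     (\<forall>c. \<forall>f\<in>A. \<forall>g\<in>A. b f (cscale c g) = cscale c (b f g)) \<and>
     (\<forall>f\<in>A. \<forall>g\<in>A. b f g = - b g f) \<and>
     (\<forall>f\<in>A. \<forall>g\<in>A. \<forall>h\<in>A. b (f * g) h = f * b g h + b f h * g) \<and>
     (\<forall>f\<in>A. \<forall>g\<in>A. \<forall>h\<in>A. b f (g * h) = b f g * h + g * b f h) \<and>
     (\<forall>f\<in>A. \<forall>g\<in>A. \<forall>h\<in>A. b f (b g h) + b g (b h f) + b h (b f g) = 0)"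

text \<open>
  The first Rankin-Cohen bracket on the algebra of modular forms is the bilinear extension of
  \<^const>\<open>RC1\<close> on homogeneous elements; a bilinear map restricts to it iff the two agree on
  homogeneous elements.
\<close>

definition admissible :: "(uhp_fun \<Rightarrow> uhp_fun \<Rightarrow> uhp_fun) \<Rightarrow> bool" where
  "admissible b \<longleftrightarrow>
     poisson_bracket_on quasimodular_algebra b \<and>
     (\<forall>k l. \<forall>f\<in>modular_forms k. \<forall>g\<in>modular_forms l. b f g = RC1 k l f g) \<and>
     (\<forall>k l s t. even k \<longrightarrow> even l \<longrightarrow>
        (\<forall>f\<in>quasimodular_forms k s. \<forall>g\<in>quasimodular_forms l t.
           b f g \<in> quasimodular_forms (k + l + 2) (s + t)))"

definition poisson_iso_on ::
    "('a \<Rightarrow> complex) set \<Rightarrow> (('a \<Rightarrow> complex) \<Rightarrow> ('a \<Rightarrow> complex) \<Rightarrow> ('a \<Rightarrow> complex)) \<Rightarrow>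
     (('a \<Rightarrow> complex) \<Rightarrow> ('a \<Rightarrow> complex) \<Rightarrow> ('a \<Rightarrow> complex)) \<Rightarrow>
     (('a \<Rightarrow> complex) \<Rightarrow> ('a \<Rightarrow> complex)) \<Rightarrow> bool" where
  "poisson_iso_on A b1 b2 \<phi> \<longleftrightarrow>
     bij_betw \<phi> A A \<and>
     \<phi> 1 = 1 \<and>
     (\<forall>f\<in>A. \<forall>g\<in>A. \<phi> (f + g) = \<phi> f + \<phi> g) \<and>
     (\<forall>f\<in>A. \<forall>g\<in>A. \<phi> (f * g) = \<phi> f * \<phi> g) \<and>
     (\<forall>c. \<forall>f\<in>A. \<phi> (cscale c f) = cscale c (\<phi> f)) \<and>
     (\<forall>f\<in>A. \<forall>g\<in>A. \<phi> (b1 f g) = b2 (\<phi> f) (\<phi> g))"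

definition modular_isomorphic ::
    "(uhp_fun \<Rightarrow> uhp_fun \<Rightarrow> uhp_fun) \<Rightarrow> (uhp_fun \<Rightarrow> uhp_fun \<Rightarrow> uhp_fun) \<Rightarrow> bool" where
  "modular_isomorphic b1 b2 \<longleftrightarrow>
     (\<exists>\<phi>. poisson_iso_on quasimodular_algebra b1 b2 \<phi> \<and> \<phi> ` modular_algebra \<subseteq> modular_algebra)"


section \<open>The model brackets\<close>

text \<open>
  The Poisson bracket on the algebra of quasimodular forms determined by its values on
  (E4,E6), (E2,E4) and (E2,E6).  It is set to zero outside the algebra, as only then can it be
  unique as a total function.
\<close>

definition bracket_of_values :: "uhp_fun \<Rightarrow> uhp_fun \<Rightarrow> uhp_fun \<Rightarrow> uhp_fun \<Rightarrow> uhp_fun \<Rightarrow> uhp_fun"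
  where
  "bracket_of_values u v w =
     (THE b. poisson_bracket_on quasimodular_algebra b \<and>
        b E4 E6 = u \<and> b E2 E4 = v \<and> b E2 E6 = w \<and>
        (\<forall>f g. f \<notin> quasimodular_algebra \<or> g \<notin> quasimodular_algebra \<longrightarrow> b f g = 0))"

definition curly_bracket :: "uhp_fun \<Rightarrow> uhp_fun \<Rightarrow> uhp_fun" where
  "curly_bracket =
     bracket_of_values (- 2 * Delta)
       (cscale (- 1/3) (2 * E6 * E2 - E4 ^ 2))
       (cscale (- 1/2) (2 * E4 ^ 2 * E2 - E4 * E6))"

definition angle_bracket :: "uhp_fun \<Rightarrow> uhp_fun \<Rightarrow> uhp_fun" where
  "angle_bracket =
     bracket_of_values (- 2 * Delta)
       (4 * E6 * E2 + E4 ^ 2)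
       (6 * E4 ^ 2 * E2 - 2 * E4 * E6)"

definition round_bracket :: "complex \<Rightarrow> uhp_fun \<Rightarrow> uhp_fun \<Rightarrow> uhp_fun" where
  "round_bracket \<alpha> =
     bracket_of_values (- 2 * Delta)
       (cscale \<alpha> (E6 * E2))
       (cscale (3/2 * \<alpha>) (E4 ^ 2 * E2))"

datatype bracket_label = Curly | Angle | Round complex

fun model_bracket :: "bracket_label \<Rightarrow> uhp_fun \<Rightarrow> uhp_fun \<Rightarrow> uhp_fun" where
  "model_bracket Curly = curly_bracket"
| "model_bracket Angle = angle_bracket"
| "model_bracket (Round \<alpha>) = round_bracket \<alpha>"

end

theory Submission
  imports Defs "HOL-Real_Asymp.Real_Asymp"
begin

text \<open>
  With \<open>u\<^sub>n = q\<^sup>n / (1 - q\<^sup>n)\<close>, the identity \<open>u\<^sub>j u\<^sub>k = u\<^bsub>j+k\<^esub> (1 + u\<^sub>j + u\<^sub>k)\<close> and a rearrangement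
  of double series give Ramanujan's formulas for the derivatives of \<open>E\<^sub>4\<close> and \<open>E\<^sub>6\<close>, whence
  \<open>RC\<^sub>1(E\<^sub>4, E\<^sub>6) = - 2 \<Delta>\<close>.  Lattice sums give the behaviour of \<open>E\<^sub>4\<close> and \<open>E\<^sub>6\<close> under
  \<open>z \<mapsto> - 1 / z\<close>, and Ramanujan's formula transfers it to \<open>E\<^sub>2\<close>.  A polynomial relation between the
  three functions is polynomial in \<open>n\<close> when evaluated at \<open>- 1 / (z + n)\<close>; doing this twice makes the
  first variable and the scale of the other two independent, and the relation is trivial because
  \<open>E\<^sub>4\<^sup>3 / E\<^sub>6\<^sup>2\<close> takes infinitely many values.

  An admissible bracket is then given by \<open>b(E\<^sub>2, E\<^sub>4) = \<alpha> E\<^sub>6 E\<^sub>2 + \<beta> E\<^sub>4\<^sup>2\<close> and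
  \<open>b(E\<^sub>2, E\<^sub>6) = \<gamma> E\<^sub>4\<^sup>2 E\<^sub>2 + \<delta> E\<^sub>4 E\<^sub>6\<close>; the Jacobi identity amounts to \<open>\<gamma> = 3/2 \<alpha>\<close> and
  \<open>\<beta> = \<delta> = 0\<close> or \<open>\<alpha> \<in> {4, - 2/3}\<close> with \<open>\<delta>\<close> determined by \<open>\<beta>\<close>, and \<open>\<beta>\<close> is normalised by rescaling
  \<open>E\<^sub>2\<close>.  A modular isomorphism \<open>\<phi>\<close> preserves the degree in \<open>E\<^sub>2\<close>, so it restricts to an
  automorphism of the algebra of modular forms.  Brackets of modular forms are multiples of \<open>\<Delta>\<close>, so
  \<open>\<phi>(\<Delta>) = \<kappa> \<Delta>\<close> with \<open>\<kappa>\<close> constant; hence \<open>\<phi>\<close> commutes with the derivation \<open>\<Delta>\<^sup>-\<^sup>1 b(-, \<Delta>)\<close>, which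
  recovers \<open>\<alpha>\<close>.  Finally, \<open>\<beta>\<close> cannot be removed: this would put \<open>\<beta> E\<^sub>4\<^sup>2\<close> into the ideal generated by
  \<open>E\<^sub>6\<close> and \<open>E\<^sub>4\<^sup>3\<close>.
\<close>

text \<open>The brackets of the statement are prescribed on generators, so they can be handled only
  once the three series are known to be algebraically independent. The analytic half serves this and
  the value of RC_1(E_4, E_6); afterwards every question is one about polynomials in three
  variables. Only the derivatives of E_4 and E_6 are needed. The inversion law of E_2, which no
  absolutely convergent lattice sum provides, comes from differentiating that of E_4, and only where
  E_4 does not vanish; this is enough to test a polynomial relation. The values 4 and - 2/3 are what
  remains when \<delta> is eliminated from the Jacobi conditions: \<beta> (\<alpha> - 4) (3 \<alpha>
  + 2) = 0. Isomorphic brackets have the same \<alpha>, so a second invariant is needed only for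
  \<open>Angle\<close> against \<open>Round 4\<close> and for \<open>Curly\<close> against
  \<open>Round (- 2/3)\<close>; it is whether \<beta> vanishes.\<close>

section \<open>Ramanujan's identities\<close>

text \<open>The value at \<open>n = 0\<close> is \<open>1 / 0 = 0\<close>.\<close>

definition lu :: "complex \<Rightarrow> nat \<Rightarrow> complex" where
  "lu q n = q ^ n / (1 - q ^ n)"

text \<open>With x = q^j and y = q^k, the factor 1 + u_j + u_k equals (1 - x y) / ((1 - x) (1 -
  y)).\<close>

lemma lu_mult:
  assumes "norm q < 1" "j > 0" "k > 0"
  shows "lu q j * lu q k = lu q (j + k) * (1 + lu q j + lu q k)"
proof -
  have *: "q ^ n \<noteq> 1" if "n > 0" for n
  proof
    assume "q ^ n = 1"
    then have "norm q ^ n = 1" by (metis norm_one norm_power)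
    with power_strict_mono[of "norm q" 1 n] that assms(1) show False by simp
  qed
  have "1 - q ^ j \<noteq> 0" "1 - q ^ k \<noteq> 0" "1 - q ^ j * q ^ k \<noteq> 0"
    using *[of j] *[of k] *[of "j+k"] assms by (auto simp: power_add)
  then show ?thesis unfolding lu_def power_add by (simp add: divide_simps) (simp add: algebra_simps)
qed

section \<open>Absolutely convergent double series over pairs of positive integers\<close>

lemma poly_geometric_bounded:
  fixes r \<rho> :: real
  assumes "0 \<le> r" "r < \<rho>"
  shows "\<exists>C\<ge>0. \<forall>n. real n ^ p * r ^ n \<le> C * \<rho> ^ n"
  using assms
proof (induction p arbitrary: \<rho>)
  case 0
  then show ?case by (intro exI[of _ 1]) (auto intro: power_mono)
next
  case (Suc p)
  \<comment> \<open>A factor n costs an arbitrarily small increase of the ratio: p factors take r to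
    \<sigma>, and the last one takes \<sigma> to \<rho>.\<close>
  obtain \<sigma> where \<sigma>: "r < \<sigma>" "\<sigma> < \<rho>" using dense Suc.prems by blast
  obtain C where C: "C \<ge> 0" "\<And>n. real n ^ p * r ^ n \<le> C * \<sigma> ^ n"
    using Suc.IH[OF Suc.prems(1) \<sigma>(1)] by blast
  have "(\<lambda>n. real n * (\<sigma> / \<rho>) ^ n) \<longlonglongrightarrow> 0"
    using powser_times_n_limit_0[of "\<sigma>/\<rho>"] Suc.prems \<sigma> by (auto)
  then have "Bseq (\<lambda>n. real n * (\<sigma> / \<rho>) ^ n)" by (meson convergentI convergent_imp_Bseq)
  then obtain K where K: "K > 0" "\<And>n. norm (real n * (\<sigma> / \<rho>) ^ n) \<le> K"
    unfolding Bseq_def by blast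
  have "real n ^ Suc p * r ^ n \<le> (C * K) * \<rho> ^ n" for n
  proof -
    have p: "\<rho> ^ n > 0" using Suc.prems by auto
    have "real n * (\<sigma> / \<rho>) ^ n \<le> K" using K(2)[of n] by (smt (verit) real_norm_def)
    with p have *: "real n * \<sigma> ^ n \<le> K * \<rho> ^ n" by (simp add: power_divide pos_divide_le_eq)
    have "real n ^ Suc p * r ^ n \<le> real n * (C * \<sigma> ^ n)"
      using mult_left_mono[OF C(2)[of n], of "real n"] by (simp add: mult_ac)
    also have "\<dots> \<le> C * (K * \<rho> ^ n)" using mult_left_mono[OF * C(1)] by (simp add: mult_ac)
    finally show ?thesis by (simp add: mult_ac)
  qed
  then show ?case using C(1) K(1) by (intro exI[of _ "C * K"]) auto
qed

text \<open>Geometric decay in j + k survives sums, polynomial weights and bounded factors, and it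
  implies absolute summability; so this one invariant licenses all the rearrangements below.\<close>

definition geo_bounded :: "(nat \<Rightarrow> nat \<Rightarrow> complex) \<Rightarrow> bool" where
  "geo_bounded g \<longleftrightarrow> (\<exists>C\<ge>0. \<exists>r. 0 \<le> r \<and> r < 1 \<and> (\<forall>j k. norm (g j k) \<le> C * r ^ (j + k)))"

lemma geo_bounded_add:
  assumes "geo_bounded g" "geo_bounded h"
  shows "geo_bounded (\<lambda>j k. g j k + h j k)"
proof -
  obtain C r where 1: "C \<ge> 0" "0 \<le> r" "r < 1" "\<And>j k. norm (g j k) \<le> C * r ^ (j + k)"
    using assms(1) unfolding geo_bounded_def by blast
  obtain C' r' where 2: "C' \<ge> 0" "0 \<le> r'" "r' < 1" "\<And>j k. norm (h j k) \<le> C' * r' ^ (j + k)"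
    using assms(2) unfolding geo_bounded_def by blast
  have "norm (g j k + h j k) \<le> (C + C') * max r r' ^ (j + k)" for j k
  proof -
    have "C * r ^ (j + k) \<le> C * max r r' ^ (j + k)" "C' * r' ^ (j + k) \<le> C' * max r r' ^ (j + k)"
      using 1 2 by (auto intro!: mult_left_mono power_mono)
    with 1(4)[of j k] 2(4)[of j k] norm_triangle_ineq[of "g j k" "h j k"]
    show ?thesis by (simp add: algebra_simps)
  qed
  then show ?thesis unfolding geo_bounded_def
    using 1 2 by (intro exI[of _ "C + C'"] conjI exI[of _ "max r r'"]) auto
qed

lemma geo_bounded_bound:
  assumes "geo_bounded g" "\<And>j k. norm (h j k) \<le> K * real (j + k) ^ p * norm (g j k)"
  shows "geo_bounded h"
proof -
  obtain C r where 1: "C \<ge> 0" "0 \<le> r" "r < 1" "\<And>j k. norm (g j k) \<le> C * r ^ (j + k)"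
    using assms(1) unfolding geo_bounded_def by blast
  obtain \<rho> where \<rho>: "r < \<rho>" "\<rho> < 1" using dense 1(3) by blast
  obtain D where D: "D \<ge> 0" "\<And>n. real n ^ p * r ^ n \<le> D * \<rho> ^ n"
    using poly_geometric_bounded[OF 1(2) \<rho>(1)] by blast
  have "norm (h j k) \<le> (\<bar>K\<bar> * C * D) * \<rho> ^ (j + k)" for j k
  proof -
    have "norm (h j k) \<le> K * real (j + k) ^ p * norm (g j k)" by (rule assms)
    also have "\<dots> \<le> \<bar>K\<bar> * real (j + k) ^ p * norm (g j k)" by (intro mult_right_mono) auto
    also have "\<dots> \<le> \<bar>K\<bar> * real (j + k) ^ p * (C * r ^ (j + k))" by (intro mult_left_mono 1) auto
    also have "\<dots> = \<bar>K\<bar> * C * (real (j + k) ^ p * r ^ (j + k))" by (simp add: mult_ac)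
    also have "\<dots> \<le> \<bar>K\<bar> * C * (D * \<rho> ^ (j + k))" by (intro mult_left_mono D) (auto simp: 1)
    finally show ?thesis by (simp add: mult_ac)
  qed
  then show ?thesis unfolding geo_bounded_def
    using 1 D \<rho> by (intro exI[of _ "\<bar>K\<bar> * C * D"] conjI exI[of _ \<rho>]) auto
qed

lemma geo_bounded_cmult: "geo_bounded g \<Longrightarrow> geo_bounded (\<lambda>j k. c * g j k)"
  by (rule geo_bounded_bound[of g _ "norm c" 0]) (auto simp: norm_mult)

lemma geo_bounded_nat1: "geo_bounded g \<Longrightarrow> geo_bounded (\<lambda>j k. of_nat j ^ p * g j k)"
  by (rule geo_bounded_bound[of g _ 1 p]) (auto simp: norm_mult norm_power intro!: mult_right_mono power_mono)

lemma geo_bounded_nat2: "geo_bounded g \<Longrightarrow> geo_bounded (\<lambda>j k. of_nat k ^ p * g j k)"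
  by (rule geo_bounded_bound[of g _ 1 p]) (auto simp: norm_mult norm_power intro!: mult_right_mono power_mono)

lemma geo_bounded_summable:
  assumes "geo_bounded g"
  shows "(\<lambda>(j, k). g j k) summable_on A"
proof -
  obtain C r where 1: "C \<ge> 0" "0 \<le> r" "r < 1" "\<And>j k. norm (g j k) \<le> C * r ^ (j + k)"
    using assms(1) unfolding geo_bounded_def by blast
  have r: "(\<lambda>n. r ^ n) summable_on UNIV"
    using 1 by (intro norm_summable_imp_summable_on) (auto intro!: summable_geometric)
  have s: "(\<lambda>(j,k). r ^ j * r ^ k) summable_on (UNIV \<times> UNIV)"
    using 1 by (intro summable_on_SigmaI[where g = "\<lambda>j. r ^ j * infsum (\<lambda>n. r ^ n) UNIV"])
      (auto intro!: has_sum_cmult_right summable_on_cmult_left has_sum_infsum r)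
  then have "(\<lambda>x. C * (case x of (j,k) \<Rightarrow> r ^ j * r ^ k)) summable_on (UNIV \<times> UNIV)"
    by (rule summable_on_cmult_right)
  then have "(\<lambda>x. norm (case x of (j, k) \<Rightarrow> g j k)) summable_on (UNIV \<times> UNIV)"
    by (rule Infinite_Sum.abs_summable_on_comparison_test') (use 1(4) in \<open>simp add: case_prod_unfold power_add mult.assoc\<close>)
  then have "(\<lambda>(j, k). g j k) summable_on (UNIV \<times> UNIV)"
    by (rule abs_summable_summable)
  then show ?thesis by (rule summable_on_subset_banach) auto
qed

definition pos_pairs :: "(nat \<times> nat) set" where
  "pos_pairs = {1..} \<times> {1..}"

definition dsum :: "(nat \<Rightarrow> nat \<Rightarrow> complex) \<Rightarrow> complex" where
  "dsum g = infsum (\<lambda>(j, k). g j k) pos_pairs"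

lemma dsum_cong: "(\<And>j k. j > 0 \<Longrightarrow> k > 0 \<Longrightarrow> g j k = h j k) \<Longrightarrow> dsum g = dsum h"
  unfolding dsum_def pos_pairs_def by (intro infsum_cong) auto

lemma dsum_add: "geo_bounded g \<Longrightarrow> geo_bounded h \<Longrightarrow> dsum (\<lambda>j k. g j k + h j k) = dsum g + dsum h"
  unfolding dsum_def using infsum_add[OF geo_bounded_summable geo_bounded_summable, of g h]
  by (simp add: case_prod_unfold)

lemma dsum_cmult: "dsum (\<lambda>j k. c * g j k) = c * dsum g"
  unfolding dsum_def using infsum_cmult_right'[of c "\<lambda>(j,k). g j k"] by (simp add: case_prod_unfold)

lemma dsum_swap: "dsum (\<lambda>j k. g k j) = dsum g"
  unfolding dsum_def pos_pairs_def
  by (rule infsum_reindex_bij_witness[of _ prod.swap prod.swap]) auto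

text \<open>Both off-diagonal parts are parametrised by the smaller index and the difference. This
  is how a function of |j - k| becomes a function of a free summation index.\<close>

lemma dsum_split:
  assumes "geo_bounded g"
  shows "dsum g = dsum (\<lambda>m k. g m (m + k)) + dsum (\<lambda>m k. g (m + k) m) + (\<Sum>\<^sub>\<infinity>m\<in>{1..}. g m m)"
proof -
  let ?g = "\<lambda>(j, k). g j k"
  let ?A = "{(j,k). 0 < j \<and> j < k}" and ?B = "{(j,k). 0 < k \<and> k < j}" and ?D = "(\<lambda>m. (m,m)) ` {1::nat..}"
  have s: "?g summable_on X" for X by (rule geo_bounded_summable[OF assms])
  have P: "pos_pairs = ?A \<union> ?B \<union> ?D" unfolding pos_pairs_def by (auto simp: image_iff)
  have "dsum g = infsum ?g (?A \<union> ?B) + infsum ?g ?D"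
    unfolding dsum_def P by (intro infsum_Un_disjoint s) auto
  also have "infsum ?g (?A \<union> ?B) = infsum ?g ?A + infsum ?g ?B"
    by (intro infsum_Un_disjoint s) auto
  also have "infsum ?g ?A = dsum (\<lambda>m k. g m (m + k))" unfolding dsum_def pos_pairs_def
    by (rule infsum_reindex_bij_witness[of _ "\<lambda>(m,k). (m, m + k)" "\<lambda>(m,l). (m, l - m)"]) auto
  also have "infsum ?g ?B = dsum (\<lambda>m k. g (m + k) m)" unfolding dsum_def pos_pairs_def
    by (rule infsum_reindex_bij_witness[of _ "\<lambda>(m,k). (m + k, m)" "\<lambda>(l,m). (m, l - m)"]) auto
  also have "infsum ?g ?D = (\<Sum>\<^sub>\<infinity>m\<in>{1..}. g m m)"
    by (subst infsum_reindex) (auto simp: inj_on_def o_def)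
  finally show ?thesis .
qed

lemma dsum_antidiagonal:
  assumes "geo_bounded (\<lambda>j k. h j (j + k))"
  shows "dsum (\<lambda>j k. h j (j + k)) = (\<Sum>\<^sub>\<infinity>l\<in>{1..}. \<Sum>j\<in>{1..<l}. h j l)"
proof -
  let ?S = "Sigma {1::nat..} (\<lambda>l. {1..<l})"
  have 1: "dsum (\<lambda>j k. h j (j + k)) = infsum (\<lambda>(l,j). h j l) ?S"
    unfolding dsum_def pos_pairs_def
    by (rule infsum_reindex_bij_witness[of _ "\<lambda>(l,j). (j, l - j)" "\<lambda>(j,k). (j + k, j)"]) auto
  have "(\<lambda>(l,j). h j l) summable_on ?S \<longleftrightarrow> (\<lambda>(j,k). h j (j + k)) summable_on ({1..} \<times> {1..})"
    by (rule summable_on_reindex_bij_witness[of _ "\<lambda>(j,k). (j + k, j)" "\<lambda>(l,j). (j, l - j)" ]) auto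
  with geo_bounded_summable[OF assms] have s: "(\<lambda>(l,j). h j l) summable_on ?S" by blast
  show ?thesis unfolding 1 using infsum_Sigma'_banach[OF s] by (simp add: case_prod_unfold)
qed

lemma dsum_mult:
  assumes "geo_bounded (\<lambda>j k. a j * b k)"
  shows "dsum (\<lambda>j k. a j * b k) = (\<Sum>\<^sub>\<infinity>j\<in>{1..}. a j) * (\<Sum>\<^sub>\<infinity>k\<in>{1..}. b k)"
  unfolding dsum_def pos_pairs_def
  using infsum_Sigma'_banach[OF geo_bounded_summable[OF assms], symmetric, of "{1..}" "\<lambda>_. {1..}"]
  by (simp add: infsum_cmult_right' infsum_cmult_left')

lemma geo_bounded_diag_summable:
  assumes "geo_bounded g"
  shows "(\<lambda>m. g m m) summable_on A"
proof -
  have "(\<lambda>(j, k). g j k) summable_on ((\<lambda>m. (m,m)) ` A)" by (rule geo_bounded_summable[OF assms])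
  then show ?thesis by (subst (asm) summable_on_reindex) (auto simp: inj_on_def o_def)
qed

lemma norm_lu_le:
  assumes "norm q < 1"
  shows "norm (lu q n) \<le> norm q ^ n / (1 - norm q)"
proof (cases "n = 0")
  case False
  have "norm q ^ n \<le> norm q" using assms False power_decreasing[of 1 n "norm q"] by auto
  moreover have "1 - norm q ^ n \<le> norm (1 - q ^ n)"
    using norm_triangle_ineq2[of 1 "q ^ n"] by (simp add: norm_power)
  ultimately have "1 - norm q \<le> norm (1 - q ^ n)" by linarith
  then show ?thesis unfolding lu_def norm_divide norm_power
    using assms by (intro divide_left_mono) (auto intro!: mult_pos_pos)
qed (use assms in \<open>auto simp: lu_def\<close>)

lemma geo_bounded_lu_sum:
  assumes "norm q < 1"
  shows "geo_bounded (\<lambda>j k. lu q (j + k))"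
  unfolding geo_bounded_def
  using norm_lu_le[OF assms] assms
  by (intro exI[of _ "1 / (1 - norm q)"] conjI exI[of _ "norm q"]) auto

lemma geo_bounded_lu_mult:
  assumes "norm q < 1"
  shows "geo_bounded (\<lambda>j k. lu q j * lu q k)"
proof -
  have "norm (lu q j * lu q k) \<le> (1 / (1 - norm q))\<^sup>2 * norm q ^ (j + k)" for j k
    using mult_mono[OF norm_lu_le[OF assms, of j] norm_lu_le[OF assms, of k]] assms
    by (auto simp: norm_mult power_add power2_eq_square)
  then show ?thesis unfolding geo_bounded_def using assms
    by (intro exI[of _ "(1 / (1 - norm q))\<^sup>2"] conjI exI[of _ "norm q"]) auto
qed

lemma norm_lu_le_const:
  assumes "norm q < 1"
  shows "norm (lu q n) \<le> 1 / (1 - norm q)"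
proof -
  have "norm q ^ n \<le> 1" using assms by (intro power_le_one) auto
  then have "norm q ^ n / (1 - norm q) \<le> 1 / (1 - norm q)" using assms by (intro divide_right_mono) auto
  with norm_lu_le[OF assms, of n] show ?thesis by linarith
qed

lemma geo_bounded_mult_lu:
  assumes "norm q < 1" "geo_bounded g"
  shows "geo_bounded (\<lambda>j k. lu q j * g j k)" "geo_bounded (\<lambda>j k. lu q k * g j k)"
proof -
  have *: "norm (lu q n * x) \<le> 1 / (1 - norm q) * real m ^ 0 * norm x" for n x m
    unfolding norm_mult using mult_right_mono[OF norm_lu_le_const[OF assms(1), of n], of "norm x"] by simp
  show "geo_bounded (\<lambda>j k. lu q j * g j k)"
    by (rule geo_bounded_bound[where g = g and K = "1 / (1 - norm q)" and p = 0]) (use assms(2) * in auto)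
  show "geo_bounded (\<lambda>j k. lu q k * g j k)"
    by (rule geo_bounded_bound[where g = g and K = "1 / (1 - norm q)" and p = 0]) (use assms(2) * in auto)
qed

lemma geo_bounded_kernel:
  assumes "geo_bounded g" "\<And>j k. norm (h j k) \<le> real (j + k) ^ p"
  shows "geo_bounded (\<lambda>j k. h j k * g j k)"
  by (rule geo_bounded_bound[OF assms(1), of _ 1 p]) (use assms(2) in \<open>auto simp: norm_mult intro!: mult_right_mono\<close>)

text \<open>The product formula solved for u_k u_(m+k), the product that appears when an
  off-diagonal part is reparametrised.\<close>

lemma lu_mult_shift:
  assumes "norm q < 1" "m > 0" "k > 0"
  shows "lu q k * lu q (m + k) = lu q m * lu q k - lu q m * lu q (m + k) - lu q (m + k)"
  using lu_mult[OF assms] by (simp add: algebra_simps)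

lemma dsum_add3:
  assumes "geo_bounded a" "geo_bounded b" "geo_bounded c"
  shows "dsum (\<lambda>j k. a j k + (b j k + c j k)) = dsum a + (dsum b + dsum c)"
    and "dsum (\<lambda>j k. a j k + ((-1) * b j k + (-1) * c j k)) = dsum a - dsum b - dsum c"
    and "dsum (\<lambda>j k. 2 * a j k + (b j k + (-1) * c j k)) =
         2 * dsum a + dsum (\<lambda>j k. b j k + (-1) * c j k)"
proof -
  note cm = geo_bounded_cmult[of _ "-1"] geo_bounded_cmult[of _ "2"]
  note neg = dsum_cmult[of "-1"]
  show "dsum (\<lambda>j k. a j k + (b j k + c j k)) = dsum a + (dsum b + dsum c)"
    using dsum_add[OF assms(1) geo_bounded_add[OF assms(2,3)]] dsum_add[OF assms(2,3)] by simp
  show "dsum (\<lambda>j k. a j k + ((-1) * b j k + (-1) * c j k)) = dsum a - dsum b - dsum c"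
    using dsum_add[OF assms(1) geo_bounded_add[OF cm(1)[OF assms(2)] cm(1)[OF assms(3)]]]
      dsum_add[OF cm(1)[OF assms(2)] cm(1)[OF assms(3)]] neg[of b] neg[of c] by simp
  show "dsum (\<lambda>j k. 2 * a j k + (b j k + (-1) * c j k)) =
         2 * dsum a + dsum (\<lambda>j k. b j k + (-1) * c j k)"
    using dsum_add[OF cm(2)[OF assms(1)] geo_bounded_add[OF assms(2) cm(1)[OF assms(3)]]]
      dsum_cmult[of 2 a] by simp
qed

text \<open>
  Ramanujan's expansions of the squares of \<open>1/4 cot(\<theta>/2) + \<Sum> u\<^sub>k sin(k \<theta>)\<close> and of its derivative, with
  the even function \<open>f\<close> in place of \<open>k \<mapsto> cos(k \<theta>)\<close>.
\<close>

lemma lambert_square_minus: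
  fixes f :: "nat \<Rightarrow> complex"
  assumes q: "norm q < 1" and f0: "f 0 = 0" and f: "\<And>n. norm (f n) \<le> real n ^ p"
  defines "U \<equiv> lu q"
  shows "dsum (\<lambda>j k. f (j + k) * (U j * U k)) - dsum (\<lambda>j k. f (nat \<bar>int j - int k\<bar>) * (U j * U k)) =
     dsum (\<lambda>j k. f (j + k) * U (j + k)) + 2 * dsum (\<lambda>j k. f j * U (j + k))
      - 2 * (\<Sum>\<^sub>\<infinity>m\<in>{1..}. f m * U m ^ 2)"
proof -
  note gb = geo_bounded_lu_mult[OF q, folded U_def] geo_bounded_lu_sum[OF q, folded U_def]
  have lm: "U j * U k = U (j + k) * (1 + U j + U k)" if "j > 0" "k > 0" for j k
    unfolding U_def by (rule lu_mult[OF q that])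
  note gm = geo_bounded_mult_lu[OF q, folded U_def]
  have mono: "norm (f m) \<le> real n ^ p" if "m \<le> n" for m n
    using f[of m] power_mono[of "real m" "real n" p] that by simp
  have K: "geo_bounded (\<lambda>j k. f (h j k) * g j k)" if "geo_bounded g" "\<And>j k. h j k \<le> j + k" for g h
    using mono[OF that(2)] by (intro geo_bounded_kernel[OF that(1), where p = p])
  have "dsum (\<lambda>j k. f (j + k) * (U j * U k)) =
     dsum (\<lambda>j k. f (j + k) * U (j + k) +
        (f (j + k) * (U j * U (j + k)) + f (j + k) * (U k * U (j + k))))"
    by (rule dsum_cong, subst lm) (simp_all add: algebra_simps)
  also have "\<dots> = dsum (\<lambda>j k. f (j + k) * U (j + k)) +
     (dsum (\<lambda>j k. f (j + k) * (U j * U (j + k))) + dsum (\<lambda>j k. f (j + k) * (U k * U (j + k))))"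
    by (intro dsum_add3(1) K gm gb order_refl)
  also have "dsum (\<lambda>j k. f (j + k) * (U k * U (j + k))) = dsum (\<lambda>j k. f (j + k) * (U j * U (j + k)))"
    by (subst dsum_swap[symmetric]) (simp add: add.commute)
  finally have L1: "dsum (\<lambda>j k. f (j + k) * (U j * U k)) =
    dsum (\<lambda>j k. f (j + k) * U (j + k)) + 2 * dsum (\<lambda>j k. f (j + k) * (U j * U (j + k)))" by simp
  \<comment> \<open>Off the diagonal |j - k| is the new index k, so f depends on k alone; the
    diagonal contributes nothing because f 0 = 0.\<close>
  have "dsum (\<lambda>j k. f (nat \<bar>int j - int k\<bar>) * (U j * U k)) =
     dsum (\<lambda>m k. f k * (U m * U (m + k))) + dsum (\<lambda>m k. f k * (U (m + k) * U m))"
    by (subst dsum_split) (auto intro!: K gb simp: f0)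
  also have "dsum (\<lambda>m k. f k * (U (m + k) * U m)) = dsum (\<lambda>m k. f k * (U m * U (m + k)))"
    by (simp add: mult_ac)
  also have "dsum (\<lambda>m k. f k * (U m * U (m + k))) = dsum (\<lambda>m k. f m * (U k * U (m + k)))"
    by (subst dsum_swap[symmetric]) (simp add: add.commute)
  also have "\<dots> = dsum (\<lambda>m k. f m * (U m * U k) +
      ((-1) * (f m * (U m * U (m + k))) + (-1) * (f m * U (m + k))))"
    by (rule dsum_cong) (simp add: U_def lu_mult_shift[OF q] algebra_simps)
  also have "\<dots> = dsum (\<lambda>m k. f m * (U m * U k)) - dsum (\<lambda>m k. f m * (U m * U (m + k)))
      - dsum (\<lambda>m k. f m * U (m + k))"
    by (intro dsum_add3(2) K gm gb le_add1)
  \<comment> \<open>A second split. Its first part cancels the negative quadratic sum just produced,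
    and its second part is the quadratic sum of \<open>L1\<close>, which disappears from the
    difference.\<close>
  also have "dsum (\<lambda>m k. f m * (U m * U k)) = dsum (\<lambda>m k. f m * (U m * U (m + k))) +
     dsum (\<lambda>m k. f (m + k) * (U m * U (m + k))) + (\<Sum>\<^sub>\<infinity>m\<in>{1..}. f m * U m ^ 2)"
    by (subst dsum_split, rule K) (auto intro!: gb simp: mult_ac power2_eq_square)
  finally show ?thesis using L1 by simp
qed

lemma lambert_square_plus:
  fixes f :: "nat \<Rightarrow> complex"
  assumes q: "norm q < 1" and f0: "f 0 = 0" and f: "\<And>n. norm (f n) \<le> real n ^ p"
  defines "U \<equiv> lu q"
  shows "dsum (\<lambda>j k. (of_nat (j * k) * f (j + k)) * (U j * U k)) +
         dsum (\<lambda>j k. (of_nat (j * k) * f (nat \<bar>int j - int k\<bar>)) * (U j * U k)) =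
     dsum (\<lambda>j k. (of_nat (j * k) * f (j + k)) * U (j + k)) +
     4 * dsum (\<lambda>j k. (of_nat (j * k) * f j) * (U j * U k))
      - 2 * dsum (\<lambda>j k. (of_nat (k * (j + k)) * f j) * U (j + k))"
proof -
  note gb = geo_bounded_lu_mult[OF q, folded U_def] geo_bounded_lu_sum[OF q, folded U_def]
  have lm: "U j * U k = U (j + k) * (1 + U j + U k)" if "j > 0" "k > 0" for j k
    unfolding U_def by (rule lu_mult[OF q that])
  note gm = geo_bounded_mult_lu[OF q, folded U_def]
  have mono: "norm (f m) \<le> real n ^ p" if "m \<le> n" for m n
    using f[of m] power_mono[of "real m" "real n" p] that by simp
  have K: "geo_bounded (\<lambda>j k. (of_nat (c j k) * f (h j k)) * g j k)"
    if "geo_bounded g" "\<And>j k. h j k \<le> j + k" "\<And>j k. c j k \<le> (j + k) ^ 2" for g h c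
  proof (rule geo_bounded_kernel[where p = "2 + p"])
    show "norm (of_nat (c j k) * f (h j k)) \<le> real (j + k) ^ (2 + p)" for j k
      using that(3)[of j k] mono[OF that(2)[of j k]]
      unfolding power_add norm_mult norm_of_nat
      by (intro mult_mono) (auto simp flip: of_nat_add of_nat_power)
  qed (rule that)
  have le: "j * k \<le> (j + k)\<^sup>2" "k * (j + k) \<le> (j + k)\<^sup>2" "j * (j + k) \<le> (j + k)\<^sup>2"  "k * k \<le> (j + k)\<^sup>2" for j k :: nat
    by (auto simp: power2_eq_square algebra_simps)
  have "dsum (\<lambda>j k. (of_nat (j * k) * f (j + k)) * (U j * U k)) =
     dsum (\<lambda>j k. (of_nat (j * k) * f (j + k)) * U (j + k) +
        ((of_nat (j * k) * f (j + k)) * (U j * U (j + k)) + (of_nat (j * k) * f (j + k)) * (U k * U (j + k))))"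
    by (rule dsum_cong, subst lm) (simp_all add: algebra_simps)
  also have "\<dots> = dsum (\<lambda>j k. (of_nat (j * k) * f (j + k)) * U (j + k)) +
     (dsum (\<lambda>j k. (of_nat (j * k) * f (j + k)) * (U j * U (j + k))) +
      dsum (\<lambda>j k. (of_nat (j * k) * f (j + k)) * (U k * U (j + k))))"
    by (intro dsum_add3(1) K gm gb order_refl le)
  also have "dsum (\<lambda>j k. (of_nat (j * k) * f (j + k)) * (U k * U (j + k))) =
      dsum (\<lambda>j k. (of_nat (j * k) * f (j + k)) * (U j * U (j + k)))"
    by (subst dsum_swap[symmetric]) (simp add: add.commute mult.commute)
  finally have L1: "dsum (\<lambda>j k. (of_nat (j * k) * f (j + k)) * (U j * U k)) =
    dsum (\<lambda>j k. (of_nat (j * k) * f (j + k)) * U (j + k)) +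
    2 * dsum (\<lambda>j k. (of_nat (j * k) * f (j + k)) * (U j * U (j + k)))" by simp
  have "dsum (\<lambda>j k. (of_nat (j * k) * f (nat \<bar>int j - int k\<bar>)) * (U j * U k)) =
     dsum (\<lambda>m k. (of_nat (m * (m + k)) * f k) * (U m * U (m + k))) +
     dsum (\<lambda>m k. (of_nat ((m + k) * m) * f k) * (U (m + k) * U m))"
    by (subst dsum_split, rule K) (auto intro!: K gb le simp: f0)
  also have "dsum (\<lambda>m k. (of_nat ((m + k) * m) * f k) * (U (m + k) * U m)) =
     dsum (\<lambda>m k. (of_nat (m * (m + k)) * f k) * (U m * U (m + k)))"
    by (simp add: mult_ac)
  also have "dsum (\<lambda>m k. (of_nat (m * (m + k)) * f k) * (U m * U (m + k))) =
     dsum (\<lambda>m k. (of_nat (k * (m + k)) * f m) * (U k * U (m + k)))"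
    by (subst dsum_swap[symmetric]) (simp add: add.commute)
  also have "\<dots> = dsum (\<lambda>m k. (of_nat (k * (m + k)) * f m) * (U m * U k) +
      ((-1) * ((of_nat (k * (m + k)) * f m) * (U m * U (m + k))) +
       (-1) * ((of_nat (k * (m + k)) * f m) * U (m + k))))"
    by (rule dsum_cong) (simp add: U_def lu_mult_shift[OF q] algebra_simps)
  also have "\<dots> = dsum (\<lambda>m k. (of_nat (k * (m + k)) * f m) * (U m * U k)) -
      dsum (\<lambda>m k. (of_nat (k * (m + k)) * f m) * (U m * U (m + k)))
      - dsum (\<lambda>m k. (of_nat (k * (m + k)) * f m) * U (m + k))"
    by (intro dsum_add3(2) K gm gb le_add1 le)
  \<comment> \<open>The weight is written as k (m + k) = 2 m k + k (k - m). The second summand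
    vanishes for k = m, so splitting it leaves no diagonal series. Of its two other parts one
    cancels the negative quadratic sum, and the other is the negative of the quadratic sum in
    \<open>L1\<close>; hence the two series are added here, whereas they were subtracted
    before.\<close>
  also have "dsum (\<lambda>m k. (of_nat (k * (m + k)) * f m) * (U m * U k)) =
     dsum (\<lambda>m k. 2 * ((of_nat (m * k) * f m) * (U m * U k)) +
       ((of_nat (k * k) * f m) * (U m * U k) + (-1) * ((of_nat (m * k) * f m) * (U m * U k))))"
    by (rule dsum_cong) (simp add: algebra_simps)
  also have "\<dots> = 2 * dsum (\<lambda>m k. (of_nat (m * k) * f m) * (U m * U k)) +
     dsum (\<lambda>m k. (of_nat (k * k) * f m) * (U m * U k) + (-1) * ((of_nat (m * k) * f m) * (U m * U k)))"
    by (intro dsum_add3(3) K gm gb le_add1 le)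
  also have "dsum (\<lambda>m k. (of_nat (k * k) * f m) * (U m * U k) + (-1) * ((of_nat (m * k) * f m) * (U m * U k))) =
     dsum (\<lambda>m k. (of_nat (k * (m + k)) * f m) * (U m * U (m + k))) +
     dsum (\<lambda>m k. (-1) * ((of_nat (m * k) * f (m + k)) * (U m * U (m + k))))"
  proof (subst dsum_split)
    show "geo_bounded (\<lambda>m k. (of_nat (k * k) * f m) * (U m * U k) + (-1) * ((of_nat (m * k) * f m) * (U m * U k)))"
      by (intro geo_bounded_add geo_bounded_cmult K gm gb le_add1 le)
    have 1: "dsum (\<lambda>m k. of_nat ((m + k) * (m + k)) * f m * (U m * U (m + k)) + -1 * (of_nat (m * (m + k)) * f m * (U m * U (m + k)))) =
      dsum (\<lambda>m k. (of_nat (k * (m + k)) * f m) * (U m * U (m + k)))"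
      by (rule dsum_cong) (simp add: algebra_simps)
    have 2: "dsum (\<lambda>m k. of_nat (m * m) * f (m + k) * (U (m + k) * U m) + -1 * (of_nat ((m + k) * m) * f (m + k) * (U (m + k) * U m))) =
     dsum (\<lambda>m k. (-1) * ((of_nat (m * k) * f (m + k)) * (U m * U (m + k))))"
      by (rule dsum_cong) (simp add: algebra_simps)
    show "dsum (\<lambda>m k. of_nat ((m + k) * (m + k)) * f m * (U m * U (m + k)) + -1 * (of_nat (m * (m + k)) * f m * (U m * U (m + k)))) +
     dsum (\<lambda>m k. of_nat (m * m) * f (m + k) * (U (m + k) * U m) + -1 * (of_nat ((m + k) * m) * f (m + k) * (U (m + k) * U m))) +
     (\<Sum>\<^sub>\<infinity>m\<in>{1..}. of_nat (m * m) * f m * (U m * U m) + -1 * (of_nat (m * m) * f m * (U m * U m))) =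
     dsum (\<lambda>m k. (of_nat (k * (m + k)) * f m) * (U m * U (m + k))) +
     dsum (\<lambda>m k. (-1) * ((of_nat (m * k) * f (m + k)) * (U m * U (m + k))))"
      unfolding 1 2 by simp
  qed
  also have "dsum (\<lambda>m k. (-1) * ((of_nat (m * k) * f (m + k)) * (U m * U (m + k)))) =
      - dsum (\<lambda>m k. (of_nat (m * k) * f (m + k)) * (U m * U (m + k)))"
    by (subst dsum_cmult) simp
  finally show ?thesis using L1 by simp
qed

section \<open>Lambert series and Ramanujan's quadratic identities\<close>

definition lambert :: "nat \<Rightarrow> complex \<Rightarrow> complex" where
  "lambert s q = (\<Sum>\<^sub>\<infinity>n\<in>{1..}. of_nat n ^ s * lu q n)"

text \<open>This is the Euler derivative q d/dq of \<open>lambert s\<close>, since it takes u_n to n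
  (u_n + u_n^2).\<close>

definition lambert_deriv :: "nat \<Rightarrow> complex \<Rightarrow> complex" where
  "lambert_deriv s q = (\<Sum>\<^sub>\<infinity>n\<in>{1..}. of_nat n ^ Suc s * (lu q n + lu q n ^ 2))"

lemma summable_lu:
  assumes "norm q < 1"
  shows "(\<lambda>n. of_nat n ^ s * lu q n) summable_on A"
proof -
  obtain \<rho> where \<rho>: "norm q < \<rho>" "\<rho> < 1" using dense assms by blast
  obtain D where D: "D \<ge> 0" "\<And>n. real n ^ s * norm q ^ n \<le> D * \<rho> ^ n"
    using poly_geometric_bounded[OF _ \<rho>(1)] by (metis norm_ge_zero)
  have "norm (of_nat n ^ s * lu q n) \<le> (D / (1 - norm q)) * \<rho> ^ n" for n
  proof -
    have "norm (of_nat n ^ s * lu q n) \<le> real n ^ s * (norm q ^ n / (1 - norm q))"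
      unfolding norm_mult norm_power norm_of_nat by (intro mult_left_mono norm_lu_le assms) auto
    also have "\<dots> \<le> D * \<rho> ^ n / (1 - norm q)"
      using D(2)[of n] assms by (simp add: divide_right_mono)
    finally show ?thesis by simp
  qed
  moreover have "(\<lambda>n. (D / (1 - norm q)) * \<rho> ^ n) summable_on UNIV"
    using \<rho> order.strict_trans1[OF norm_ge_zero \<rho>(1)]
    by (intro summable_on_cmult_right norm_summable_imp_summable_on) (auto intro!: summable_geometric)
  ultimately have "(\<lambda>n. norm (of_nat n ^ s * lu q n)) summable_on UNIV"
    by (intro Infinite_Sum.abs_summable_on_comparison_test') auto
  then have "(\<lambda>n. of_nat n ^ s * lu q n) summable_on UNIV" by (rule abs_summable_summable)
  then show ?thesis by (rule summable_on_subset_banach) auto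
qed

lemma has_sum_lambert:
  assumes "norm q < 1"
  shows "((\<lambda>n. of_nat n ^ s * lu q n) has_sum lambert s q) {1..}"
  unfolding lambert_def using summable_lu[OF assms] by (rule has_sum_infsum)

lemma infsum_lu_square:
  assumes "norm q < 1"
  shows "(\<Sum>\<^sub>\<infinity>n\<in>{1..}. of_nat n ^ Suc s * lu q n ^ 2) = lambert_deriv s q - lambert (Suc s) q"
proof -
  have "geo_bounded (\<lambda>j k. of_nat j ^ Suc s * (lu q j * lu q k))"
    by (intro geo_bounded_nat1 geo_bounded_lu_mult assms)
  from geo_bounded_diag_summable[OF this]
  have "(\<lambda>n. of_nat n ^ Suc s * lu q n ^ 2) summable_on {1..}" by (simp add: power2_eq_square)
  then have "(\<Sum>\<^sub>\<infinity>n\<in>{1..}. of_nat n ^ Suc s * lu q n + of_nat n ^ Suc s * lu q n ^ 2) =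
    lambert (Suc s) q + (\<Sum>\<^sub>\<infinity>n\<in>{1..}. of_nat n ^ Suc s * lu q n ^ 2)"
    unfolding lambert_def by (intro infsum_add summable_lu assms)
  then show ?thesis unfolding lambert_deriv_def by (simp add: distrib_left)
qed

lemma dsum_lu_mult:
  assumes "norm q < 1"
  shows "dsum (\<lambda>j k. of_nat j ^ a * of_nat k ^ b * (lu q j * lu q k)) = lambert a q * lambert b q"
proof -
  have "geo_bounded (\<lambda>j k. of_nat j ^ a * (of_nat k ^ b * (lu q j * lu q k)))"
    by (intro geo_bounded_nat1 geo_bounded_nat2 geo_bounded_lu_mult assms)
  then have "geo_bounded (\<lambda>j k. (of_nat j ^ a * lu q j) * (of_nat k ^ b * lu q k))"
    by (simp add: mult_ac)
  from dsum_mult[OF this] show ?thesis unfolding lambert_def by (simp add: mult_ac)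
qed

lemma geo_bounded_nat_lu_mult:
  assumes "norm q < 1"
  shows "geo_bounded (\<lambda>j k. of_nat j ^ a * of_nat k ^ b * (lu q j * lu q k))"
  using geo_bounded_nat1[OF geo_bounded_nat2[OF geo_bounded_lu_mult[OF assms]]] by (simp add: mult.assoc)

text \<open>Faulhaber's formulas with the endpoint l left out, which makes the term l^p / 2
  negative.\<close>

lemma sum_powers:
  "(\<Sum>j\<in>{1..<l}. of_nat j ^ 4 :: complex) = of_nat l ^ 5 / 5 - of_nat l ^ 4 / 2 + of_nat l ^ 3 / 3 - of_nat l / 30"
  "(\<Sum>j\<in>{1..<l}. of_nat j ^ 5 :: complex) = of_nat l ^ 6 / 6 - of_nat l ^ 5 / 2 + 5 * of_nat l ^ 4 / 12 - of_nat l ^ 2 / 12"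
  "(\<Sum>j\<in>{1..<l}. of_nat j ^ 6 :: complex) =
     of_nat l ^ 7 / 7 - of_nat l ^ 6 / 2 + of_nat l ^ 5 / 2 - of_nat l ^ 3 / 6 + of_nat l / 42"
proof -
  have S: "(\<Sum>j\<in>{1..<Suc l}. of_nat j ^ p :: complex) = (\<Sum>j\<in>{1..<l}. of_nat j ^ p) + of_nat l ^ p"
    if "p > 0" for p l using that by (cases l) auto
  show "(\<Sum>j\<in>{1..<l}. of_nat j ^ 4 :: complex) = of_nat l ^ 5 / 5 - of_nat l ^ 4 / 2 + of_nat l ^ 3 / 3 - of_nat l / 30"
    by (induction l) (simp, simp only: S zero_less_numeral, simp add: field_simps eval_nat_numeral)
  show "(\<Sum>j\<in>{1..<l}. of_nat j ^ 5 :: complex) = of_nat l ^ 6 / 6 - of_nat l ^ 5 / 2 + 5 * of_nat l ^ 4 / 12 - of_nat l ^ 2 / 12"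
    by (induction l) (simp, simp only: S zero_less_numeral, simp add: field_simps eval_nat_numeral)
  show "(\<Sum>j\<in>{1..<l}. of_nat j ^ 6 :: complex) =
     of_nat l ^ 7 / 7 - of_nat l ^ 6 / 2 + of_nat l ^ 5 / 2 - of_nat l ^ 3 / 6 + of_nat l / 42"
    by (induction l) (simp, simp only: S zero_less_numeral, simp add: field_simps eval_nat_numeral)
qed

lemma dsum_kernel_lu:
  assumes "norm q < 1" "\<And>j k. norm (h j k) \<le> real (j + k) ^ p"
  shows "dsum (\<lambda>j k. h j k * lu q (j + k)) = (\<Sum>\<^sub>\<infinity>l\<in>{1..}. (\<Sum>j\<in>{1..<l}. h j (l - j)) * lu q l)"
proof -
  have "geo_bounded (\<lambda>j k. h j k * lu q (j + k))"
    by (rule geo_bounded_kernel[OF geo_bounded_lu_sum[OF assms(1)] assms(2)])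
  then show ?thesis using dsum_antidiagonal[of "\<lambda>j l. h j (l - j) * lu q l"]
    by (simp add: sum_distrib_right)
qed

lemma has_sum_lambert_cmult:
  "norm q < 1 \<Longrightarrow> ((\<lambda>n. c * (of_nat n ^ s * lu q n)) has_sum c * lambert s q) {1..}"
  by (intro has_sum_cmult_right has_sum_lambert)

context
  fixes q :: complex
  assumes q: "norm q < 1"
begin

text \<open>For even p, choosing f(n) = n^p extracts a Taylor coefficient in \<theta> from the
  identity for the cotangent.\<close>

lemma lambert_square_minus_power:
  assumes "p > 0"
  shows "dsum (\<lambda>j k. (of_nat (j + k) ^ p - of_nat (nat \<bar>int j - int k\<bar>) ^ p) * (lu q j * lu q k)) =
    (\<Sum>\<^sub>\<infinity>l\<in>{1..}. (\<Sum>j\<in>{1..<l}. of_nat l ^ p) * lu q l) +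
    2 * (\<Sum>\<^sub>\<infinity>l\<in>{1..}. (\<Sum>j\<in>{1..<l}. of_nat j ^ p) * lu q l)
    - 2 * (\<Sum>\<^sub>\<infinity>m\<in>{1..}. of_nat m ^ p * lu q m ^ 2)"
proof -
  have K: "geo_bounded (\<lambda>j k. of_nat (h j k) ^ p * (lu q j * lu q k))" if "\<And>j k. h j k \<le> j + k" for h
    by (rule geo_bounded_kernel[OF geo_bounded_lu_mult[OF q], where p = p])
      (use that in \<open>auto simp: norm_power intro!: power_mono simp flip: of_nat_add\<close>)
  have "dsum (\<lambda>j k. of_nat (j + k) ^ p * (lu q j * lu q k) +
             (-1) * (of_nat (nat \<bar>int j - int k\<bar>) ^ p * (lu q j * lu q k))) =
     dsum (\<lambda>j k. of_nat (j + k) ^ p * (lu q j * lu q k)) -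
     dsum (\<lambda>j k. of_nat (nat \<bar>int j - int k\<bar>) ^ p * (lu q j * lu q k))"
    by (subst dsum_add, rule K, simp, rule geo_bounded_cmult, rule K) (auto simp only: dsum_cmult, simp)
  then have "dsum (\<lambda>j k. (of_nat (j + k) ^ p - of_nat (nat \<bar>int j - int k\<bar>) ^ p) * (lu q j * lu q k)) =
     dsum (\<lambda>j k. of_nat (j + k) ^ p * (lu q j * lu q k)) -
     dsum (\<lambda>j k. of_nat (nat \<bar>int j - int k\<bar>) ^ p * (lu q j * lu q k))"
    by (simp add: algebra_simps)
  also have "\<dots> = dsum (\<lambda>j k. of_nat (j + k) ^ p * lu q (j + k)) + 2 * dsum (\<lambda>j k. of_nat j ^ p * lu q (j + k))
      - 2 * (\<Sum>\<^sub>\<infinity>m\<in>{1..}. of_nat m ^ p * lu q m ^ 2)"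
    by (rule lambert_square_minus[where p = p]) (use q assms in \<open>auto simp: norm_power\<close>)
  also have "dsum (\<lambda>j k. of_nat (j + k) ^ p * lu q (j + k)) =
      (\<Sum>\<^sub>\<infinity>l\<in>{1..}. (\<Sum>j\<in>{1..<l}. of_nat (j + (l - j)) ^ p) * lu q l)"
    by (rule dsum_kernel_lu[OF q, where p = p]) (simp add: norm_power flip: of_nat_add)
  also have "\<dots> = (\<Sum>\<^sub>\<infinity>l\<in>{1..}. (\<Sum>j\<in>{1..<l}. of_nat l ^ p) * lu q l)"
    by (intro infsum_cong arg_cong2[where f = "(*)"] sum.cong) auto
  also have "dsum (\<lambda>j k. of_nat j ^ p * lu q (j + k)) = (\<Sum>\<^sub>\<infinity>l\<in>{1..}. (\<Sum>j\<in>{1..<l}. of_nat j ^ p) * lu q l)"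
    by (rule dsum_kernel_lu[OF q, where p = p]) (simp add: norm_power power_mono)
  finally show ?thesis .
qed

lemma of_nat_nat_abs_even_power:
  "even p \<Longrightarrow> (of_nat (nat \<bar>int j - int k\<bar>) :: complex) ^ p = (of_nat j - of_nat k) ^ p"
proof -
  assume p: "even p"
  have "(of_nat (nat \<bar>int j - int k\<bar>) :: complex) = of_int \<bar>int j - int k\<bar>" by simp
  also have "\<dots> ^ p = of_int (\<bar>int j - int k\<bar> ^ p)" by simp
  also have "\<bar>int j - int k\<bar> ^ p = (int j - int k) ^ p" by (rule power_even_abs[OF p])
  finally show ?thesis by simp
qed

text \<open>The kernel (j + k)^4 - (j - k)^4 = 8 j k^3 + 8 j^3 k produces the left side. On the
  right the three occurrences of \<open>lambert 4\<close> cancel.\<close>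

lemma lambert_1_3:
  "16 * lambert 1 q * lambert 3 q = 7/5 * lambert 5 q + 2/3 * lambert 3 q - lambert 1 q / 15 - 2 * lambert_deriv 3 q"
proof -
  note hs = has_sum_lambert_cmult[OF q]
  note gb = geo_bounded_nat_lu_mult[OF q]
  have "dsum (\<lambda>j k. (of_nat (j + k) ^ 4 - of_nat (nat \<bar>int j - int k\<bar>) ^ 4) * (lu q j * lu q k)) =
    dsum (\<lambda>j k. 8 * (of_nat j ^ 1 * of_nat k ^ 3 * (lu q j * lu q k)) +
        8 * (of_nat j ^ 3 * of_nat k ^ 1 * (lu q j * lu q k)))"
    by (rule dsum_cong, subst of_nat_nat_abs_even_power) (simp, simp add: eval_nat_numeral algebra_simps)
  also have "\<dots> = 16 * lambert 1 q * lambert 3 q"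
    by (subst dsum_add) (intro geo_bounded_cmult gb, intro geo_bounded_cmult gb, simp only: dsum_cmult dsum_lu_mult[OF q], simp)
  finally have L: "16 * lambert 1 q * lambert 3 q =
    dsum (\<lambda>j k. (of_nat (j + k) ^ 4 - of_nat (nat \<bar>int j - int k\<bar>) ^ 4) * (lu q j * lu q k))" ..
  have "((\<lambda>l. (\<Sum>j\<in>{1..<l}. of_nat l ^ 4) * lu q l) has_sum
     (1 * lambert 5 q + (-1) * lambert 4 q)) {1..}"
    by (rule has_sum_cong[THEN iffD1, OF _ has_sum_add[OF hs hs]])
      (simp add: of_nat_diff algebra_simps eval_nat_numeral)
  then have 1: "(\<Sum>\<^sub>\<infinity>l\<in>{1..}. (\<Sum>j\<in>{1..<l}. of_nat l ^ 4) * lu q l) = 1 * lambert 5 q + (-1) * lambert 4 q"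
    by (rule infsumI)
  have "((\<lambda>l. (\<Sum>j\<in>{1..<l}. of_nat j ^ 4) * lu q l) has_sum
     (1/5 * lambert 5 q + (-1/2) * lambert 4 q + 1/3 * lambert 3 q + (-1/30) * lambert 1 q)) {1..}"
    by (rule has_sum_cong[THEN iffD1, OF _ has_sum_add[OF has_sum_add[OF has_sum_add[OF hs hs] hs] hs]])
      (simp only: sum_powers, simp add: algebra_simps)
  then have 2: "(\<Sum>\<^sub>\<infinity>l\<in>{1..}. (\<Sum>j\<in>{1..<l}. of_nat j ^ 4) * lu q l) =
      1/5 * lambert 5 q + (-1/2) * lambert 4 q + 1/3 * lambert 3 q + (-1/30) * lambert 1 q" by (rule infsumI)
  have 3: "(\<Sum>\<^sub>\<infinity>m\<in>{1..}. of_nat m ^ 4 * lu q m ^ 2) = lambert_deriv 3 q - lambert 4 q"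
    using infsum_lu_square[OF q, of 3] by simp
  show ?thesis unfolding L
    by (subst lambert_square_minus_power, simp, subst 1, subst 2, subst 3, simp add: algebra_simps)
qed

text \<open>The same with (j + k)^6 - (j - k)^6. The middle term 40 j^3 k^3 brings in the square of
  \<open>lambert 3\<close>, so this identity alone does not yet give the derivative of E_6.\<close>

lemma lambert_1_5:
  "24 * lambert 1 q * lambert 5 q + 40 * lambert 3 q ^ 2 =
     9/7 * lambert 7 q + lambert 5 q - lambert 3 q / 3 + lambert 1 q / 21 - 2 * lambert_deriv 5 q"
proof -
  note hs = has_sum_lambert_cmult[OF q]
  note gb = geo_bounded_nat_lu_mult[OF q]
  have "dsum (\<lambda>j k. (of_nat (j + k) ^ 6 - of_nat (nat \<bar>int j - int k\<bar>) ^ 6) * (lu q j * lu q k)) =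
    dsum (\<lambda>j k. 12 * (of_nat j ^ 1 * of_nat k ^ 5 * (lu q j * lu q k)) +
        (12 * (of_nat j ^ 5 * of_nat k ^ 1 * (lu q j * lu q k)) + 40 * (of_nat j ^ 3 * of_nat k ^ 3 * (lu q j * lu q k))))"
    by (rule dsum_cong, subst of_nat_nat_abs_even_power) (simp, simp add: eval_nat_numeral algebra_simps)
  also have "\<dots> = 24 * lambert 1 q * lambert 5 q + 40 * lambert 3 q ^ 2"
    by (subst dsum_add3(1)) (intro geo_bounded_cmult gb, intro geo_bounded_cmult gb,
        intro geo_bounded_cmult gb, simp only: dsum_cmult dsum_lu_mult[OF q], simp add: power2_eq_square)
  finally have L: "24 * lambert 1 q * lambert 5 q + 40 * lambert 3 q ^ 2 =
    dsum (\<lambda>j k. (of_nat (j + k) ^ 6 - of_nat (nat \<bar>int j - int k\<bar>) ^ 6) * (lu q j * lu q k))" ..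
  have "((\<lambda>l. (\<Sum>j\<in>{1..<l}. of_nat l ^ 6) * lu q l) has_sum
     (1 * lambert 7 q + (-1) * lambert 6 q)) {1..}"
    by (rule has_sum_cong[THEN iffD1, OF _ has_sum_add[OF hs hs]])
      (simp add: of_nat_diff algebra_simps eval_nat_numeral)
  then have 1: "(\<Sum>\<^sub>\<infinity>l\<in>{1..}. (\<Sum>j\<in>{1..<l}. of_nat l ^ 6) * lu q l) = 1 * lambert 7 q + (-1) * lambert 6 q"
    by (rule infsumI)
  have "((\<lambda>l. (\<Sum>j\<in>{1..<l}. of_nat j ^ 6) * lu q l) has_sum
     (1/7 * lambert 7 q + (-1/2) * lambert 6 q + 1/2 * lambert 5 q + (-1/6) * lambert 3 q + 1/42 * lambert 1 q)) {1..}"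
    by (rule has_sum_cong[THEN iffD1, OF _ has_sum_add[OF has_sum_add[OF has_sum_add[OF has_sum_add[OF hs hs] hs] hs] hs]])
      (simp only: sum_powers, simp add: algebra_simps)
  then have 2: "(\<Sum>\<^sub>\<infinity>l\<in>{1..}. (\<Sum>j\<in>{1..<l}. of_nat j ^ 6) * lu q l) =
      1/7 * lambert 7 q + (-1/2) * lambert 6 q + 1/2 * lambert 5 q + (-1/6) * lambert 3 q + 1/42 * lambert 1 q" by (rule infsumI)
  have 3: "(\<Sum>\<^sub>\<infinity>m\<in>{1..}. of_nat m ^ 6 * lu q m ^ 2) = lambert_deriv 5 q - lambert 6 q"
    using infsum_lu_square[OF q, of 5] by simp
  show ?thesis unfolding L
    by (subst lambert_square_minus_power, simp, subst 1, subst 2, subst 3, simp add: algebra_simps)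
qed

lemma sum_mult_diff:
  "(\<Sum>j\<in>{1..<l}. of_nat (j * (l - j)) :: complex) = of_nat l ^ 3 / 6 - of_nat l / 6"
  "(\<Sum>j\<in>{1..<l}. of_nat ((l - j) * l) * of_nat j ^ 4 :: complex) = of_nat l ^ 7 / 30 - of_nat l ^ 5 / 12 + of_nat l ^ 3 / 20"
proof -
  have S: "(\<Sum>j\<in>{1..<Suc l}. f j :: complex) = (\<Sum>j\<in>{1..<l}. f j) + f l" if "f 0 = 0" for f l
    using that by (cases l) auto
  have a: "(\<Sum>j\<in>{1..<l}. of_nat j :: complex) = of_nat l ^ 2 / 2 - of_nat l / 2"
    by (induction l) (simp, subst S, simp, simp only:, simp add: field_simps eval_nat_numeral)
  have b: "(\<Sum>j\<in>{1..<l}. of_nat j ^ 2 :: complex) = of_nat l ^ 3 / 3 - of_nat l ^ 2 / 2 + of_nat l / 6"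
    by (induction l) (simp, subst S, simp, simp only:, simp add: field_simps eval_nat_numeral)
  have "(\<Sum>j\<in>{1..<l}. of_nat (j * (l - j)) :: complex) = (\<Sum>j\<in>{1..<l}. of_nat l * of_nat j - of_nat j ^ 2)"
    by (intro sum.cong) (auto simp: of_nat_diff algebra_simps power2_eq_square)
  also have "\<dots> = of_nat l ^ 3 / 6 - of_nat l / 6"
    unfolding sum_subtractf sum_distrib_left[symmetric] a b by (simp add: field_simps eval_nat_numeral)
  finally show "(\<Sum>j\<in>{1..<l}. of_nat (j * (l - j)) :: complex) = of_nat l ^ 3 / 6 - of_nat l / 6" .
  have "(\<Sum>j\<in>{1..<l}. of_nat ((l - j) * l) * of_nat j ^ 4 :: complex) =
     (\<Sum>j\<in>{1..<l}. of_nat l ^ 2 * of_nat j ^ 4 - of_nat l * of_nat j ^ 5)"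
    by (intro sum.cong) (auto simp: of_nat_diff algebra_simps eval_nat_numeral)
  also have "\<dots> = of_nat l ^ 7 / 30 - of_nat l ^ 5 / 12 + of_nat l ^ 3 / 20"
    unfolding sum_subtractf sum_distrib_left[symmetric] sum_powers by (simp add: field_simps eval_nat_numeral)
  finally show "(\<Sum>j\<in>{1..<l}. of_nat ((l - j) * l) * of_nat j ^ 4 :: complex) =
    of_nat l ^ 7 / 30 - of_nat l ^ 5 / 12 + of_nat l ^ 3 / 20" .
qed

text \<open>This is E_4^2 = E_8, where E_8 = 1 + 480 sum sigma_7(n) q^n. The kernel j k ((j + k)^4 +
  (j - k)^4) contains j k^5 and j^5 k, but the product of \<open>lambert 1\<close> and
  \<open>lambert 5\<close> occurs with coefficient 4 on both sides and cancels.\<close>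

lemma lambert_3_3: "120 * lambert 3 q ^ 2 = lambert 7 q - lambert 3 q"
proof -
  note hs = has_sum_lambert_cmult[OF q]
  note gb = geo_bounded_nat_lu_mult[OF q]
  have pm: "norm (of_nat a * of_nat b ^ 4 :: complex) \<le> real (j + k) ^ 6" if "a \<le> (j + k) ^ 2" "b \<le> j + k" for a b j k :: nat
  proof -
    have "a * b ^ 4 \<le> (j + k) ^ 2 * (j + k) ^ 4" using that by (intro mult_mono power_mono) auto
    also have "\<dots> = (j + k) ^ 6" by (simp flip: power_add)
    finally have "real (a * b ^ 4) \<le> real ((j + k) ^ 6)" by (simp only: of_nat_le_iff)
    then show ?thesis by (simp add: norm_mult norm_power)
  qed
  have le: "j * k \<le> (j + k)\<^sup>2" "k * (j + k) \<le> (j + k)\<^sup>2" for j k :: nat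
    by (auto simp: power2_eq_square algebra_simps)
  have K: "geo_bounded (\<lambda>j k. (of_nat (j * k) * of_nat (h j k) ^ 4) * (lu q j * lu q k))" if "\<And>j k. h j k \<le> j + k" for h
    by (rule geo_bounded_kernel[OF geo_bounded_lu_mult[OF q], where p = 6], rule pm) (use that le in auto)
  have "dsum (\<lambda>j k. (of_nat (j * k) * of_nat (j + k) ^ 4) * (lu q j * lu q k)) +
        dsum (\<lambda>j k. (of_nat (j * k) * of_nat (nat \<bar>int j - int k\<bar>) ^ 4) * (lu q j * lu q k)) =
        dsum (\<lambda>j k. (of_nat (j * k) * of_nat (j + k) ^ 4) * (lu q j * lu q k) +
          (of_nat (j * k) * of_nat (nat \<bar>int j - int k\<bar>) ^ 4) * (lu q j * lu q k))"
    by (rule dsum_add[symmetric]; rule K) auto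
  also have "\<dots> = dsum (\<lambda>j k. 2 * (of_nat j ^ 1 * of_nat k ^ 5 * (lu q j * lu q k)) +
        (2 * (of_nat j ^ 5 * of_nat k ^ 1 * (lu q j * lu q k)) + 12 * (of_nat j ^ 3 * of_nat k ^ 3 * (lu q j * lu q k))))"
    by (rule dsum_cong, subst of_nat_nat_abs_even_power) (simp, simp add: eval_nat_numeral algebra_simps)
  also have "\<dots> = 4 * lambert 1 q * lambert 5 q + 12 * lambert 3 q ^ 2"
    by (subst dsum_add3(1)) (intro geo_bounded_cmult gb, intro geo_bounded_cmult gb,
        intro geo_bounded_cmult gb, simp only: dsum_cmult dsum_lu_mult[OF q], simp add: power2_eq_square)
  finally have L: "4 * lambert 1 q * lambert 5 q + 12 * lambert 3 q ^ 2 =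
     dsum (\<lambda>j k. (of_nat (j * k) * of_nat (j + k) ^ 4) * (lu q j * lu q k)) +
        dsum (\<lambda>j k. (of_nat (j * k) * of_nat (nat \<bar>int j - int k\<bar>) ^ 4) * (lu q j * lu q k))" ..
  also have "\<dots> = dsum (\<lambda>j k. (of_nat (j * k) * of_nat (j + k) ^ 4) * lu q (j + k)) +
     4 * dsum (\<lambda>j k. (of_nat (j * k) * of_nat j ^ 4) * (lu q j * lu q k))
      - 2 * dsum (\<lambda>j k. (of_nat (k * (j + k)) * of_nat j ^ 4) * lu q (j + k))"
    by (rule lambert_square_plus[where p = 4]) (use q in \<open>auto simp: norm_power\<close>)
  also have "dsum (\<lambda>j k. (of_nat (j * k) * of_nat j ^ 4) * (lu q j * lu q k)) =
     dsum (\<lambda>j k. of_nat j ^ 5 * of_nat k ^ 1 * (lu q j * lu q k))"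
    by (rule dsum_cong) (simp add: eval_nat_numeral)
  also have "\<dots> = lambert 5 q * lambert 1 q" by (rule dsum_lu_mult[OF q])
  also have "dsum (\<lambda>j k. (of_nat (j * k) * of_nat (j + k) ^ 4) * lu q (j + k)) =
      (\<Sum>\<^sub>\<infinity>l\<in>{1..}. (\<Sum>j\<in>{1..<l}. of_nat (j * (l - j)) * of_nat (j + (l - j)) ^ 4) * lu q l)"
    by (rule dsum_kernel_lu[OF q, where p = 6], rule pm) (use le in auto)
  also have "\<dots> = (\<Sum>\<^sub>\<infinity>l\<in>{1..}. ((\<Sum>j\<in>{1..<l}. of_nat (j * (l - j))) * of_nat l ^ 4) * lu q l)"
    unfolding sum_distrib_right by (intro infsum_cong arg_cong2[where f = "(*)"] sum.cong) auto
  also have "\<dots> = 1/6 * lambert 7 q + (-1/6) * lambert 5 q"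
    by (rule infsumI, rule has_sum_cong[THEN iffD1, OF _ has_sum_add[OF hs hs]])
      (simp only: sum_mult_diff, simp add: algebra_simps eval_nat_numeral)
  also have "dsum (\<lambda>j k. (of_nat (k * (j + k)) * of_nat j ^ 4) * lu q (j + k)) =
      (\<Sum>\<^sub>\<infinity>l\<in>{1..}. (\<Sum>j\<in>{1..<l}. of_nat ((l - j) * (j + (l - j))) * of_nat j ^ 4) * lu q l)"
    by (rule dsum_kernel_lu[OF q, where p = 6], rule pm) (use le in auto)
  also have "\<dots> = (\<Sum>\<^sub>\<infinity>l\<in>{1..}. (\<Sum>j\<in>{1..<l}. of_nat ((l - j) * l) * of_nat j ^ 4) * lu q l)"
    by (intro infsum_cong arg_cong2[where f = "(*)"] sum.cong) auto
  also have "\<dots> = 1/30 * lambert 7 q + (-1/12) * lambert 5 q + 1/20 * lambert 3 q"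
    by (rule infsumI, rule has_sum_cong[THEN iffD1, OF _ has_sum_add[OF has_sum_add[OF hs hs] hs]])
      (simp only: sum_mult_diff, simp add: algebra_simps)
  finally show ?thesis by (simp add: algebra_simps)
qed

end

section \<open>Lambert series as generating functions of divisor sums\<close>

lemma geo_bounded_lattice_power:
  assumes "norm q < 1"
  shows "geo_bounded (\<lambda>d k. if d = 0 \<or> k = 0 then 0 else of_nat d ^ s * of_nat k ^ t * q ^ (d * k))"
proof -
  obtain r where r: "norm q < r" "r < 1" using dense assms by blast
  have r0: "0 < r" using r(1) by (rule order.strict_trans1[OF norm_ge_zero])
  have "geo_bounded (\<lambda>d k. if d = 0 \<or> k = 0 then 0 else q ^ (d * k))"
  proof -
    have "norm (if d = 0 \<or> k = 0 then 0 else q ^ (d * k)) \<le> (1 / r) * r ^ (d + k)" for d k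
    proof (cases "d = 0 \<or> k = 0")
      case False
      then obtain a b where ab: "d = Suc a" "k = Suc b" by (metis not0_implies_Suc)
      have "norm (q ^ (d * k)) \<le> r ^ (d * k)" unfolding norm_power using r by (intro power_mono) auto
      \<comment> \<open>For d, k >= 1 one has d k >= d + k - 1, whence the constant 1 / r. On the
        axes q^(d k) = 1 has no decay, which is why they are masked out.\<close>
      also have "\<dots> \<le> r ^ (d + k - 1)" using r r0 ab by (intro power_decreasing) auto
      also have "\<dots> = (1 / r) * r ^ (d + k)" using r0 ab by simp
      finally show ?thesis using False by simp
    qed (use r0 in auto)
    then show ?thesis unfolding geo_bounded_def using r r0
      by (intro exI[of _ "1/r"] conjI exI[of _ r]) auto
  qed
  from geo_bounded_nat1[OF geo_bounded_nat2[OF this]]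
  have "geo_bounded (\<lambda>d k. of_nat d ^ s * (of_nat k ^ t * (if d = 0 \<or> k = 0 then 0 else q ^ (d * k))))" .
  then show ?thesis by (rule geo_bounded_bound[of _ _ 1 0]) (auto simp: mult.assoc)
qed

text \<open>The pairs (d, k) are grouped by n = d k. The exponent t = 0 yields the divisor sums and
  t = 1 their Euler derivative, because d^(s+1) (n / d) = n d^s.\<close>

lemma has_sum_divisors:
  fixes q :: complex and c :: "nat \<Rightarrow> complex"
  assumes "norm q < 1"
    and "\<And>d. d > 0 \<Longrightarrow> ((\<lambda>k. of_nat k ^ t * q ^ (d * k)) has_sum c d) {1..}"
  shows "((\<lambda>n. (\<Sum>d | d dvd n. of_nat d ^ s * of_nat (n div d) ^ t) * q ^ n) has_sum
            (\<Sum>\<^sub>\<infinity>d\<in>{1..}. of_nat d ^ s * c d)) {1..}"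
proof -
  let ?g = "\<lambda>(d, k). of_nat d ^ s * of_nat k ^ t * q ^ (d * k)"
  let ?S = "Sigma {1::nat..} (\<lambda>n. {d. d dvd n})"
  have "(\<lambda>(d, k). if d = 0 \<or> k = 0 then 0 else of_nat d ^ s * of_nat k ^ t * q ^ (d * k)) summable_on pos_pairs"
    by (rule geo_bounded_summable[OF geo_bounded_lattice_power[OF assms(1)]])
  then have sm: "?g summable_on pos_pairs"
    by (rule summable_on_cong[THEN iffD1, rotated]) (auto simp: pos_pairs_def)
  then obtain X where X: "(?g has_sum X) ({1..} \<times> {1..})" unfolding pos_pairs_def by (auto simp: summable_on_def)
  have "((\<lambda>d. of_nat d ^ s * c d) has_sum X) {1..}"
    by (rule has_sum_SigmaD[OF X]) (use has_sum_cmult_right[OF assms(2)] in \<open>auto simp: mult.assoc\<close>)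
  then have Xe: "X = (\<Sum>\<^sub>\<infinity>d\<in>{1..}. of_nat d ^ s * c d)" by (simp add: infsumI)
  have "((\<lambda>(n, d). of_nat d ^ s * of_nat (n div d) ^ t * q ^ n) has_sum X) ?S \<longleftrightarrow> (?g has_sum X) ({1..} \<times> {1..})"
    by (rule has_sum_reindex_bij_witness[of _ "\<lambda>(d, k). (d * k, d)" "\<lambda>(n, d). (d, n div d)"])
      (auto intro!: Nat.gr0I simp: dvd_div_eq_0_iff Suc_le_eq dest: dvd_pos_nat)
  with X have "((\<lambda>(n, d). of_nat d ^ s * of_nat (n div d) ^ t * q ^ n) has_sum X) ?S" by blast
  then have "((\<lambda>n. \<Sum>d | d dvd n. of_nat d ^ s * of_nat (n div d) ^ t * q ^ n) has_sum X) {1..}"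
    by (rule has_sum_SigmaD) (auto intro!: has_sum_finite)
  then show ?thesis by (simp add: Xe sum_distrib_right)
qed

lemma has_sum_lu:
  assumes "norm q < 1" "d > 0"
  shows "((\<lambda>k. of_nat k ^ 0 * q ^ (d * k)) has_sum lu q d) {1..}"
    and "((\<lambda>k. of_nat k ^ 1 * q ^ (d * k)) has_sum (lu q d + lu q d ^ 2)) {1..}"
proof -
  have n: "norm (q ^ d) < 1" using assms power_strict_mono[of "norm q" 1 d] by (simp add: norm_power)
  then have ne: "1 - q ^ d \<noteq> 0" by auto
  show "((\<lambda>k. of_nat k ^ 0 * q ^ (d * k)) has_sum lu q d) {1..}"
    using has_sum_geometric_from_1[OF n] by (simp add: lu_def power_mult)
  have "(\<lambda>k. of_nat (Suc k) * (q ^ d) ^ k) sums (1 / (1 - q ^ d)\<^sup>2)"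
    by (rule geometric_deriv_sums[OF n])
  from sums_mult[OF this, of "q ^ d"]
  have s: "(\<lambda>k. of_nat (Suc k) * (q ^ d) ^ Suc k) sums (q ^ d / (1 - q ^ d)\<^sup>2)"
    by (simp add: mult_ac del: of_nat_Suc)
  have "summable (\<lambda>k. norm (of_nat (Suc k) * (q ^ d) ^ Suc k))"
  proof -
    have "summable (\<lambda>k. of_nat (Suc k) * norm (q ^ d) ^ k)"
      using geometric_deriv_sums[of "norm (q ^ d)"] n by (auto simp: sums_iff)
    from summable_mult[OF this, of "norm (q ^ d)"] show ?thesis
      by (simp add: norm_mult norm_power mult_ac del: of_nat_Suc)
  qed
  from norm_summable_imp_has_sum[OF this s]
  have "((\<lambda>k. of_nat k ^ 1 * q ^ (d * k)) has_sum (q ^ d / (1 - q ^ d)\<^sup>2)) (Suc ` UNIV)"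
    by (subst has_sum_reindex) (auto simp: o_def power_mult simp del: power_Suc)
  also have "Suc ` UNIV = {1..}" by (auto simp: image_iff) (metis Suc_le_D One_nat_def)
  finally have hs: "((\<lambda>k. of_nat k ^ 1 * q ^ (d * k)) has_sum (q ^ d / (1 - q ^ d)\<^sup>2)) {1..}" .
  have "x / (1 - x)\<^sup>2 = x / (1 - x) + (x / (1 - x)) ^ 2" if "1 - x \<noteq> 0" for x :: complex
    using that by (simp add: divide_simps power2_eq_square) (simp add: algebra_simps)
  then have "q ^ d / (1 - q ^ d)\<^sup>2 = lu q d + lu q d ^ 2"
    unfolding lu_def using ne by blast
  with hs show "((\<lambda>k. of_nat k ^ 1 * q ^ (d * k)) has_sum (lu q d + lu q d ^ 2)) {1..}" by simp
qed

text \<open>Every number divides 0, and a sum over an infinite set is 0 by convention.\<close>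

lemma divisor_sigma_0 [simp]: "divisor_sigma s 0 = 0"
  by (simp add: divisor_sigma_def infinite_UNIV_nat)

lemma lambert_eq_divisor_sum:
  assumes "norm q < 1"
  shows "((\<lambda>n. of_nat (divisor_sigma s n) * q ^ n) has_sum lambert s q) UNIV"
    and "((\<lambda>n. of_nat n * of_nat (divisor_sigma s n) * q ^ n) has_sum lambert_deriv s q) UNIV"
proof -
  have "((\<lambda>n. of_nat (divisor_sigma s n) * q ^ n) has_sum lambert s q) {1..}"
    using has_sum_divisors[OF assms, of 0 "lu q" s] has_sum_lu(1)[OF assms]
    unfolding lambert_def divisor_sigma_def by simp
  then show "((\<lambda>n. of_nat (divisor_sigma s n) * q ^ n) has_sum lambert s q) UNIV"
    by (rule has_sum_cong_neutral[THEN iffD1, rotated -1]) (auto simp: not_le)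
  have "((\<lambda>n. of_nat n * of_nat (divisor_sigma s n) * q ^ n) has_sum lambert_deriv s q) {1..}"
  proof (rule has_sum_cong[THEN iffD1])
    show "((\<lambda>n. (\<Sum>d | d dvd n. of_nat d ^ Suc s * of_nat (n div d) ^ 1) * q ^ n) has_sum lambert_deriv s q) {1..}"
      unfolding lambert_deriv_def
      by (rule has_sum_divisors[OF assms has_sum_lu(2)[OF assms]])
  next
    fix n :: nat
    have "(\<Sum>d | d dvd n. of_nat d ^ Suc s * of_nat (n div d) ^ 1 :: complex) =
       (\<Sum>d | d dvd n. of_nat n * of_nat d ^ s)"
      by (rule sum.cong) (auto simp: mult_ac simp flip: of_nat_mult)
    then show "(\<Sum>d | d dvd n. of_nat d ^ Suc s * of_nat (n div d) ^ 1) * q ^ n = of_nat n * of_nat (divisor_sigma s n) * q ^ n"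
      by (simp add: divisor_sigma_def sum_distrib_left)
  qed
  then show "((\<lambda>n. of_nat n * of_nat (divisor_sigma s n) * q ^ n) has_sum lambert_deriv s q) UNIV"
    by (rule has_sum_cong_neutral[THEN iffD1, rotated -1]) (auto simp: not_le)
qed

text \<open>The equation q L = F' says nothing about L at q = 0. The value there is recorded
  separately because the behaviour at the cusp depends on it.\<close>

lemma power_series_Euler_derivative:
  fixes c :: "nat \<Rightarrow> complex"
  assumes 1: "\<And>x. norm x < 1 \<Longrightarrow> ((\<lambda>n. c n * x ^ n) has_sum F x) UNIV"
    and 2: "((\<lambda>n. of_nat n * c n * q ^ n) has_sum F') UNIV"
    and q: "norm q < 1"
  shows "\<exists>L. (F has_field_derivative L) (at q) \<and> q * L = F' \<and> (q = 0 \<longrightarrow> L = c 1)"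
proof -
  obtain r where r: "norm q < r" "r < 1" using dense q by blast
  have r0: "0 < r" using r(1) by (rule order.strict_trans1[OF norm_ge_zero])
  have sums: "(\<lambda>n. c n * x ^ n) sums F x" if "norm x < 1" for x
    using has_sum_imp_sums[OF 1[OF that]] .
  have s1: "summable (\<lambda>n. c n * (of_real r) ^ n)"
    using sums[of "of_real r"] r r0 by (simp add: sums_iff)
  have d: "((\<lambda>x. \<Sum>n. c n * x ^ n) has_field_derivative (\<Sum>n. diffs c n * q ^ n)) (at q)"
    by (rule termdiffs_strong[OF s1]) (use r r0 in simp)
  have "(F has_field_derivative (\<Sum>n. diffs c n * q ^ n)) (at q)"
    by (rule DERIV_cong_ev[THEN iffD1, OF refl _ refl d])
      (rule eventually_mono[OF eventually_nhds_in_open[of "ball 0 1" q]],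
         use q sums in \<open>auto simp: sums_iff\<close>)
  moreover have "q * (\<Sum>n. diffs c n * q ^ n) = F'"
  proof -
    have "summable (\<lambda>n. diffs c n * q ^ n)"
      by (rule termdiff_converges[of q 1]) (use q sums in \<open>auto simp: sums_iff\<close>)
    then have "(\<lambda>n. q * (diffs c n * q ^ n)) sums (q * (\<Sum>n. diffs c n * q ^ n))"
      by (intro sums_mult summable_sums)
    moreover have "(\<lambda>n. of_nat n * c n * q ^ n) sums F'"
      using has_sum_imp_sums[OF 2] .
    then have "(\<lambda>n. q * (diffs c n * q ^ n)) sums F'"
      using sums_Suc_iff[of "\<lambda>n. of_nat n * c n * q ^ n" F']
      by (simp add: diffs_def mult_ac)
    ultimately show ?thesis by (rule sums_unique2)
  qed
  moreover have "q = 0 \<Longrightarrow> (\<Sum>n. diffs c n * q ^ n) = c 1"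
    using powser_zero[of "diffs c"] by (simp add: diffs_def)
  ultimately show ?thesis by blast
qed

lemma lambert_has_field_derivative:
  assumes "norm q < 1"
  shows "\<exists>L. (lambert s has_field_derivative L) (at q) \<and> q * L = lambert_deriv s q \<and> (q = 0 \<longrightarrow> L = 1)"
proof -
  have "of_nat (divisor_sigma s 1) = (1 :: complex)" by (simp add: divisor_sigma_def)
  then show ?thesis
    using power_series_Euler_derivative[OF lambert_eq_divisor_sum(1) lambert_eq_divisor_sum(2)[OF assms] assms]
    by metis
qed

section \<open>Derivatives on the half plane\<close>

lemma norm_nome: "norm (nome z) < 1"
  using Rep_uhp[of z] by (simp add: nome_def norm_exp)

lemma E_eq_lambert:
  "E2 z = 1 - 24 * lambert 1 (nome z)"
  "E4 z = 1 + 240 * lambert 3 (nome z)"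
  "E6 z = 1 - 504 * lambert 5 (nome z)"
proof -
  have "(\<lambda>n. of_nat (divisor_sigma s (Suc n)) * nome z ^ Suc n) sums lambert s (nome z)" for s
    using has_sum_imp_sums[OF lambert_eq_divisor_sum(1)[OF norm_nome, of s z]]
    by (subst sums_Suc_iff) simp
  then show "E2 z = 1 - 24 * lambert 1 (nome z)" "E4 z = 1 + 240 * lambert 3 (nome z)"
    "E6 z = 1 - 504 * lambert 5 (nome z)"
    unfolding E2_def E4_def E6_def by (simp_all add: sums_iff)
qed

text \<open>A relation, so that differentiability is carried along; an equation for the total
  operator \<open>D\<close> would not express it.\<close>

definition has_D :: "uhp_fun \<Rightarrow> uhp_fun \<Rightarrow> bool" where
  "has_D f g \<longleftrightarrow> (\<forall>z. ((\<lambda>w. f (Abs_uhp w)) has_field_derivative (2 * of_real pi * \<i>) * g z) (at (Rep_uhp z)))"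

lemma has_D_imp_D: "has_D f g \<Longrightarrow> D f = g"
proof -
  assume "has_D f g"
  then have "deriv (\<lambda>w. f (Abs_uhp w)) (Rep_uhp z) = (2 * of_real pi * \<i>) * g z" for z
    unfolding has_D_def by (intro DERIV_imp_deriv) blast
  then show ?thesis unfolding D_def by auto
qed

lemma has_D_add: "has_D f f' \<Longrightarrow> has_D g g' \<Longrightarrow> has_D (f + g) (f' + g')"
  unfolding has_D_def by (auto intro!: derivative_eq_intros simp: algebra_simps)

lemma has_D_mult: "has_D f f' \<Longrightarrow> has_D g g' \<Longrightarrow> has_D (f * g) (f' * g + f * g')"
  unfolding has_D_def
  by (auto intro!: derivative_eq_intros simp: algebra_simps Rep_uhp_inverse)

lemma has_D_cscale: "has_D f f' \<Longrightarrow> has_D (cscale c f) (cscale c f')"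
  unfolding has_D_def cscale_def by (auto intro!: derivative_eq_intros simp: algebra_simps)

lemma has_D_1: "has_D 1 0"
  unfolding has_D_def by auto

text \<open>On functions of q the operator \<open>D\<close> is the Euler derivative q d/dq; the
  division by 2 pi i in \<open>D\<close> is made for this.\<close>

lemma has_D_nome:
  assumes "\<And>z. (G has_field_derivative G' (nome z)) (at (nome z))"
  shows "has_D (\<lambda>z. G (nome z)) (\<lambda>z. nome z * G' (nome z))"
  unfolding has_D_def
proof
  fix z
  let ?e = "\<lambda>w. exp (2 * of_real pi * \<i> * w)"
  have "((\<lambda>w. G (?e w)) has_field_derivative (G' (nome z) * (2 * of_real pi * \<i> * nome z))) (at (Rep_uhp z))"
    by (rule DERIV_chain2[where f = G])
      (use assms[of z] in \<open>auto simp: nome_def intro!: derivative_eq_intros\<close>)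
  then show "((\<lambda>w. G (nome (Abs_uhp w))) has_field_derivative (2 * of_real pi * \<i>) * (nome z * G' (nome z))) (at (Rep_uhp z))"
  proof (rule DERIV_cong_ev[THEN iffD1, OF refl _ _, rotated -1])
    have "eventually (\<lambda>w. Im w > 0) (nhds (Rep_uhp z))"
      using eventually_nhds_in_open[OF open_halfspace_Im_gt[of 0], of "Rep_uhp z"] Rep_uhp[of z] by simp
    then show "eventually (\<lambda>w. G (?e w) = G (nome (Abs_uhp w))) (nhds (Rep_uhp z))"
      by eventually_elim (simp add: nome_def Abs_uhp_inverse)
  qed (simp add: mult_ac)
qed

lemma has_D_lambert: "has_D (\<lambda>z. lambert s (nome z)) (\<lambda>z. lambert_deriv s (nome z))"
proof -
  obtain L where L: "\<And>q. norm q < 1 \<Longrightarrow> (lambert s has_field_derivative L q) (at q) \<and> q * L q = lambert_deriv s q"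
    using lambert_has_field_derivative[of _ s] by metis
  have "has_D (\<lambda>z. lambert s (nome z)) (\<lambda>z. nome z * L (nome z))"
    by (rule has_D_nome) (use L norm_nome in blast)
  also have "(\<lambda>z. nome z * L (nome z)) = (\<lambda>z. lambert_deriv s (nome z))"
    using L norm_nome by blast
  finally show ?thesis .
qed

theorem ramanujan_E4: "has_D E4 (cscale (1/3) (E2 * E4 - E6))"
proof -
  have "has_D (1 + cscale 240 (\<lambda>z. lambert 3 (nome z))) (0 + cscale 240 (\<lambda>z. lambert_deriv 3 (nome z)))"
    by (intro has_D_add has_D_1 has_D_cscale has_D_lambert)
  also have "1 + cscale 240 (\<lambda>z. lambert 3 (nome z)) = E4"
    by (auto simp: E_eq_lambert cscale_def)
  also have "0 + cscale 240 (\<lambda>z. lambert_deriv 3 (nome z)) = cscale (1/3) (E2 * E4 - E6)"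
    using arg_cong[OF lambert_1_3[OF norm_nome], of "\<lambda>x. 120 * x"]
    by (auto simp: fun_eq_iff E_eq_lambert cscale_def algebra_simps)
  finally show ?thesis .
qed

theorem ramanujan_E6: "has_D E6 (cscale (1/2) (E2 * E6 - E4 ^ 2))"
proof -
  have "has_D (1 + cscale (-504) (\<lambda>z. lambert 5 (nome z))) (0 + cscale (-504) (\<lambda>z. lambert_deriv 5 (nome z)))"
    by (intro has_D_add has_D_1 has_D_cscale has_D_lambert)
  also have "1 + cscale (-504) (\<lambda>z. lambert 5 (nome z)) = E6"
    by (auto simp: E_eq_lambert cscale_def)
  also have "0 + cscale (-504) (\<lambda>z. lambert_deriv 5 (nome z)) = cscale (1/2) (E2 * E6 - E4 ^ 2)"
  proof
    fix z
    let ?l = "\<lambda>s. lambert s (nome z)"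
    \<comment> \<open>The series of sigma_7 in \<open>lambert_1_5\<close> is traded for the square
      of \<open>lambert 3\<close>; this is where E_4^2 enters the derivative of E_6.\<close>
    have "?l 7 = 120 * ?l 3 ^ 2 + ?l 3" using lambert_3_3[OF norm_nome, of z] by simp
    then show "(0 + cscale (-504) (\<lambda>z. lambert_deriv 5 (nome z))) z = cscale (1/2) (E2 * E6 - E4 ^ 2) z"
      using arg_cong[OF lambert_1_5[OF norm_nome], of "\<lambda>x. 252 * x" z]
      by (simp add: E_eq_lambert cscale_def power2_eq_square algebra_simps)
  qed
  finally show ?thesis .
qed

section \<open>Lattice sums\<close>

text \<open>Up to sign, the third derivative of the cotangent with its pole at 0 removed; the next
  lemma treats the fifth. The limits 2/15 and 16/63 are 2 * 3! zeta(4) / pi^4 and 2 * 5! zeta(6) /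
  pi^6.\<close>

lemma zeta4_limit: "((\<lambda>x::real. 6 / sin x ^ 4 - 4 / sin x ^ 2 - 6 / x ^ 4) \<longlongrightarrow> 2 / 15) (at_right 0)"
  by real_asymp

lemma zeta6_limit: "((\<lambda>x::real. 120 / sin x ^ 6 - 120 / sin x ^ 4 + 16 / sin x ^ 2 - 120 / x ^ 6) \<longlongrightarrow> 16 / 63) (at_right 0)"
  by real_asymp

lemma lattice_norm_bound:
  assumes "Im z > 0"
  shows "\<exists>C>0. \<forall>m n. (real_of_int m)\<^sup>2 + (real_of_int n)\<^sup>2 \<le> C * norm (of_int m * z + of_int n) ^ 2"
proof -
  \<comment> \<open>From n = (m Re z + n) - m Re z one gets n^2 <= 2 (m Re z + n)^2 + 2 (m Re z)^2,
    and m^2 is (m Im z)^2 / (Im z)^2.\<close>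
  define C where "C = 2 + (1 + 2 * (Re z)\<^sup>2) / (Im z)\<^sup>2"
  have "(real_of_int m)\<^sup>2 + (real_of_int n)\<^sup>2 \<le> C * norm (of_int m * z + of_int n) ^ 2" for m n
  proof -
    let ?a = "of_int m * Re z + of_int n" and ?b = "of_int m * Im z :: real"
    have "(real_of_int n)\<^sup>2 \<le> 2 * ?a\<^sup>2 + 2 * (of_int m * Re z)\<^sup>2"
      using sum_squares_ge_zero[of "?a + of_int m * Re z" 0] zero_le_power2[of "?a + of_int m * Re z"]
      by (simp add: power2_eq_square algebra_simps)
    then have "(real_of_int m)\<^sup>2 + (real_of_int n)\<^sup>2 \<le> 2 * ?a\<^sup>2 + (of_int m)\<^sup>2 * (1 + 2 * (Re z)\<^sup>2)"
      by (simp add: power_mult_distrib algebra_simps)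
    also have "\<dots> = 2 * ?a\<^sup>2 + (1 + 2 * (Re z)\<^sup>2) / (Im z)\<^sup>2 * ?b\<^sup>2"
      using assms by (simp add: power_mult_distrib field_simps)
    also have "\<dots> \<le> C * ?a\<^sup>2 + C * ?b\<^sup>2" unfolding C_def
      by (intro add_mono mult_right_mono) auto
    also have "\<dots> = C * norm (of_int m * z + of_int n) ^ 2"
      by (simp add: cmod_power2 algebra_simps)
    finally show ?thesis .
  qed
  moreover have "C > 0" unfolding C_def by (intro add_pos_nonneg) auto
  ultimately show ?thesis by blast
qed

lemma summable_on_inverse_square_int:
  "(\<lambda>n::int. 1 / (1 + (real_of_int n)\<^sup>2)) summable_on UNIV"
proof -
  have "summable (\<lambda>n. norm (1 / (1 + (real n)\<^sup>2)))"
    by (rule summable_comparison_test'[OF inverse_power_summable[of 2], of 1])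
      (auto simp: field_simps add_pos_nonneg)
  then have s: "(\<lambda>n. 1 / (1 + (real n)\<^sup>2)) summable_on UNIV" by (rule norm_summable_imp_summable_on)
  have "(\<lambda>n::int. 1 / (1 + (real_of_int n)\<^sup>2)) summable_on (range int \<union> range (\<lambda>n. - int n))"
    by (rule summable_on_union; subst summable_on_reindex) (use s in \<open>auto simp: inj_on_def o_def\<close>)
  also have "range int \<union> range (\<lambda>n. - int n) = UNIV"
    using int_cases2 by (auto simp: image_iff) metis
  finally show ?thesis .
qed

text \<open>Away from the origin m^2 + n^2 >= 1, hence (1 + m^2) (1 + n^2) <= 3 (m^2 + n^2)^2, and
  the lattice series is dominated by a product of two single series. This is where the exponent has
  to be at least 4.\<close>

lemma eisenstein_summable:
  assumes "Im z > 0" "l \<ge> 2"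
  shows "(\<lambda>(m, n). 1 / (of_int m * z + of_int n) ^ (2 * l)) summable_on A"
proof -
  obtain C where C: "C > 0"
    "\<And>m n. (real_of_int m)\<^sup>2 + (real_of_int n)\<^sup>2 \<le> C * norm (of_int m * z + of_int n) ^ 2"
    using lattice_norm_bound[OF assms(1)] by blast
  let ?g = "\<lambda>n::int. 1 / (1 + (real_of_int n)\<^sup>2)"
  have bound: "norm (1 / (of_int m * z + of_int n) ^ (2 * l)) \<le> 3 * C ^ l * (?g m * ?g n)" for m n
  proof (cases "m = 0 \<and> n = 0")
    case False
    let ?s = "(real_of_int m)\<^sup>2 + (real_of_int n)\<^sup>2"
    have "0 < m\<^sup>2 + n\<^sup>2" using False by (simp add: sum_power2_gt_zero_iff)
    then have "1 \<le> m\<^sup>2 + n\<^sup>2" by linarith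
    then have s1: "1 \<le> ?s" by (metis of_int_1_le_iff of_int_add of_int_power)
    have "(1 + (real_of_int m)\<^sup>2) * (1 + (real_of_int n)\<^sup>2) = 1 + ?s + (real_of_int m)\<^sup>2 * (real_of_int n)\<^sup>2"
      by (simp add: algebra_simps)
    also have "\<dots> \<le> ?s\<^sup>2 + ?s\<^sup>2 + ?s\<^sup>2"
    proof (intro add_mono)
      show s2: "?s \<le> ?s\<^sup>2" using mult_right_mono[OF s1, of ?s] s1 by (simp add: power2_eq_square)
      show "1 \<le> ?s\<^sup>2" using s1 s2 by linarith
      show "(real_of_int m)\<^sup>2 * (real_of_int n)\<^sup>2 \<le> ?s\<^sup>2"
        unfolding power2_eq_square[of ?s] by (intro mult_mono) auto
    qed
    also have "\<dots> = 3 * ?s ^ 2" by simp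
    also have "\<dots> \<le> 3 * ?s ^ l" using s1 assms(2) by (intro mult_left_mono power_increasing) auto
    also have "?s ^ l \<le> (C * norm (of_int m * z + of_int n) ^ 2) ^ l"
      by (intro power_mono C) auto
    also have "\<dots> = C ^ l * norm (of_int m * z + of_int n) ^ (2 * l)"
      by (simp only: power_mult_distrib power_mult)
    finally have *: "(1 + (real_of_int m)\<^sup>2) * (1 + (real_of_int n)\<^sup>2) \<le> 3 * C ^ l * norm (of_int m * z + of_int n) ^ (2 * l)"
      by (simp only: mult.assoc)
    have p: "0 < (1 + (real_of_int m)\<^sup>2) * (1 + (real_of_int n)\<^sup>2)" by (intro mult_pos_pos add_pos_nonneg) auto
    have "norm (of_int m * z + of_int n) ^ (2 * l) > 0"
    proof (rule ccontr)
      assume "\<not> ?thesis"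
      then have "norm (of_int m * z + of_int n) ^ (2 * l) = 0"
        using zero_le_power[OF norm_ge_zero, of "of_int m * z + of_int n" "2 * l"] by linarith
      with * p show False by simp
    qed
    with * p show ?thesis by (simp add: norm_divide norm_power field_simps)
  next
    case True
    then show ?thesis using C(1) assms(2) by (simp add: power_0_left)
  qed
  have "(\<lambda>(m, n). ?g m * ?g n) summable_on (UNIV \<times> UNIV)"
    by (intro summable_on_SigmaI[where g = "\<lambda>m. ?g m * infsum ?g UNIV"])
      (auto intro!: has_sum_cmult_right summable_on_cmult_left has_sum_infsum summable_on_inverse_square_int
         simp del: times_divide_eq_left times_divide_eq_right)
  then have "(\<lambda>x. (3 * C ^ l) * (case x of (m, n) \<Rightarrow> ?g m * ?g n)) summable_on (UNIV \<times> UNIV)"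
    by (rule summable_on_cmult_right)
  then have "(\<lambda>x. norm (case x of (m, n) \<Rightarrow> 1 / (of_int m * z + of_int n) ^ (2 * l))) summable_on (UNIV \<times> UNIV)"
    by (rule Infinite_Sum.abs_summable_on_comparison_test')
      (auto simp: case_prod_unfold simp del: times_divide_eq_left times_divide_eq_right intro: bound)
  then have "(\<lambda>(m, n). 1 / (of_int m * z + of_int n) ^ (2 * l)) summable_on (UNIV \<times> UNIV)"
    by (rule abs_summable_summable)
  then show ?thesis by (rule summable_on_subset_banach) auto
qed

text \<open>The summand at \<open>(0, 0)\<close> vanishes because \<open>1 / 0 = 0\<close>.\<close>

definition eisenstein :: "nat \<Rightarrow> complex \<Rightarrow> complex" where
  "eisenstein k z = (\<Sum>\<^sub>\<infinity>(m, n)\<in>UNIV. 1 / (of_int m * z + of_int n) ^ k)"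

text \<open>Since m (- 1 / z) + n = (n z - m) / z, inversion permutes the lattice points up to the
  factor 1 / z.\<close>

lemma eisenstein_inversion:
  assumes "z \<noteq> 0"
  shows "eisenstein k (- 1 / z) = z ^ k * eisenstein k z"
proof -
  have "eisenstein k (- 1 / z) =
     (\<Sum>\<^sub>\<infinity>x\<in>UNIV. z ^ k * (case x of (m, n) \<Rightarrow> 1 / (of_int m * z + of_int n) ^ k))"
    unfolding eisenstein_def
  proof (rule infsum_reindex_bij_witness[of _ "\<lambda>(m, n). (- n, m)" "\<lambda>(m, n). (n, - m)"])
    fix a :: "int \<times> int"
    obtain m n where a: "a = (m, n)" by force
    have "of_int m * (- 1 / z) + of_int n = (of_int n * z - of_int m) / z"
      using assms by (simp add: field_simps)
    then show "z ^ k * (case (case a of (m, n) \<Rightarrow> (n, - m)) of (m, n) \<Rightarrow> 1 / (of_int m * z + of_int n) ^ k) =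
      (case a of (m, n) \<Rightarrow> 1 / (of_int m * (- 1 / z) + of_int n) ^ k)"
      by (simp add: a power_divide)
  qed auto
  also have "\<dots> = z ^ k * eisenstein k z"
    unfolding eisenstein_def by (rule infsum_cmult_right')
  finally show ?thesis .
qed

section \<open>Reflection formulas for the polygamma functions\<close>

lemma Digamma_reflection_complex:
  fixes z :: complex
  assumes "z \<notin> \<int>"
  shows "Digamma (1 - z) - Digamma z = of_real pi * cot (of_real pi * z)"
proof -
  have nz: "w \<notin> \<int>\<^sub>\<le>\<^sub>0" "1 - w \<notin> \<int>\<^sub>\<le>\<^sub>0" if "w \<notin> \<int>" for w :: complex
    using that nonpos_Ints_Int Ints_diff[OF Ints_1, of "1 - w"] by auto
  have sn: "sin (of_real pi * z) \<noteq> 0" using assms by (auto simp: sin_eq_0 mult_ac)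
  have G: "Gamma z \<noteq> 0" "Gamma (1 - z) \<noteq> 0" using nz[OF assms] by (auto simp: Gamma_eq_zero_iff)
  have 1: "((\<lambda>w. Gamma w * Gamma (1 - w)) has_field_derivative
      (Gamma z * Digamma z * Gamma (1 - z) - Gamma z * (Gamma (1 - z) * Digamma (1 - z)))) (at z)"
    using nz[OF assms] by (auto intro!: derivative_eq_intros)
  have 2: "((\<lambda>w. of_real pi / sin (of_real pi * w)) has_field_derivative
      (- of_real pi * (of_real pi * cos (of_real pi * z)) / sin (of_real pi * z) ^ 2)) (at z)"
    using sn by (auto intro!: derivative_eq_intros simp: power2_eq_square)
  \<comment> \<open>By Euler's reflection formula this is the function differentiated in
    \<open>1\<close>. Equating the two derivatives and dividing by its value amounts to taking the
    logarithmic derivative.\<close>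
  have "((\<lambda>w. of_real pi / sin (of_real pi * w)) has_field_derivative
      (Gamma z * Digamma z * Gamma (1 - z) - Gamma z * (Gamma (1 - z) * Digamma (1 - z)))) (at z)"
    using 1 by (simp add: Gamma_reflection_complex)
  from DERIV_unique[OF this 2]
  have "Gamma z * Gamma (1 - z) * (Digamma (1 - z) - Digamma z) =
       of_real pi / sin (of_real pi * z) * (of_real pi * cot (of_real pi * z))"
    by (simp add: algebra_simps cot_def power2_eq_square)
  then show ?thesis using sn G unfolding Gamma_reflection_complex by simp
qed

text \<open>One differentiation of a reflection formula on an open set; the sign alternates because
  of the inner derivative of 1 - w. It is iterated twice: in terms of sines for the zeta values, in
  terms of exponentials for the Fourier expansion.\<close>

lemma Polygamma_reflection_step:
  fixes G :: "complex \<Rightarrow> complex"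
  assumes "open S" "S \<inter> \<int> = {}"
    and eq: "\<And>w. w \<in> S \<Longrightarrow> (-1) ^ n * Polygamma n (1 - w) - Polygamma n w = G w"
    and G: "\<And>w. w \<in> S \<Longrightarrow> (G has_field_derivative G' w) (at w)"
    and w: "w \<in> S"
  shows "(-1) ^ Suc n * Polygamma (Suc n) (1 - w) - Polygamma (Suc n) w = G' w"
proof -
  have "w \<notin> \<int>" using assms by auto
  then have nz: "w \<notin> \<int>\<^sub>\<le>\<^sub>0" "1 - w \<notin> \<int>\<^sub>\<le>\<^sub>0"
    using nonpos_Ints_Int Ints_diff[OF Ints_1, of "1 - w"] by auto
  have 1: "((\<lambda>w. (-1) ^ n * Polygamma n (1 - w) - Polygamma n w) has_field_derivative
      ((-1) ^ Suc n * Polygamma (Suc n) (1 - w) - Polygamma (Suc n) w)) (at w)"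
    using nz by (auto intro!: derivative_eq_intros)
  have "(G has_field_derivative ((-1) ^ Suc n * Polygamma (Suc n) (1 - w) - Polygamma (Suc n) w)) (at w)"
    by (rule DERIV_cong_ev[THEN iffD1, OF refl _ refl 1])
      (rule eventually_mono[OF eventually_nhds_in_open[OF assms(1) w]], use eq in auto)
  from DERIV_unique[OF this G[OF w]] show ?thesis .
qed

lemma Polygamma_reflection_sin:
  fixes w :: complex
  assumes "w \<notin> \<int>"
  shows "Polygamma 3 w + Polygamma 3 (1 - w) =
           of_real pi ^ 4 * (6 / sin (of_real pi * w) ^ 4 - 4 / sin (of_real pi * w) ^ 2)"
    and "Polygamma 5 w + Polygamma 5 (1 - w) =
           of_real pi ^ 6 * (120 / sin (of_real pi * w) ^ 6 - 120 / sin (of_real pi * w) ^ 4 + 16 / sin (of_real pi * w) ^ 2)"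
proof -
  define p where "p = complex_of_real pi"
  define s where "s = (\<lambda>w. sin (p * w))"
  define c where "c = (\<lambda>w. cos (p * w))"
  \<comment> \<open>Derivatives of polynomials in c and v are again such polynomials modulo s v = 1
    and c^2 = 1 - s^2, so each of the steps below ends in a polynomial identity.\<close>
  define v where "v = (\<lambda>w. inverse (s w))"
  have op: "open (- \<int> :: complex set)" "- \<int> \<inter> \<int> = ({} :: complex set)" by auto
  have sn: "s w \<noteq> 0" if "w \<in> - \<int>" for w using that by (auto simp: sin_eq_0 s_def p_def mult_ac)
  have sv: "s w * v w = 1" if "w \<in> - \<int>" for w using sn[OF that] by (simp add: v_def)
  have cs: "c w * c w = 1 - s w * s w" for w
    using sin_cos_squared_add3[of "p * w"] by (simp add: algebra_simps c_def s_def)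
  have ds: "(s has_field_derivative p * c w) (at w)" for w
    unfolding s_def c_def by (auto intro!: derivative_eq_intros)
  have dc: "(c has_field_derivative - p * s w) (at w)" for w
    unfolding s_def c_def by (auto intro!: derivative_eq_intros)
  have dv: "(v has_field_derivative - p * c w * v w ^ 2) (at w)" if "w \<in> - \<int>" for w
    unfolding v_def using sn[OF that]
    by (auto intro!: derivative_eq_intros ds simp: power2_eq_square)
  have 0: "(-1) ^ 0 * Polygamma 0 (1 - w) - Polygamma 0 w = p * (c w * v w)" if "w \<in> - \<int>" for w :: complex
    using Digamma_reflection_complex[of w] that by (simp add: cot_def p_def c_def v_def s_def field_simps)
  have 1: "(-1) ^ (Suc 0) * Polygamma (Suc 0) (1 - w) - Polygamma (Suc 0) w = - (p ^ 2 * v w ^ 2)"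
    if "w \<in> - \<int>" for w :: complex
  proof (rule Polygamma_reflection_step[OF op 0 _ that])
    fix w :: complex assume w: "w \<in> - \<int>"
    show "((\<lambda>w. p * (c w * v w)) has_field_derivative - (p ^ 2 * v w ^ 2)) (at w)"
      by (rule derivative_eq_intros ds dc dv w refl)+
        (simp, use sv[OF w] cs[of w] in algebra)
  qed assumption
  have 2: "(-1) ^ (Suc (Suc 0)) * Polygamma (Suc (Suc 0)) (1 - w) - Polygamma (Suc (Suc 0)) w = 2 * p ^ 3 * (c w * v w ^ 3)"
    if "w \<in> - \<int>" for w :: complex
  proof (rule Polygamma_reflection_step[OF op 1 _ that])
    fix w :: complex assume w: "w \<in> - \<int>"
    show "((\<lambda>w. - (p ^ 2 * v w ^ 2)) has_field_derivative 2 * p ^ 3 * (c w * v w ^ 3)) (at w)"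
      by (rule derivative_eq_intros ds dc dv w refl)+
        (simp add: algebra_simps eval_nat_numeral)
  qed assumption
  have 3: "(-1) ^ (Suc (Suc (Suc 0))) * Polygamma (Suc (Suc (Suc 0))) (1 - w) - Polygamma (Suc (Suc (Suc 0))) w = - (p ^ 4 * (6 * v w ^ 4 - 4 * v w ^ 2))"
    if "w \<in> - \<int>" for w :: complex
  proof (rule Polygamma_reflection_step[OF op 2 _ that])
    fix w :: complex assume w: "w \<in> - \<int>"
    show "((\<lambda>w. 2 * p ^ 3 * (c w * v w ^ 3)) has_field_derivative - (p ^ 4 * (6 * v w ^ 4 - 4 * v w ^ 2))) (at w)"
      by (rule derivative_eq_intros ds dc dv w refl)+
        (simp, use sv[OF w] cs[of w] in algebra)
  qed assumption
  have 4: "(-1) ^ (Suc (Suc (Suc (Suc 0)))) * Polygamma (Suc (Suc (Suc (Suc 0)))) (1 - w) - Polygamma (Suc (Suc (Suc (Suc 0)))) w = p ^ 5 * (c w * (24 * v w ^ 5 - 8 * v w ^ 3))"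
    if "w \<in> - \<int>" for w :: complex
  proof (rule Polygamma_reflection_step[OF op 3 _ that])
    fix w :: complex assume w: "w \<in> - \<int>"
    show "((\<lambda>w. - (p ^ 4 * (6 * v w ^ 4 - 4 * v w ^ 2))) has_field_derivative p ^ 5 * (c w * (24 * v w ^ 5 - 8 * v w ^ 3))) (at w)"
      by (rule derivative_eq_intros ds dc dv w refl)+
        (simp add: algebra_simps eval_nat_numeral)
  qed assumption
  have 5: "(-1) ^ (Suc (Suc (Suc (Suc (Suc 0))))) * Polygamma (Suc (Suc (Suc (Suc (Suc 0))))) (1 - w) - Polygamma (Suc (Suc (Suc (Suc (Suc 0))))) w = - (p ^ 6 * (120 * v w ^ 6 - 120 * v w ^ 4 + 16 * v w ^ 2))"
    if "w \<in> - \<int>" for w :: complex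
  proof (rule Polygamma_reflection_step[OF op 4 _ that])
    fix w :: complex assume w: "w \<in> - \<int>"
    show "((\<lambda>w. p ^ 5 * (c w * (24 * v w ^ 5 - 8 * v w ^ 3))) has_field_derivative - (p ^ 6 * (120 * v w ^ 6 - 120 * v w ^ 4 + 16 * v w ^ 2))) (at w)"
      by (rule derivative_eq_intros ds dc dv w refl)+
        (simp, use sv[OF w] cs[of w] in algebra)
  qed assumption
  show "Polygamma 3 w + Polygamma 3 (1 - w) =
           of_real pi ^ 4 * (6 / sin (of_real pi * w) ^ 4 - 4 / sin (of_real pi * w) ^ 2)"
    using 3[of w] assms by (simp add: numeral_3_eq_3 v_def s_def p_def divide_inverse power_inverse algebra_simps)
  have n5: "(5::nat) = Suc (Suc (Suc (Suc (Suc 0))))" by simp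
  show "Polygamma 5 w + Polygamma 5 (1 - w) =
           of_real pi ^ 6 * (120 / sin (of_real pi * w) ^ 6 - 120 / sin (of_real pi * w) ^ 4 + 16 / sin (of_real pi * w) ^ 2)"
    using 5[of w, folded n5] assms by (simp add: v_def s_def p_def divide_inverse power_inverse algebra_simps)
qed

section \<open>Rows of the lattice and the zeta values\<close>

lemma infsum_int_split:
  fixes f :: "int \<Rightarrow> complex"
  assumes "f summable_on UNIV"
  shows "infsum f UNIV = (\<Sum>\<^sub>\<infinity>j\<in>UNIV. f (int j)) + (\<Sum>\<^sub>\<infinity>j\<in>UNIV. f (- 1 - int j))"
    and "(\<lambda>j. f (int j)) summable_on UNIV" and "(\<lambda>j. f (- 1 - int j)) summable_on UNIV"
proof -
  have s: "f summable_on A" for A by (rule summable_on_subset_banach[OF assms]) auto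
  have "UNIV = range int \<union> range (\<lambda>j. - 1 - int j)"
  proof (intro equalityI subsetI)
    fix x :: int
    show "x \<in> range int \<union> range (\<lambda>j. - 1 - int j)"
    proof (cases "x \<ge> 0")
      case True
      then show ?thesis by (auto simp: image_iff intro!: exI[of _ "nat x"])
    next
      case False
      then have "x = - 1 - int (nat (- 1 - x))" by simp
      then show ?thesis by blast
    qed
  qed auto
  then have "infsum f UNIV = infsum f (range int \<union> range (\<lambda>j. - 1 - int j))" by simp
  also have "\<dots> = infsum f (range int) + infsum f (range (\<lambda>j. - 1 - int j))"
    by (rule infsum_Un_disjoint[OF s s]) auto
  also have "infsum f (range int) = (\<Sum>\<^sub>\<infinity>j\<in>UNIV. f (int j))"
    by (subst infsum_reindex) (auto simp: o_def)
  also have "infsum f (range (\<lambda>j. - 1 - int j)) = (\<Sum>\<^sub>\<infinity>j\<in>UNIV. f (- 1 - int j))"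
    by (subst infsum_reindex) (auto simp: o_def inj_on_def)
  finally show "infsum f UNIV = (\<Sum>\<^sub>\<infinity>j\<in>UNIV. f (int j)) + (\<Sum>\<^sub>\<infinity>j\<in>UNIV. f (- 1 - int j))" .
  show "(\<lambda>j. f (int j)) summable_on UNIV"
    using s[of "range int"] by (subst (asm) summable_on_reindex) (auto simp: o_def)
  show "(\<lambda>j. f (- 1 - int j)) summable_on UNIV"
    using s[of "range (\<lambda>j. - 1 - int j)"] by (subst (asm) summable_on_reindex) (auto simp: o_def inj_on_def)
qed

lemma infsum_eq_sums: "f summable_on UNIV \<Longrightarrow> f sums s \<Longrightarrow> infsum f UNIV = (s :: complex)"
  using has_sum_imp_sums[OF has_sum_infsum] sums_unique2 by blast

text \<open>For the odd order 2 l - 1 the sign in the series of the polygamma function is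
  positive.\<close>

lemma Polygamma_odd_sums:
  fixes z :: complex
  assumes "z \<noteq> 0" "l \<ge> 1"
  shows "(\<lambda>k. 1 / (z + of_nat k) ^ (2 * l)) sums (Polygamma (2 * l - 1) z / fact (2 * l - 1))"
  using Polygamma_LIMSEQ[OF assms(1), of "2 * l - 1"] assms(2) by (simp add: field_simps)

lemma lattice_row_summable:
  assumes "Im w > 0" "l \<ge> 2"
  shows "(\<lambda>n. 1 / (of_int m * w + of_int n) ^ (2 * l)) summable_on A"
proof -
  have "(\<lambda>(m, n). 1 / (of_int m * w + of_int n) ^ (2 * l)) summable_on (Pair m ` A)"
    by (rule eisenstein_summable[OF assms])
  then show ?thesis by (subst (asm) summable_on_reindex) (auto simp: inj_on_def o_def)
qed

text \<open>The terms n >= 0 form the series at w. For n = - 1 - j one has w + n = - (1 - w + j),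
  whose even power is a term of the series at 1 - w.\<close>

lemma lattice_row_Polygamma:
  assumes "Im w > 0" "l \<ge> 2"
  shows "(\<Sum>\<^sub>\<infinity>n\<in>UNIV. 1 / (w + of_int n) ^ (2 * l)) =
     (Polygamma (2 * l - 1) w + Polygamma (2 * l - 1) (1 - w)) / fact (2 * l - 1)"
proof -
  have w: "w \<noteq> 0" "1 - w \<noteq> 0" using assms(1) by auto
  have s: "(\<lambda>n::int. 1 / (w + of_int n) ^ (2 * l)) summable_on UNIV"
    using lattice_row_summable[OF assms, of 1] by simp
  note S = infsum_int_split[OF s]
  have 1: "(\<Sum>\<^sub>\<infinity>j\<in>UNIV. 1 / (w + of_int (int j)) ^ (2 * l)) = Polygamma (2 * l - 1) w / fact (2 * l - 1)"
    by (rule infsum_eq_sums[OF S(2)]) (use Polygamma_odd_sums[OF w(1), of l] assms(2) in auto)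
  have "(w + of_int (- 1 - int j)) ^ (2 * l) = (1 - w + of_nat j) ^ (2 * l)" for j
    using power_minus_even[of "2 * l" "1 - w + of_nat j"] by (simp add: algebra_simps)
  then have 2: "(\<Sum>\<^sub>\<infinity>j\<in>UNIV. 1 / (w + of_int (- 1 - int j)) ^ (2 * l)) = Polygamma (2 * l - 1) (1 - w) / fact (2 * l - 1)"
    by (intro infsum_eq_sums[OF S(3)]) (use Polygamma_odd_sums[OF w(2), of l] assms(2) in auto)
  show ?thesis unfolding S(1) 1 2 by (simp add: add_divide_distrib)
qed

text \<open>The term n = 0 is 1 / 0 = 0, so both halves are the series at 1.\<close>

lemma zeta_row_Polygamma:
  assumes "l \<ge> 2"
  shows "(\<Sum>\<^sub>\<infinity>n\<in>UNIV. 1 / (of_int n :: complex) ^ (2 * l)) = 2 * Polygamma (2 * l - 1) 1 / fact (2 * l - 1)"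
proof -
  have s: "(\<lambda>n::int. 1 / (of_int n :: complex) ^ (2 * l)) summable_on UNIV"
    using lattice_row_summable[of \<i> l 0] assms by simp
  note S = infsum_int_split[OF s]
  have P: "(\<lambda>k. 1 / (1 + of_nat k :: complex) ^ (2 * l)) sums (Polygamma (2 * l - 1) 1 / fact (2 * l - 1))"
    using Polygamma_odd_sums[of 1 l] assms by auto
  then have "(\<lambda>k. 1 / (of_nat k :: complex) ^ (2 * l)) sums (Polygamma (2 * l - 1) 1 / fact (2 * l - 1))"
    using sums_Suc_iff[of "\<lambda>k. 1 / (of_nat k :: complex) ^ (2 * l)"] assms by (auto simp: power_0_left)
  then have 1: "(\<Sum>\<^sub>\<infinity>j\<in>UNIV. 1 / (of_int (int j) :: complex) ^ (2 * l)) = Polygamma (2 * l - 1) 1 / fact (2 * l - 1)"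
    by (intro infsum_eq_sums[OF S(2)]) auto
  have "(of_int (- 1 - int j) :: complex) ^ (2 * l) = (1 + of_nat j) ^ (2 * l)" for j
    using power_minus_even[of "2 * l" "1 + of_nat j :: complex"] by (simp add: algebra_simps)
  then have 2: "(\<Sum>\<^sub>\<infinity>j\<in>UNIV. 1 / (of_int (- 1 - int j) :: complex) ^ (2 * l)) = Polygamma (2 * l - 1) 1 / fact (2 * l - 1)"
    by (intro infsum_eq_sums[OF S(3)]) (use P in auto)
  show ?thesis unfolding S(1) 1 2 by simp
qed

text \<open>The reflection formula is singular at 0. The recurrence replaces
  \<open>Polygamma n x\<close> by \<open>Polygamma n (1 + x)\<close>, which for odd n subtracts
  exactly the pole n! / x^(n+1); then both terms tend to \<open>Polygamma n 1\<close>.\<close>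

lemma Polygamma_1_limit:
  fixes f :: "real \<Rightarrow> real"
  assumes n: "odd n"
    and f: "\<And>x. 0 < x \<Longrightarrow> x < 1 \<Longrightarrow> Polygamma n (of_real x) + Polygamma n (1 - of_real x) = complex_of_real (f x)"
    and lim: "((\<lambda>x. f x - fact n / x ^ Suc n) \<longlongrightarrow> L) (at_right 0)"
  shows "2 * Polygamma n 1 = complex_of_real L"
proof -
  have "isCont (\<lambda>x::real. Polygamma n (1 + x) + Polygamma n (1 - x)) 0"
    by (intro continuous_intros) (auto dest: nonpos_Ints_of_int)
  then have "((\<lambda>x::real. Polygamma n (1 + x) + Polygamma n (1 - x)) \<longlongrightarrow> 2 * Polygamma n 1) (at 0)"
    by (auto simp: isCont_def)
  then have "((\<lambda>x::real. Polygamma n (1 + x) + Polygamma n (1 - x)) \<longlongrightarrow> 2 * Polygamma n 1) (at_right 0)"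
    by (rule filterlim_mono) (auto simp: at_le)
  moreover have "eventually (\<lambda>x. Polygamma n (1 + x) + Polygamma n (1 - x) = f x - fact n / x ^ Suc n) (at_right 0)"
  proof (rule eventually_at_right_less[THEN eventually_elim2, OF eventually_at_right_real[of 0 1]])
    fix x :: real assume "0 < x" "x \<in> {0<..<1}"
    then have elim: "0 < x" "x < 1" by auto
    have "complex_of_real (Polygamma n x + Polygamma n (1 - x)) = of_real (f x)"
      using f[of x] elim Polygamma_of_real[of x n, where ?'a = complex] Polygamma_of_real[of "1 - x" n, where ?'a = complex]
      by simp
    then have "Polygamma n x + Polygamma n (1 - x) = f x" by (simp only: of_real_eq_iff)
    moreover have "Polygamma n (x + 1) = Polygamma n x + (-1) ^ n * fact n / x ^ Suc n"
      by (rule Polygamma_plus1) (use elim in auto)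
    ultimately show "Polygamma n (1 + x) + Polygamma n (1 - x) = f x - fact n / x ^ Suc n"
      using n by (simp add: add.commute)
  qed simp
  ultimately have "((\<lambda>x. f x - fact n / x ^ Suc n) \<longlongrightarrow> 2 * Polygamma n 1) (at_right 0)"
    by (rule Lim_transform_eventually)
  from tendsto_unique[OF _ this lim] have "2 * Polygamma n 1 = L" by simp
  then show ?thesis using Polygamma_of_real[of 1 n, where ?'a = complex] by (metis of_real_1 of_real_mult of_real_numeral zero_neq_one)
qed

lemma Polygamma_1_values:
  "2 * Polygamma 3 1 = complex_of_real (2 * pi ^ 4 / 15)"
  "2 * Polygamma 5 1 = complex_of_real (16 * pi ^ 6 / 63)"
proof -
  have nI: "complex_of_real x \<notin> \<int>" if "0 < x" "x < 1" for x
  proof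
    assume "complex_of_real x \<in> \<int>"
    then obtain k where "complex_of_real x = of_int k" by (auto elim: Ints_cases)
    then have "x = of_int k" by (metis of_real_eq_iff of_real_of_int_eq)
    with that show False by simp
  qed
  have fl: "filterlim (\<lambda>x. pi * x) (at_right 0) (at_right 0)" by real_asymp
  show "2 * Polygamma 3 1 = complex_of_real (2 * pi ^ 4 / 15)"
  proof (rule Polygamma_1_limit)
    show "Polygamma 3 (of_real x) + Polygamma 3 (1 - of_real x) =
        complex_of_real (pi ^ 4 * (6 / sin (pi * x) ^ 4 - 4 / sin (pi * x) ^ 2))" if "0 < x" "x < 1" for x
      using Polygamma_reflection_sin(1)[OF nI[OF that]] by (simp flip: sin_of_real)
    have "((\<lambda>x. pi ^ 4 * (6 / sin (pi * x) ^ 4 - 4 / sin (pi * x) ^ 2 - 6 / (pi * x) ^ 4)) \<longlongrightarrow> pi ^ 4 * (2 / 15)) (at_right 0)"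
      by (intro tendsto_mult_left filterlim_compose[OF zeta4_limit fl])
    then show "((\<lambda>x. pi ^ 4 * (6 / sin (pi * x) ^ 4 - 4 / sin (pi * x) ^ 2) - fact 3 / x ^ Suc 3) \<longlongrightarrow> 2 * pi ^ 4 / 15) (at_right 0)"
      by (simp add: algebra_simps power_mult_distrib fact_numeral eval_nat_numeral)
  qed simp
  show "2 * Polygamma 5 1 = complex_of_real (16 * pi ^ 6 / 63)"
  proof (rule Polygamma_1_limit)
    show "Polygamma 5 (of_real x) + Polygamma 5 (1 - of_real x) =
        complex_of_real (pi ^ 6 * (120 / sin (pi * x) ^ 6 - 120 / sin (pi * x) ^ 4 + 16 / sin (pi * x) ^ 2))" if "0 < x" "x < 1" for x
      using Polygamma_reflection_sin(2)[OF nI[OF that]] by (simp flip: sin_of_real)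
    have "((\<lambda>x. pi ^ 6 * (120 / sin (pi * x) ^ 6 - 120 / sin (pi * x) ^ 4 + 16 / sin (pi * x) ^ 2 - 120 / (pi * x) ^ 6)) \<longlongrightarrow> pi ^ 6 * (16 / 63)) (at_right 0)"
      by (intro tendsto_mult_left filterlim_compose[OF zeta6_limit fl])
    then show "((\<lambda>x. pi ^ 6 * (120 / sin (pi * x) ^ 6 - 120 / sin (pi * x) ^ 4 + 16 / sin (pi * x) ^ 2) - fact 5 / x ^ Suc 5) \<longlongrightarrow> 16 * pi ^ 6 / 63) (at_right 0)"
      by (simp add: algebra_simps power_mult_distrib fact_numeral eval_nat_numeral)
  qed simp
qed

section \<open>Fourier expansion of the lattice sums\<close>

text \<open>The polylogarithm of order - s; as a function of q^m it is the contribution of row m to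
  the Fourier expansion.\<close>

definition polylog_neg :: "nat \<Rightarrow> complex \<Rightarrow> complex" where
  "polylog_neg s x = (\<Sum>\<^sub>\<infinity>r\<in>{1..}. of_nat r ^ s * x ^ r)"

lemma polylog_neg_summable:
  fixes x :: complex
  assumes "norm x < 1"
  shows "(\<lambda>r. of_nat r ^ s * x ^ r) summable_on A"
proof -
  obtain \<rho> where \<rho>: "norm x < \<rho>" "\<rho> < 1" using dense assms by blast
  obtain C where C: "C \<ge> 0" "\<And>n. real n ^ s * norm x ^ n \<le> C * \<rho> ^ n"
    using poly_geometric_bounded[OF norm_ge_zero \<rho>(1)] by blast
  have "(\<lambda>n. C * \<rho> ^ n) summable_on UNIV"
    using \<rho> order.strict_trans1[OF norm_ge_zero \<rho>(1)]
    by (intro summable_on_cmult_right norm_summable_imp_summable_on) (auto intro!: summable_geometric)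
  then have "(\<lambda>r. norm (of_nat r ^ s * x ^ r)) summable_on UNIV"
    by (rule Infinite_Sum.abs_summable_on_comparison_test') (use C in \<open>auto simp: norm_mult norm_power\<close>)
  then have "(\<lambda>r. of_nat r ^ s * x ^ r) summable_on UNIV" by (rule abs_summable_summable)
  then show ?thesis by (rule summable_on_subset_banach) auto
qed

lemma polylog_neg_derivative:
  assumes "norm x < 1"
  shows "\<exists>L. (polylog_neg s has_field_derivative L) (at x) \<and> x * L = polylog_neg (Suc s) x"
proof -
  let ?c = "\<lambda>n. if n = 0 then 0 else of_nat n ^ s :: complex"
  have "\<exists>L. (polylog_neg s has_field_derivative L) (at x) \<and> x * L = polylog_neg (Suc s) x \<and> (x = 0 \<longrightarrow> L = ?c 1)"
  \<comment> \<open>The case distinction matters for s = 0, where 0^0 = 1 would add a constant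
    term.\<close>
  proof (rule power_series_Euler_derivative[where c = "\<lambda>n. if n = 0 then 0 else of_nat n ^ s"])
  fix x :: complex assume x: "norm x < 1"
  show "((\<lambda>n. (if n = 0 then 0 else of_nat n ^ s) * x ^ n) has_sum polylog_neg s x) UNIV"
    unfolding polylog_neg_def
    by (rule has_sum_cong_neutral[THEN iffD1, OF _ _ _ has_sum_infsum[OF polylog_neg_summable[OF x]]]) auto
next
  show "((\<lambda>n. of_nat n * (if n = 0 then 0 else of_nat n ^ s) * x ^ n) has_sum polylog_neg (Suc s) x) UNIV"
    unfolding polylog_neg_def
    by (rule has_sum_cong_neutral[THEN iffD1, OF _ _ _ has_sum_infsum[OF polylog_neg_summable[OF assms]]]) (auto simp: not_le)
  qed (rule assms)
  then show ?thesis by blast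
qed

lemma cot_exp:
  assumes "Im w > 0"
  shows "of_real pi * cot (of_real pi * w) = - of_real pi * \<i> - 2 * of_real pi * \<i> * polylog_neg 0 (exp (2 * of_real pi * \<i> * w))"
proof -
  let ?E = "exp (\<i> * (of_real pi * w))"
  have e: "exp (2 * of_real pi * \<i> * w) = ?E\<^sup>2"
    by (simp add: power2_eq_square mult_exp_exp algebra_simps)
  have n: "norm (?E\<^sup>2) < 1" using assms by (simp add: norm_power norm_exp power_less_one_iff)
  then have ne: "1 - ?E\<^sup>2 \<noteq> 0" by auto
  have p: "polylog_neg 0 (?E\<^sup>2) = ?E\<^sup>2 / (1 - ?E\<^sup>2)"
    unfolding polylog_neg_def using has_sum_geometric_from_1[OF n] by (simp add: infsumI)
  have i: "inverse ?E * ?E = 1" by simp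
  have "cos (of_real pi * w) = (?E\<^sup>2 + 1) / (2 * ?E)" "sin (of_real pi * w) = (?E\<^sup>2 - 1) / (2 * \<i> * ?E)"
    unfolding cos_exp_eq sin_exp_eq exp_minus by (simp_all add: field_simps power2_eq_square)
  moreover have "(a / (2 * x)) / (b / (2 * \<i> * x)) = (a / 2) / (b / (2 * \<i>))" if "x \<noteq> 0" for a b x :: complex
    using that by (simp add: divide_simps)
  ultimately have "cot (of_real pi * w) = ((?E\<^sup>2 + 1) / 2) / ((?E\<^sup>2 - 1) / (2 * \<i>))"
    unfolding cot_def by (metis exp_not_eq_zero)
  also have "\<dots> = - \<i> - 2 * \<i> * (?E\<^sup>2 / (1 - ?E\<^sup>2))"
  proof -
    have "(x + 1) / 2 / ((x - 1) / (2 * \<i>)) = - \<i> - 2 * \<i> * (x / (1 - x))" if "1 - x \<noteq> 0" for x :: complex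
      using that by (simp add: divide_simps) (simp add: algebra_simps)
    then show ?thesis using ne by blast
  qed
  finally have c: "cot (of_real pi * w) = - \<i> - 2 * \<i> * (?E\<^sup>2 / (1 - ?E\<^sup>2))" .
  show ?thesis unfolding e p c by (simp add: algebra_simps)
qed

text \<open>The q-expansion of the cotangent differentiated n times: every derivative contributes 2
  pi i and one more factor r in the series, and the constant term disappears after the
  first.\<close>

lemma Polygamma_reflection_exp:
  assumes "Im w > 0"
  shows "(-1) ^ n * Polygamma n (1 - w) - Polygamma n w =
     (if n = 0 then - of_real pi * \<i> else 0) - (2 * of_real pi * \<i>) ^ Suc n * polylog_neg n (exp (2 * of_real pi * \<i> * w))"
  using assms
proof (induction n arbitrary: w)
  case 0
  then have "w \<notin> \<int>" by (auto elim!: Ints_cases)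
  then show ?case using Digamma_reflection_complex[of w] cot_exp[OF 0] by simp
next
  case (Suc n)
  let ?e = "\<lambda>w. exp (2 * of_real pi * \<i> * w)"
  have "(-1) ^ Suc n * Polygamma (Suc n) (1 - w) - Polygamma (Suc n) w =
     - ((2 * of_real pi * \<i>) ^ Suc (Suc n) * polylog_neg (Suc n) (?e w))"
  proof (rule Polygamma_reflection_step[of "{w. Im w > 0}"])
    show "open {w. 0 < Im w}" by (rule open_halfspace_Im_gt)
    show "{w. 0 < Im w} \<inter> \<int> = {}" by (auto elim!: Ints_cases)
    show "w \<in> {w. 0 < Im w}" using Suc.prems by simp
    fix w assume w: "w \<in> {w. 0 < Im w}"
    then show "(-1) ^ n * Polygamma n (1 - w) - Polygamma n w =
      (if n = 0 then - of_real pi * \<i> else 0) - (2 * of_real pi * \<i>) ^ Suc n * polylog_neg n (?e w)"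
      using Suc.IH by blast
    have "norm (?e w) < 1" using w by (simp add: norm_exp)
    then obtain L where L: "(polylog_neg n has_field_derivative L) (at (?e w))" "?e w * L = polylog_neg (Suc n) (?e w)"
      using polylog_neg_derivative by blast
    have "((\<lambda>w. polylog_neg n (?e w)) has_field_derivative (L * (2 * of_real pi * \<i> * ?e w))) (at w)"
      by (rule DERIV_chain2[where f = "polylog_neg n" and g = ?e, OF L(1)]) (auto intro!: derivative_eq_intros)
    also have "L * (2 * of_real pi * \<i> * ?e w) = 2 * of_real pi * \<i> * polylog_neg (Suc n) (?e w)"
      using L(2) by (simp add: mult_ac)
    finally have d: "((\<lambda>w. polylog_neg n (?e w)) has_field_derivative
       2 * of_real pi * \<i> * polylog_neg (Suc n) (?e w)) (at w)" .
    show "((\<lambda>w. (if n = 0 then - of_real pi * \<i> else 0) - (2 * of_real pi * \<i>) ^ Suc n * polylog_neg n (?e w))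
       has_field_derivative - ((2 * of_real pi * \<i>) ^ Suc (Suc n) * polylog_neg (Suc n) (?e w))) (at w)"
      by (rule derivative_eq_intros d refl)+ simp
  qed
  then show ?case by simp
qed

lemma lipschitz_formula:
  assumes "Im w > 0" "l \<ge> 2"
  shows "(\<Sum>\<^sub>\<infinity>n\<in>UNIV. 1 / (w + of_int n) ^ (2 * l)) =
     (2 * of_real pi * \<i>) ^ (2 * l) / fact (2 * l - 1) * polylog_neg (2 * l - 1) (exp (2 * of_real pi * \<i> * w))"
proof -
  have o: "odd (2 * l - 1)" and e: "Suc (2 * l - 1) = 2 * l" "2 * l - 1 \<noteq> 0" using assms(2) by auto
  have "- (Polygamma (2 * l - 1) w + Polygamma (2 * l - 1) (1 - w)) =
      - ((2 * of_real pi * \<i>) ^ (2 * l) * polylog_neg (2 * l - 1) (exp (2 * of_real pi * \<i> * w)))"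
    using Polygamma_reflection_exp[OF assms(1), of "2 * l - 1"] e unfolding power_minus_odd[OF o] by (simp add: algebra_simps)
  then have "Polygamma (2 * l - 1) w + Polygamma (2 * l - 1) (1 - w) =
      (2 * of_real pi * \<i>) ^ (2 * l) * polylog_neg (2 * l - 1) (exp (2 * of_real pi * \<i> * w))"
    by (simp only: neg_equal_iff_equal)
  then show ?thesis unfolding lattice_row_Polygamma[OF assms] by simp
qed

text \<open>Both sides are the double series of r^s q^(m r), summed in the two orders.\<close>

lemma infsum_polylog_neg:
  assumes "norm q < 1"
  shows "(\<Sum>\<^sub>\<infinity>m\<in>{1..}. polylog_neg s (q ^ m)) = lambert s q"
proof -
  have "(\<lambda>(d, k). if d = 0 \<or> k = 0 then 0 else of_nat d ^ 0 * of_nat k ^ s * q ^ (d * k)) summable_on ({1..} \<times> {1..})"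
    by (rule geo_bounded_summable[OF geo_bounded_lattice_power[OF assms(1)]])
  then have "(\<lambda>(d, k). of_nat k ^ s * q ^ (d * k)) summable_on ({1..} \<times> {1..})"
    by (rule summable_on_cong[THEN iffD1, rotated]) auto
  then have "(\<Sum>\<^sub>\<infinity>m\<in>{1..}. \<Sum>\<^sub>\<infinity>r\<in>{1..}. of_nat r ^ s * q ^ (m * r)) =
      (\<Sum>\<^sub>\<infinity>r\<in>{1..}. \<Sum>\<^sub>\<infinity>m\<in>{1..}. of_nat r ^ s * q ^ (m * r))"
    by (rule infsum_swap_banach)
  also have "\<dots> = lambert s q" unfolding lambert_def
  proof (rule infsum_cong)
    fix r :: nat assume "r \<in> {1..}"
    then have "((\<lambda>m. q ^ (r * m)) has_sum lu q r) {1..}"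
      using has_sum_lu(1)[OF assms, of r] by simp
    from has_sum_cmult_right[OF this, of "of_nat r ^ s"]
    show "(\<Sum>\<^sub>\<infinity>m\<in>{1..}. of_nat r ^ s * q ^ (m * r)) = of_nat r ^ s * lu q r"
      by (simp add: infsumI mult.commute)
  qed
  finally show ?thesis by (simp add: polylog_neg_def power_mult)
qed

text \<open>Summation by rows: row 0 gives the zeta value, the rows m and - m agree because the
  exponent is even, and \<open>lipschitz_formula\<close> evaluates the rows with m > 0.\<close>

lemma eisenstein_fourier:
  assumes z: "Im z > 0" and l: "l \<ge> 2"
  shows "eisenstein (2 * l) z = 2 * Polygamma (2 * l - 1) 1 / fact (2 * l - 1) +
    2 * ((2 * of_real pi * \<i>) ^ (2 * l) / fact (2 * l - 1) * lambert (2 * l - 1) (exp (2 * of_real pi * \<i> * z)))"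
proof -
  define f where "f = (\<lambda>m n. 1 / (of_int m * z + of_int n) ^ (2 * l))"
  define g where "g = (\<lambda>m. infsum (f m) UNIV)"
  define K where "K = (2 * complex_of_real pi * \<i>) ^ (2 * l) / fact (2 * l - 1)"
  define q where "q = exp (2 * complex_of_real pi * \<i> * z)"
  have q: "norm q < 1" using z by (simp add: q_def norm_exp)
  have s: "(\<lambda>(m, n). f m n) summable_on (UNIV \<times> UNIV)"
    unfolding f_def by (rule eisenstein_summable[OF z l])
  have 1: "eisenstein (2 * l) z = infsum g UNIV"
    unfolding g_def using infsum_Sigma'_banach[OF s] by (simp add: eisenstein_def f_def)
  have gs: "g summable_on UNIV" unfolding g_def by (rule summable_on_Sigma_banach[OF s])
  have gm: "g (int m) = K * polylog_neg (2 * l - 1) (q ^ m)" if "m > 0" for m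
  proof -
    have "g (int m) = K * polylog_neg (2 * l - 1) (exp (2 * of_real pi * \<i> * (of_nat m * z)))"
      unfolding g_def f_def K_def using lipschitz_formula[of "of_nat m * z" l] z l that by simp
    also have "exp (2 * of_real pi * \<i> * (of_nat m * z)) = q ^ m"
      unfolding q_def by (simp add: exp_of_nat_mult[symmetric] mult_ac)
    finally show ?thesis .
  qed
  have gneg: "g (- m) = g m" for m
  proof -
    have "(- (of_int m * z) + of_int n) ^ (2 * l) = (of_int m * z + of_int (- n)) ^ (2 * l)" for n
      using power_minus_even[of "2 * l" "of_int m * z + of_int (- n)"] by (simp add: algebra_simps)
    then have "g (- m) = (\<Sum>\<^sub>\<infinity>n\<in>UNIV. f m (- n))" unfolding g_def f_def by simp
    also have "\<dots> = g m" unfolding g_def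
      by (rule infsum_reindex_bij_witness[of _ uminus uminus]) auto
    finally show ?thesis .
  qed
  have g0: "g 0 = 2 * Polygamma (2 * l - 1) 1 / fact (2 * l - 1)"
    unfolding g_def f_def using zeta_row_Polygamma[OF l] by simp
  note S = infsum_int_split[OF gs]
  have X: "(\<Sum>\<^sub>\<infinity>m\<in>{1..}. g (int m)) = K * lambert (2 * l - 1) q"
  proof -
    have "(\<Sum>\<^sub>\<infinity>m\<in>{1..}. g (int m)) = (\<Sum>\<^sub>\<infinity>m\<in>{1..}. K * polylog_neg (2 * l - 1) (q ^ m))"
      by (rule infsum_cong) (simp add: gm)
    then show ?thesis by (simp only: infsum_cmult_right' infsum_polylog_neg[OF q])
  qed
  have "(\<Sum>\<^sub>\<infinity>j\<in>UNIV. g (int j)) = (\<Sum>\<^sub>\<infinity>j\<in>{0} \<union> {1..}. g (int j))"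
    by (intro arg_cong2[where f = infsum]) auto
  also have "\<dots> = (\<Sum>\<^sub>\<infinity>j\<in>{0}. g (int j)) + (\<Sum>\<^sub>\<infinity>j\<in>{1..}. g (int j))"
    by (intro infsum_Un_disjoint summable_on_subset_banach[OF S(2)]) auto
  also have "(\<Sum>\<^sub>\<infinity>j\<in>{0}. g (int j)) = g 0" by simp
  finally have A: "(\<Sum>\<^sub>\<infinity>j\<in>UNIV. g (int j)) = g 0 + K * lambert (2 * l - 1) q" unfolding X .
  have "(\<Sum>\<^sub>\<infinity>j\<in>UNIV. g (- 1 - int j)) = (\<Sum>\<^sub>\<infinity>m\<in>{1..}. g (int m))"
  proof (rule infsum_reindex_bij_witness[of _ "\<lambda>m. m - 1" Suc])
    show "g (int (Suc j)) = g (- 1 - int j)" for j using gneg[of "int (Suc j)"] by simp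
  qed auto
  then have B: "(\<Sum>\<^sub>\<infinity>j\<in>UNIV. g (- 1 - int j)) = K * lambert (2 * l - 1) q" unfolding X .
  show ?thesis unfolding 1 S(1) A B g0 by (simp add: K_def q_def)
qed

text \<open>The constants here and for E_6 are 2 zeta(4) and 2 zeta(6).\<close>

theorem E4_eq_eisenstein: "of_real (pi ^ 4 / 45) * E4 z = eisenstein 4 (Rep_uhp z)"
  using eisenstein_fourier[of "Rep_uhp z" 2] Rep_uhp[of z] Polygamma_1_values(1)
  by (simp add: E_eq_lambert nome_def fact_numeral power_mult_distrib algebra_simps)

theorem E6_eq_eisenstein: "of_real (2 * pi ^ 6 / 945) * E6 z = eisenstein 6 (Rep_uhp z)"
  using eisenstein_fourier[of "Rep_uhp z" 3] Rep_uhp[of z] Polygamma_1_values(2)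
  by (simp add: E_eq_lambert nome_def fact_numeral power_mult_distrib algebra_simps)

section \<open>Algebraic independence of the Eisenstein series\<close>

lemma E4_E6_inversion:
  assumes "Rep_uhp z' = - 1 / Rep_uhp z"
  shows "E4 z' = Rep_uhp z ^ 4 * E4 z" "E6 z' = Rep_uhp z ^ 6 * E6 z"
proof -
  have nz: "Rep_uhp z \<noteq> 0" using Rep_uhp[of z] by auto
  have pi: "complex_of_real (pi ^ 4 / 45) \<noteq> 0" "complex_of_real (2 * pi ^ 6 / 945) \<noteq> 0" by auto
  have "of_real (pi ^ 4 / 45) * E4 z' = of_real (pi ^ 4 / 45) * (Rep_uhp z ^ 4 * E4 z)"
    using E4_eq_eisenstein[of z'] E4_eq_eisenstein[of z] eisenstein_inversion[OF nz, of 4] assms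
    by (simp add: mult_ac)
  then show "E4 z' = Rep_uhp z ^ 4 * E4 z" using pi(1) mult_left_cancel by blast
  have "of_real (2 * pi ^ 6 / 945) * E6 z' = of_real (2 * pi ^ 6 / 945) * (Rep_uhp z ^ 6 * E6 z)"
    using E6_eq_eisenstein[of z'] E6_eq_eisenstein[of z] eisenstein_inversion[OF nz, of 6] assms
    by (simp add: mult_ac)
  then show "E6 z' = Rep_uhp z ^ 6 * E6 z" using pi(2) mult_left_cancel by blast
qed

lemma Im_inversion_pos:
  assumes "Im w > 0"
  shows "Im (- 1 / w) > 0"
proof -
  have "Im (- 1 / w) = Im w / (norm w)\<^sup>2"
    by (simp add: Im_divide cmod_power2)
  moreover have "w \<noteq> 0" using assms by auto
  ultimately show ?thesis using assms by simp
qed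

text \<open>Differentiating the transformation law of \<^term>\<open>E4\<close> and eliminating the derivatives by
  Ramanujan's identity; this determines \<^term>\<open>E2\<close> away from the zeros of \<^term>\<open>E4\<close>.\<close>

lemma E2_inversion:
  assumes z': "Rep_uhp z' = - 1 / Rep_uhp z" and nz: "E4 z \<noteq> 0"
  shows "E2 z' = Rep_uhp z ^ 2 * E2 z + 6 / (of_real pi * \<i>) * Rep_uhp z"
proof -
  define w where "w = Rep_uhp z"
  have w: "Im w > 0" "w \<noteq> 0" using Rep_uhp[of z] unfolding w_def by auto
  define e where "e = (\<lambda>w. E4 (Abs_uhp w))"
  define d where "d = (\<lambda>z. (E2 z * E4 z - E6 z) / 3)"
  define K where "K = 2 * complex_of_real pi * \<i>"
  have e: "(e has_field_derivative K * d z) (at (Rep_uhp z))" for z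
    using ramanujan_E4 unfolding has_D_def e_def d_def cscale_def K_def by (simp add: field_simps)
  have "(e has_field_derivative K * d z') (at (- 1 / w))" using e[of z'] z' by (simp add: w_def)
  then have 1: "((\<lambda>w. e (- 1 / w)) has_field_derivative (K * d z' * (1 / w ^ 2))) (at w)"
    by (rule DERIV_chain2[where f = e]) (use w in \<open>auto intro!: derivative_eq_intros simp: power2_eq_square\<close>)
  have 2: "((\<lambda>w. w ^ 4 * e w) has_field_derivative (4 * w ^ 3 * e w + w ^ 4 * (K * d z))) (at w)"
    using e[of z] unfolding w_def[symmetric] by (auto intro!: derivative_eq_intros)
  have 3: "eventually (\<lambda>w. e (- 1 / w) = w ^ 4 * e w) (nhds w)"
  proof (rule eventually_mono[OF eventually_nhds_in_open[OF open_halfspace_Im_gt[of 0]]])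
    fix x assume "x \<in> {w. 0 < Im w}"
    then show "e (- 1 / x) = x ^ 4 * e x" unfolding e_def
      using E4_E6_inversion(1)[of "Abs_uhp (- 1 / x)" "Abs_uhp x"] Im_inversion_pos[of x]
      by (simp add: Abs_uhp_inverse)
  qed (use w in auto)
  have "K * d z' * (1 / w ^ 2) = 4 * w ^ 3 * e w + w ^ 4 * (K * d z)"
    by (rule DERIV_unique[OF DERIV_cong_ev[OF refl 3 refl, THEN iffD1, OF 1] 2])
  then have "K * d z' = 4 * w ^ 5 * e w + w ^ 6 * (K * d z)"
    using w(2) by (simp add: field_simps eval_nat_numeral)
  then have "K * (E2 z' * (w ^ 4 * E4 z) - w ^ 6 * E6 z) = 12 * w ^ 5 * E4 z + w ^ 6 * (K * (E2 z * E4 z - E6 z))"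
    using E4_E6_inversion[OF z'] by (simp add: d_def e_def w_def Rep_uhp_inverse field_simps)
  then have "(w ^ 4 * E4 z) * (K * E2 z') = (w ^ 4 * E4 z) * (12 * w + K * w ^ 2 * E2 z)"
    by (simp add: algebra_simps eval_nat_numeral)
  then have "K * E2 z' = 12 * w + K * w ^ 2 * E2 z" using w(2) nz by simp
  moreover have "K \<noteq> 0" by (simp add: K_def)
  ultimately have "E2 z' = (12 * w + K * w ^ 2 * E2 z) / K" by (simp add: field_simps)
  also have "\<dots> = w ^ 2 * E2 z + 12 / K * w" using \<open>K \<noteq> 0\<close> by (simp add: add_divide_distrib)
  finally show ?thesis by (simp add: K_def w_def)
qed

lemma E_translation:
  assumes "Rep_uhp z' = Rep_uhp z + of_nat n"
  shows "E2 z' = E2 z" "E4 z' = E4 z" "E6 z' = E6 z"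
proof -
  have "nome z' = nome z"
    using exp_integer_2pi[of "of_nat n"] unfolding nome_def assms
    by (simp add: distrib_left exp_add mult_ac)
  then show "E2 z' = E2 z" "E4 z' = E4 z" "E6 z' = E6 z" by (simp_all add: E_eq_lambert)
qed

text \<open>By periodicity the values at z stay fixed while z + n varies, so the values at - 1 / (z
  + n) are polynomials in z + n. Keeping \<open>E4 z'\<close> nonzero allows the construction to be
  repeated at z'.\<close>

lemma translate_invert:
  obtains z' where "E4 z' = (Rep_uhp z + of_nat n) ^ 4 * E4 z" "E6 z' = (Rep_uhp z + of_nat n) ^ 6 * E6 z"
    "E4 z \<noteq> 0 \<Longrightarrow> E2 z' = (Rep_uhp z + of_nat n) ^ 2 * E2 z + 6 / (of_real pi * \<i>) * (Rep_uhp z + of_nat n)"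
    "E4 z \<noteq> 0 \<Longrightarrow> E4 z' \<noteq> 0"
proof -
  let ?w = "Rep_uhp z + of_nat n"
  have im: "Im ?w > 0" using Rep_uhp[of z] by simp
  then have w0: "?w \<noteq> 0" by (metis less_irrefl zero_complex.simps(2))
  define y where "y = Abs_uhp ?w"
  define z' where "z' = Abs_uhp (- 1 / ?w)"
  have y: "Rep_uhp y = ?w" unfolding y_def using im by (simp add: Abs_uhp_inverse)
  have z': "Rep_uhp z' = - 1 / Rep_uhp y" unfolding z'_def y using Im_inversion_pos[OF im] by (simp add: Abs_uhp_inverse)
  note t = E_translation[OF y]
  show ?thesis
    by (rule that[of z']) (use E4_E6_inversion[OF z'] E2_inversion[OF z'] t y w0 in auto)
qed

text \<open>The outermost variable stands for \<^term>\<open>E2\<close>, the innermost for \<^term>\<open>E6\<close>; so the modular forms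
  are the polynomials of degree \<open>0\<close>.\<close>

type_synonym poly3 = "complex poly poly poly"

definition eval3 :: "poly3 \<Rightarrow> complex \<Rightarrow> complex \<Rightarrow> complex \<Rightarrow> complex" where
  "eval3 p x y z = poly (poly (poly p [:[:x:]:]) [:y:]) z"

lemma eval3_simps [simp]:
  "eval3 (p + q) x y z = eval3 p x y z + eval3 q x y z"
  "eval3 (p * q) x y z = eval3 p x y z * eval3 q x y z"
  "eval3 (- p) x y z = - eval3 p x y z"
  "eval3 (p - q) x y z = eval3 p x y z - eval3 q x y z"
  "eval3 0 x y z = 0" "eval3 1 x y z = 1"
  by (simp_all add: eval3_def)

lemma eval3_polynomial:
  "\<exists>r. \<forall>s. eval3 p (poly a s) (poly b s) (poly c s) = poly r s"
  unfolding eval3_def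
proof (induction p)
  case (pCons m p)
  obtain r where r: "poly (poly (poly p [:[:poly a s:]:]) [:poly b s:]) (poly c s) = poly r s" for s
    using pCons.IH by blast
  have "\<exists>r. \<forall>s. poly (poly m [:poly b s:]) (poly c s) = poly r s"
  proof (induction m)
    case (pCons n m)
    obtain r where r: "poly (poly m [:poly b s:]) (poly c s) = poly r s" for s
      using pCons.IH by blast
    show ?case by (rule exI[of _ "pcompose n c + b * r"]) (simp add: r poly_pcompose)
  qed (auto intro: exI[of _ 0])
  then obtain t where t: "poly (poly m [:poly b s:]) (poly c s) = poly t s" for s by blast
  show ?case by (rule exI[of _ "t + a * r"]) (simp add: r t)
qed (auto intro: exI[of _ 0])

lemma eval3_polynomial_zero:
  assumes "infinite {s. eval3 p (poly a s) (poly b s) (poly c s) = 0}"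
  shows "eval3 p (poly a s) (poly b s) (poly c s) = 0"
proof -
  obtain r where r: "eval3 p (poly a s) (poly b s) (poly c s) = poly r s" for s
    using eval3_polynomial by blast
  have "r = 0" using assms poly_roots_finite[of r] unfolding r by blast
  then show ?thesis by (simp add: r)
qed

lemma infinite_translates: "infinite (range (\<lambda>n. w + complex_of_nat n))"
  by (rule range_inj_infinite) (auto intro: injI)

text \<open>At \<open>- 1 / (z + n)\<close> the relation is a polynomial in \<open>z + n\<close> vanishing at infinitely many points, so
  \<open>z + n\<close> may be replaced by any \<open>x\<close>; using this at \<open>- 1 / (z + n)\<close> again frees a second parameter.\<close>

lemma eval3_E_rescaled:
  assumes P: "\<And>z. eval3 P (E2 z) (E4 z) (E6 z) = 0" and E: "E4 z \<noteq> 0" and v: "v \<noteq> -1"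
  shows "eval3 P w (v ^ 4 * E4 z) (v ^ 6 * E6 z) = 0"
proof -
  define K where "K = 6 / (complex_of_real pi * \<i>)"
  have K: "K \<noteq> 0" by (simp add: K_def)
  have 1: "eval3 P (x ^ 2 * E2 z + K * x) (x ^ 4 * E4 z) (x ^ 6 * E6 z) = 0" if "E4 z \<noteq> 0" for x z
  proof -
    let ?a = "[:0, K, E2 z:]" and ?b = "[:0, 0, 0, 0, E4 z:]" and ?c = "[:0, 0, 0, 0, 0, 0, E6 z:]"
    have ev: "poly ?a x = x ^ 2 * E2 z + K * x" "poly ?b x = x ^ 4 * E4 z" "poly ?c x = x ^ 6 * E6 z" for x
      by (simp_all add: algebra_simps eval_nat_numeral)
    have "range (\<lambda>n. Rep_uhp z + of_nat n) \<subseteq> {s. eval3 P (poly ?a s) (poly ?b s) (poly ?c s) = 0}"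
    proof safe
      fix n
      obtain z' where z': "E4 z' = (Rep_uhp z + of_nat n) ^ 4 * E4 z" "E6 z' = (Rep_uhp z + of_nat n) ^ 6 * E6 z"
        "E4 z \<noteq> 0 \<Longrightarrow> E2 z' = (Rep_uhp z + of_nat n) ^ 2 * E2 z + K * (Rep_uhp z + of_nat n)"
        using translate_invert[of z n] unfolding K_def by metis
      show "eval3 P (poly ?a (Rep_uhp z + of_nat n)) (poly ?b (Rep_uhp z + of_nat n)) (poly ?c (Rep_uhp z + of_nat n)) = 0"
        unfolding ev using P[of z'] z' that by simp
    qed
    with infinite_translates have "infinite {s. eval3 P (poly ?a s) (poly ?b s) (poly ?c s) = 0}"
      by (meson finite_subset)
    from eval3_polynomial_zero[OF this, of x] show ?thesis unfolding ev .
  qed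
  have 2: "eval3 P (x ^ 2 * (u ^ 2 * E2 z + K * u) + K * x) (x ^ 4 * (u ^ 4 * E4 z)) (x ^ 6 * (u ^ 6 * E6 z)) = 0" for x u
  proof -
    let ?a = "[:K * x, x ^ 2 * K, x ^ 2 * E2 z:]" and ?b = "[:0, 0, 0, 0, x ^ 4 * E4 z:]"
      and ?c = "[:0, 0, 0, 0, 0, 0, x ^ 6 * E6 z:]"
    have ev: "poly ?a u = x ^ 2 * (u ^ 2 * E2 z + K * u) + K * x" "poly ?b u = x ^ 4 * (u ^ 4 * E4 z)"
      "poly ?c u = x ^ 6 * (u ^ 6 * E6 z)" for u
      by (simp_all add: algebra_simps eval_nat_numeral)
    have "range (\<lambda>n. Rep_uhp z + of_nat n) \<subseteq> {s. eval3 P (poly ?a s) (poly ?b s) (poly ?c s) = 0}"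
    proof safe
      fix n
      obtain z' where z': "E4 z' = (Rep_uhp z + of_nat n) ^ 4 * E4 z" "E6 z' = (Rep_uhp z + of_nat n) ^ 6 * E6 z"
        "E4 z \<noteq> 0 \<Longrightarrow> E2 z' = (Rep_uhp z + of_nat n) ^ 2 * E2 z + K * (Rep_uhp z + of_nat n)"
        "E4 z \<noteq> 0 \<Longrightarrow> E4 z' \<noteq> 0"
        using translate_invert[of z n] unfolding K_def by metis
      show "eval3 P (poly ?a (Rep_uhp z + of_nat n)) (poly ?b (Rep_uhp z + of_nat n)) (poly ?c (Rep_uhp z + of_nat n)) = 0"
        unfolding ev using 1[OF z'(4)[OF E], of x] z'(1,2) z'(3)[OF E] by simp
    qed
    with infinite_translates have "infinite {s. eval3 P (poly ?a s) (poly ?b s) (poly ?c s) = 0}"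
      by (meson finite_subset)
    from eval3_polynomial_zero[OF this, of u] show ?thesis unfolding ev .
  qed
  \<comment> \<open>With u = v / x the scale x u = v is fixed, and the first argument becomes v^2
    E_2 + K (v + 1) x. It takes every value as x varies, provided v + 1 is nonzero; the point x = 0
    is recovered by polynomial continuation.\<close>
  let ?a = "[:v ^ 2 * E2 z, K * (v + 1):]" and ?b = "[:v ^ 4 * E4 z:]" and ?c = "[:v ^ 6 * E6 z:]"
  have "- {0} \<subseteq> {s. eval3 P (poly ?a s) (poly ?b s) (poly ?c s) = 0}"
  proof safe
    fix x :: complex assume x: "x \<noteq> 0"
    have *: "x ^ 2 * ((v / x) ^ 2 * E2 z + K * (v / x)) + K * x = v ^ 2 * E2 z + x * (K * (v + 1))"
      "x ^ 4 * ((v / x) ^ 4 * E4 z) = v ^ 4 * E4 z" "x ^ 6 * ((v / x) ^ 6 * E6 z) = v ^ 6 * E6 z"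
      using x by (simp_all add: field_simps eval_nat_numeral)
    show "eval3 P (poly ?a x) (poly ?b x) (poly ?c x) = 0"
      using 2[of x "v / x"] unfolding * by simp
  qed
  moreover have "infinite (- {0::complex})" by (simp add: infinite_UNIV_char_0)
  ultimately have "infinite {s. eval3 P (poly ?a s) (poly ?b s) (poly ?c s) = 0}" by (meson finite_subset)
  from eval3_polynomial_zero[OF this, of "(w - v ^ 2 * E2 z) / (K * (v + 1))"] K v
  show ?thesis by (simp add: add_eq_0_iff add.commute)
qed

text \<open>At the cusp the ratio tends to 1 without taking that value nearby, because E_4^3 - E_6^2
  has derivative 3 * 240 + 2 * 504 = 1728 at q = 0. A finite set of values, with 1 removed, would be
  closed and would still contain the limit 1.\<close>

lemma infinite_E4_E6_ratios:
  "infinite {E4 z ^ 3 / E6 z ^ 2 | z. E4 z \<noteq> 0 \<and> E6 z \<noteq> 0}" (is "infinite ?R")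
proof
  assume fin: "finite ?R"
  define F4 where "F4 = (\<lambda>q. 1 + 240 * lambert 3 q)"
  define F6 where "F6 = (\<lambda>q. 1 - 504 * lambert 5 q)"
  have l: "(lambert s has_field_derivative 1) (at 0)" for s
    using lambert_has_field_derivative[of 0 s] by auto
  have l0: "lambert s 0 = 0" for s
    unfolding lambert_def by (rule infsum_0) (auto simp: lu_def power_0_left)
  have d: "(F4 has_field_derivative 240) (at 0)" "(F6 has_field_derivative -504) (at 0)"
    unfolding F4_def F6_def by (auto intro!: derivative_eq_intros l)
  have v0: "F4 0 = 1" "F6 0 = 1" by (simp_all add: F4_def F6_def l0)
  have "((\<lambda>q. F4 q ^ 3 - F6 q ^ 2) has_field_derivative 1728) (at 0)"
    by (auto intro!: derivative_eq_intros d simp: v0)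
  then have "((\<lambda>q. (F4 q ^ 3 - F6 q ^ 2) / q) \<longlongrightarrow> 1728) (at 0)"
    by (simp add: has_field_derivative_iff v0)
  then have "eventually (\<lambda>q. (F4 q ^ 3 - F6 q ^ 2) / q \<noteq> 0) (at 0)"
    by (rule tendsto_imp_eventually_ne) simp
  then have ne: "eventually (\<lambda>q. F4 q ^ 3 \<noteq> F6 q ^ 2) (at 0)"
    by (rule eventually_mono) auto
  have lim: "(F4 \<longlongrightarrow> 1) (at 0)" "(F6 \<longlongrightarrow> 1) (at 0)"
    using DERIV_isCont[OF d(1)] DERIV_isCont[OF d(2)] by (simp_all add: isCont_def v0)
  then have "((\<lambda>q. F4 q ^ 3 / F6 q ^ 2) \<longlongrightarrow> 1 ^ 3 / 1 ^ 2) (at 0)"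
    by (intro tendsto_intros) auto
  then have lim2: "((\<lambda>q. F4 q ^ 3 / F6 q ^ 2) \<longlongrightarrow> 1) (at 0)" by simp
  have n0: "eventually (\<lambda>q. F4 q \<noteq> 0) (at 0)" "eventually (\<lambda>q. F6 q \<noteq> 0) (at 0)"
    using lim by (auto intro: tendsto_imp_eventually_ne)
  have "eventually (\<lambda>q. q \<in> ball 0 1 - {0}) (at (0::complex))"
    by (rule eventually_at_in_open) auto
  then have ev: "eventually (\<lambda>q. F4 q ^ 3 / F6 q ^ 2 \<in> ?R - {1}) (at 0)"
    using ne n0
  proof eventually_elim
    case (elim q)
    \<comment> \<open>A point of the half plane with nome q, for a given q in the punctured unit
      disc.\<close>
    define w where "w = Ln q / (2 * of_real pi * \<i>)"
    have "Im w = - ln (norm q) / (2 * pi)" unfolding w_def using elim(1)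
      by (simp add: Im_divide Re_Ln power2_eq_square field_simps)
    moreover have "ln (norm q) < 0" using elim(1) by simp
    ultimately have "Im w > 0" by (metis divide_pos_pos neg_0_less_iff_less mult_pos_pos pi_gt_zero zero_less_numeral)
    then have "Rep_uhp (Abs_uhp w) = w" by (simp add: Abs_uhp_inverse)
    then have "nome (Abs_uhp w) = q" using elim(1) by (simp add: nome_def w_def)
    then have "E4 (Abs_uhp w) = F4 q" "E6 (Abs_uhp w) = F6 q" by (simp_all add: E_eq_lambert F4_def F6_def)
    with elim show ?case by (auto intro!: exI[of _ "Abs_uhp w"])
  qed
  have "1 \<in> ?R - {1}"
    by (rule Lim_in_closed_set[OF _ ev _ lim2]) (use fin in \<open>auto intro: finite_imp_closed\<close>)
  then show False by simp
qed

theorem eisenstein_algebraically_independent: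
  assumes P: "\<And>z. eval3 P (E2 z) (E4 z) (E6 z) = 0"
  shows "P = 0"
proof -
  \<comment> \<open>The variables are specialised one at a time: the first to w, the last to B, and
    the remaining one to infinitely many values A.\<close>
  have slice: "poly P [:[:w:]:] = 0" for w
  proof -
    define Q where "Q = poly P [:[:w:]:]"
    have Q: "poly (poly Q [:v ^ 4 * E4 z:]) (v ^ 6 * E6 z) = 0" if "E4 z \<noteq> 0" "v \<noteq> -1" for v z
      using eval3_E_rescaled[OF P that] by (simp add: eval3_def Q_def)
    have mp: "poly (map_poly (\<lambda>c. poly c B) Q) A = poly (poly Q [:A:]) B" for A B
      by (induction Q) (auto simp: map_poly_pCons)
    have "map_poly (\<lambda>c. poly c B) Q = 0" if B: "B \<noteq> 0" for B
    proof -
      let ?Z = "{A. poly (map_poly (\<lambda>c. poly c B) Q) A = 0}"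
      \<comment> \<open>If v^6 E_6 = B, then A = v^4 E_4 is a root and A^3 / B^2 = E_4^3 / E_6^2 at
        the same point. So infinitely many ratios force infinitely many roots A.\<close>
      have "{E4 z ^ 3 / E6 z ^ 2 | z. E4 z \<noteq> 0 \<and> E6 z \<noteq> 0} \<subseteq> (\<lambda>A. A ^ 3 / B ^ 2) ` ?Z"
      proof safe
        fix z assume z: "E4 z \<noteq> 0" "E6 z \<noteq> 0"
        obtain v0 where v0: "v0 ^ 6 = B / E6 z" using exists_complex_root[of 6 "B / E6 z"] by (metis zero_neq_numeral)
        \<comment> \<open>\<open>eval3_E_rescaled\<close> excludes - 1, which may be replaced by 1
          because only the sixth power is prescribed.\<close>
        obtain v where v: "v ^ 6 = B / E6 z" "v \<noteq> -1"
        proof (cases "v0 = -1")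
          case True
          then show ?thesis using that[of 1] v0 by simp
        qed (use that v0 in auto)
        have vB: "v ^ 6 * E6 z = B" using v(1) z by simp
        have "poly (map_poly (\<lambda>c. poly c B) Q) (v ^ 4 * E4 z) = 0"
          unfolding mp using Q[OF z(1) v(2)] by (simp add: vB)
        moreover have "E4 z ^ 3 / E6 z ^ 2 = (v ^ 4 * E4 z) ^ 3 / B ^ 2"
        proof -
          have "(v ^ 4) ^ 3 = (v ^ 6) ^ 2" unfolding power_mult[symmetric] by simp
          then have "(v ^ 4 * E4 z) ^ 3 = (v ^ 6) ^ 2 * E4 z ^ 3" by (simp only: power_mult_distrib)
          also have "\<dots> / B ^ 2 = E4 z ^ 3 / E6 z ^ 2" unfolding v(1) using z B by (simp add: power_divide)
          finally show ?thesis by simp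
        qed
        ultimately show "E4 z ^ 3 / E6 z ^ 2 \<in> (\<lambda>A. A ^ 3 / B ^ 2) ` ?Z" by blast
      qed
      then have "infinite ?Z" using infinite_E4_E6_ratios finite_surj by blast
      then show ?thesis using poly_roots_finite by blast
    qed
    then have c0: "poly (coeff Q n) B = 0" if "B \<noteq> 0" for n B
      using that coeff_map_poly[of "\<lambda>c. poly c B" Q n] by simp
    have "coeff Q n = 0" for n
    proof (rule ccontr)
      assume "coeff Q n \<noteq> 0"
      then have "finite {B. poly (coeff Q n) B = 0}" by (rule poly_roots_finite)
      moreover have "- {0} \<subseteq> {B. poly (coeff Q n) B = 0}" using c0 by auto
      moreover have "infinite (- {0::complex})" by (simp add: infinite_UNIV_char_0)
      ultimately show False by (meson finite_subset)
    qed
    then show ?thesis unfolding Q_def by (simp add: poly_eq_iff)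
  qed
  show "P = 0"
  proof (rule ccontr)
    assume "P \<noteq> 0"
    then have "finite {x. poly P x = 0}" by (rule poly_roots_finite)
    moreover have "range (\<lambda>w::complex. [:[:w:]:]) \<subseteq> {x. poly P x = 0}" using slice by auto
    moreover have "infinite (range (\<lambda>w::complex. [:[:w:]:]))"
      using infinite_UNIV_char_0 finite_imageD[of "\<lambda>w::complex. [:[:w:]:]" UNIV] by (auto simp: inj_on_def)
    ultimately show False by (meson finite_subset)
  qed
qed

section \<open>Quasimodular forms as polynomials\<close>

definition const3 :: "complex \<Rightarrow> poly3" where "const3 c = [:[:[:c:]:]:]"
definition X3 :: poly3 where "X3 = [:0, 1:]"
definition Y3 :: poly3 where "Y3 = [:[:0, 1:]:]"
definition Z3 :: poly3 where "Z3 = [:[:[:0, 1:]:]:]"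

lemma eval3_gens [simp]:
  "eval3 (const3 c) x y z = c" "eval3 X3 x y z = x" "eval3 Y3 x y z = y" "eval3 Z3 x y z = z"
  by (simp_all add: eval3_def const3_def X3_def Y3_def Z3_def)

lemma eval3_power [simp]: "eval3 (p ^ n) x y z = eval3 p x y z ^ n"
  by (induction n) auto

lemma poly3_coeff_induct [consumes 0, case_names const Y Z add mult]:
  assumes "\<And>c. P (const3 c)" "P Y3" "P Z3"
    "\<And>p q. P p \<Longrightarrow> P q \<Longrightarrow> P (p + q)" "\<And>p q. P p \<Longrightarrow> P q \<Longrightarrow> P (p * q)"
  shows "P [:m:]"
proof (induction m)
  case 0
  show ?case using assms(1)[of 0] by (simp add: const3_def)
next
  case (pCons n m)
  have "P [:[:n:]:]"
  proof (induction n)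
    case 0
    show ?case using assms(1)[of 0] by (simp add: const3_def)
  next
    case (pCons a n)
    have "P (const3 a + Z3 * [:[:n:]:])" by (intro assms pCons.IH)
    also have "const3 a + Z3 * [:[:n:]:] = [:[:pCons a n:]:]" by (simp add: const3_def Z3_def)
    finally show ?case .
  qed
  then have "P ([:[:n:]:] + Y3 * [:m:])" by (intro assms pCons.IH)
  also have "[:[:n:]:] + Y3 * [:m:] = [:pCons n m:]" by (simp add: Y3_def)
  finally show ?case .
qed

lemma poly3_induct [case_names const X Y Z add mult]:
  assumes "\<And>c. P (const3 c)" "P X3" "P Y3" "P Z3"
    "\<And>p q. P p \<Longrightarrow> P q \<Longrightarrow> P (p + q)" "\<And>p q. P p \<Longrightarrow> P q \<Longrightarrow> P (p * q)"
  shows "P p"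
proof (induction p)
  case 0
  show ?case using assms(1)[of 0] by (simp add: const3_def)
next
  case (pCons m p)
  have "P [:m:]" by (rule poly3_coeff_induct) (use assms in auto)
  then have "P ([:m:] + X3 * p)" by (intro assms pCons.IH)
  then show ?case by (simp add: X3_def)
qed

lemma const3_hom:
  "const3 (a + b) = const3 a + const3 b" "const3 (a * b) = const3 a * const3 b"
  "const3 (- a) = - const3 a" "const3 0 = 0" "const3 1 = 1"
  by (simp_all add: const3_def one_pCons)

lemma const3_eq_0_iff [simp]: "const3 c = 0 \<longleftrightarrow> c = 0"
  by (simp add: const3_def)

lemma degree_const3 [simp]: "degree (const3 c) = 0" "degree Y3 = 0" "degree Z3 = 0"
  by (simp_all add: const3_def Y3_def Z3_def)

definition eisen :: "poly3 \<Rightarrow> uhp_fun" where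
  "eisen p = (\<lambda>z. eval3 p (E2 z) (E4 z) (E6 z))"

lemma eisen_hom:
  "eisen (p + q) = eisen p + eisen q" "eisen (p * q) = eisen p * eisen q"
  "eisen (- p) = - eisen p" "eisen (p - q) = eisen p - eisen q" "eisen (p ^ n) = eisen p ^ n"
  "eisen 0 = 0" "eisen 1 = 1"
proof -
  show "eisen (p + q) = eisen p + eisen q" "eisen (p * q) = eisen p * eisen q"
    "eisen (- p) = - eisen p" "eisen (p - q) = eisen p - eisen q" "eisen 0 = 0" "eisen 1 = 1" for p q
    by (auto simp: eisen_def)
  then show "eisen (p ^ n) = eisen p ^ n" by (induction n) auto
qed

lemma eisen_gens: "eisen X3 = E2" "eisen Y3 = E4" "eisen Z3 = E6"
  "eisen (const3 c * p) = cscale c (eisen p)" "eisen (const3 c) = cscale c 1"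
  by (auto simp: eisen_def cscale_def)

text \<open>Algebraic independence in the form used from here on: an identity between functions can
  be checked on polynomials and conversely.\<close>

lemma inj_eisen: "inj eisen"
proof (rule injI)
  fix p q assume "eisen p = eisen q"
  then have "eval3 (p - q) (E2 z) (E4 z) (E6 z) = 0" for z
    by (auto simp: eisen_def dest: fun_cong[of _ _ z])
  from eisenstein_algebraically_independent[OF this] show "p = q" by simp
qed

lemma eisen_eq_iff [simp]: "eisen p = eisen q \<longleftrightarrow> p = q"
  using inj_eisen by (auto dest: injD)

lemma cfun_span_mult:
  assumes "\<And>x y. x \<in> S \<Longrightarrow> y \<in> T \<Longrightarrow> x * y \<in> cfun.span U"
    and "f \<in> cfun.span S" "g \<in> cfun.span T"
  shows "f * g \<in> cfun.span U"
proof -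
  have 1: "x * g \<in> cfun.span U" if "x \<in> S" for x
    using assms(3)
  proof (induction rule: cfun.span_induct_alt)
    case base
    show ?case unfolding mult_zero_right by (rule cfun.span_zero)
  next
    case (step c y v)
    have "x * (cscale c y + v) = cscale c (x * y) + x * v"
      by (auto simp: cscale_def algebra_simps)
    then show ?case by (metis cfun.span_add cfun.span_scale step assms(1)[OF that])
  qed
  show ?thesis using assms(2)
  proof (induction rule: cfun.span_induct_alt)
    case base
    show ?case unfolding mult_zero_left by (rule cfun.span_zero)
  next
    case (step c x v)
    have "(cscale c x + v) * g = cscale c (x * g) + v * g"
      by (auto simp: cscale_def algebra_simps)
    then show ?case by (metis cfun.span_add cfun.span_scale step 1)
  qed
qed

lemma subspace_eisen_image:
  assumes "\<And>p q. p \<in> S \<Longrightarrow> q \<in> S \<Longrightarrow> p + q \<in> S" "\<And>c p. p \<in> S \<Longrightarrow> const3 c * p \<in> S" "0 \<in> S"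
  shows "cfun.subspace (eisen ` S)"
  unfolding cfun.subspace_def
  by (auto simp flip: eisen_hom eisen_gens intro!: imageI assms)

lemma quasimodular_algebra_eq: "quasimodular_algebra = range eisen"
proof
  show "quasimodular_algebra \<subseteq> range eisen"
    unfolding quasimodular_algebra_def
    by (rule cfun.span_minimal[OF _ subspace_eisen_image]) (auto simp flip: eisen_hom eisen_gens)
  let ?S = "{E2 ^ c * E4 ^ a * E6 ^ b |a b c. True}"
  have mono: "E2 ^ c * E4 ^ a * E6 ^ b \<in> cfun.span ?S" for a b c by (rule cfun.span_base) blast
  have "eisen p \<in> cfun.span ?S" for p
  proof (induction p rule: poly3_induct)
    case (const c)
    show ?case unfolding eisen_gens by (rule cfun.span_scale) (use mono[of 0 0 0] in \<open>simp only: power_0 mult_1_right\<close>)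
  next
    case X show ?case unfolding eisen_gens using mono[of 1 0 0] by (simp only: power_0 power_one_right mult_1_left mult_1_right)
  next
    case Y show ?case unfolding eisen_gens using mono[of 0 1 0] by (simp only: power_0 power_one_right mult_1_left mult_1_right)
  next
    case Z show ?case unfolding eisen_gens using mono[of 0 0 1] by (simp only: power_0 power_one_right mult_1_left mult_1_right)
  next
    case (add p q)
    then show ?case unfolding eisen_hom by (rule cfun.span_add)
  next
    case (mult p q)
    show ?case unfolding eisen_hom
    proof (rule cfun_span_mult[OF _ mult])
      fix x y assume "x \<in> ?S" "y \<in> ?S"
      then obtain a b c a' b' c' where "x = E2 ^ c * E4 ^ a * E6 ^ b" "y = E2 ^ c' * E4 ^ a' * E6 ^ b'" by blast
      then have "x * y = E2 ^ (c + c') * E4 ^ (a + a') * E6 ^ (b + b')" by (simp add: power_add mult_ac)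
      then show "x * y \<in> cfun.span ?S" using mono by simp
    qed
  qed
  then show "range eisen \<subseteq> quasimodular_algebra" unfolding quasimodular_algebra_def by blast
qed

lemma modular_algebra_eq: "modular_algebra = eisen ` {p. degree p = 0}"
proof
  show "modular_algebra \<subseteq> eisen ` {p. degree p = 0}"
    unfolding modular_algebra_def
  proof (rule cfun.span_minimal[OF _ subspace_eisen_image])
    show "{E4 ^ a * E6 ^ b |a b. True} \<subseteq> eisen ` {p. degree p = 0}"
    proof safe
      fix a b
      have "degree (Y3 ^ a * Z3 ^ b) = 0"
        using degree_mult_le[of "Y3 ^ a" "Z3 ^ b"] degree_power_le[of Y3 a] degree_power_le[of Z3 b] by simp
      then show "E4 ^ a * E6 ^ b \<in> eisen ` {p. degree p = 0}" by (simp flip: eisen_hom eisen_gens)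
    qed
    show "p + q \<in> {p. degree p = 0}" if "p \<in> {p. degree p = 0}" "q \<in> {p. degree p = 0}" for p q :: poly3
      using that degree_add_le[of p 0 q] by simp
    show "const3 c * p \<in> {p. degree p = 0}" if "p \<in> {p. degree p = 0}" for p c
      using that degree_mult_le[of "const3 c" p] by simp
  qed simp
  let ?S = "{E4 ^ a * E6 ^ b |a b. True}"
  have mono: "E4 ^ a * E6 ^ b \<in> cfun.span ?S" for a b by (rule cfun.span_base) blast
  have "eisen [:m:] \<in> cfun.span ?S" for m
  proof (induction m rule: poly3_coeff_induct)
    case (const c)
    show ?case unfolding eisen_gens by (rule cfun.span_scale) (use mono[of 0 0] in \<open>simp only: power_0 mult_1_right\<close>)
  next
    case Y show ?case unfolding eisen_gens using mono[of 1 0] by (simp only: power_0 power_one_right mult_1_left mult_1_right)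
  next
    case Z show ?case unfolding eisen_gens using mono[of 0 1] by (simp only: power_0 power_one_right mult_1_left mult_1_right)
  next
    case (add p q)
    then show ?case unfolding eisen_hom by (rule cfun.span_add)
  next
    case (mult p q)
    show ?case unfolding eisen_hom
    proof (rule cfun_span_mult[OF _ mult])
      fix x y assume "x \<in> ?S" "y \<in> ?S"
      then obtain a b a' b' where "x = E4 ^ a * E6 ^ b" "y = E4 ^ a' * E6 ^ b'" by blast
      then have "x * y = E4 ^ (a + a') * E6 ^ (b + b')" by (simp add: power_add mult_ac)
      then show "x * y \<in> cfun.span ?S" using mono by simp
    qed
  qed
  then show "eisen ` {p. degree p = 0} \<subseteq> modular_algebra" unfolding modular_algebra_def
    by (auto elim: degree_eq_zeroE)
qed

section \<open>Derivations and brackets on polynomials\<close>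

text \<open>The twist by \<phi> covers ordinary derivations, with \<phi> the identity, and also the
  failure of \<phi> to intertwine two brackets.\<close>

definition derivation_along :: "(poly3 \<Rightarrow> poly3) \<Rightarrow> (poly3 \<Rightarrow> poly3) \<Rightarrow> bool" where
  "derivation_along \<phi> F \<longleftrightarrow> (\<forall>c. F (const3 c) = 0) \<and> (\<forall>p q. F (p + q) = F p + F q) \<and>
     (\<forall>p q. F (p * q) = \<phi> p * F q + F p * \<phi> q)"

lemma derivation_along_zero:
  assumes "derivation_along \<phi> F" "F X3 = 0" "F Y3 = 0" "F Z3 = 0"
  shows "F p = 0"
  using assms unfolding derivation_along_def by (induction p rule: poly3_induct) auto

text \<open>Skew symmetry transports additivity and the Leibniz rule to the second argument.\<close>

definition biderivation :: "(poly3 \<Rightarrow> poly3 \<Rightarrow> poly3) \<Rightarrow> bool" where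
  "biderivation B \<longleftrightarrow> (\<forall>q. derivation_along id (\<lambda>p. B p q)) \<and> (\<forall>p q. B p q = - B q p)"

lemma poly3_eq_neg_self: "(p :: poly3) = - p \<Longrightarrow> p = 0"
proof -
  assume "p = - p"
  then have "p + p = 0" by simp
  then have "const3 2 * p = 0" using const3_hom(1)[of 1 1] by (simp add: const3_hom(5) algebra_simps)
  then show "p = 0" by simp
qed

lemma biderivationD:
  assumes "biderivation B"
  shows "B p q = - B q p" "B (p + p') q = B p q + B p' q" "B (p * p') q = p * B p' q + B p q * p'"
    "B (const3 c) q = 0" "B p (q + q') = B p q + B p q'" "B p (q * q') = q * B p q' + B p q * q'"
    "B p (const3 c) = 0" "B p p = 0" "B (- p) q = - B p q" "B p (- q) = - B p q" "B 0 q = 0" "B p 0 = 0"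
proof -
  have skew: "B p q = - B q p" for p q using assms unfolding biderivation_def by blast
  have d: "derivation_along id (\<lambda>p. B p q)" for q using assms unfolding biderivation_def by blast
  show "B p q = - B q p" by (rule skew)
  show add: "B (p + p') q = B p q + B p' q" for p p' q using d unfolding derivation_along_def by blast
  show mult: "B (p * p') q = p * B p' q + B p q * p'" for p p' q
    using d[of q] unfolding derivation_along_def by simp
  show const: "B (const3 c) q = 0" for c q using d unfolding derivation_along_def by blast
  show "B p (q + q') = B p q + B p q'" using skew[of p "q + q'"] skew[of q p] skew[of q' p] add by simp
  show "B p (q * q') = q * B p q' + B p q * q'"
    using skew[of p "q * q'"] skew[of q p] skew[of q' p] mult by simp
  show "B p (const3 c) = 0" using skew[of p "const3 c"] const by simp
  show "B p p = 0" using skew poly3_eq_neg_self by blast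
  show z: "B 0 q = 0" for q using const[of 0] by (simp add: const3_hom)
  show m: "B (- p) q = - B p q" for p q using add[of p "- p" q] z[of q] by (simp add: eq_neg_iff_add_eq_0 add.commute)
  show "B p (- q) = - B p q" using skew[of p "- q"] skew[of q p] m by simp
  show "B p 0 = 0" using skew[of p 0] z by simp
qed

text \<open>The difference of the two sides is a derivation along \<phi> in each argument
  separately, so the generators are inserted first on one side and then on the other.\<close>

lemma biderivation_intertwine:
  assumes B: "biderivation B" "biderivation B'"
    and \<phi>: "\<And>p q. \<phi> (p + q) = \<phi> p + \<phi> q" "\<And>p q. \<phi> (p * q) = \<phi> p * \<phi> q" "\<And>c. \<phi> (const3 c) = const3 c"
    and gens: "\<phi> (B Y3 Z3) = B' (\<phi> Y3) (\<phi> Z3)" "\<phi> (B X3 Y3) = B' (\<phi> X3) (\<phi> Y3)" "\<phi> (B X3 Z3) = B' (\<phi> X3) (\<phi> Z3)"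
  shows "\<phi> (B p q) = B' (\<phi> p) (\<phi> q)"
proof -
  note b = biderivationD[OF B(1)] and b' = biderivationD[OF B(2)]
  have \<phi>0: "\<phi> 0 = 0" using \<phi>(3)[of 0] by (simp add: const3_hom)
  have \<phi>m: "\<phi> (- p) = - \<phi> p" for p using \<phi>(1)[of p "- p"] \<phi>0 by (simp add: eq_neg_iff_add_eq_0 add.commute)
  have d: "derivation_along \<phi> (\<lambda>p. \<phi> (B p q) - B' (\<phi> p) (\<phi> q))" for q
    unfolding derivation_along_def by (simp add: \<phi> b(2,3,4) b'(2,3,4) \<phi>0 algebra_simps)
  have swap: "\<phi> (B p q) - B' (\<phi> p) (\<phi> q) = - (\<phi> (B q p) - B' (\<phi> q) (\<phi> p))" for p q
    using b(1)[of p q] b'(1)[of "\<phi> p" "\<phi> q"] \<phi>m by simp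
  have g: "\<phi> (B p q) - B' (\<phi> p) (\<phi> q) = 0" if "q \<in> {X3, Y3, Z3}" for p q
    by (rule derivation_along_zero[OF d])
      (use that gens swap[of Y3 X3] swap[of Z3 X3] swap[of Z3 Y3] in \<open>auto simp: b(8) b'(8) \<phi>0\<close>)
  have "\<phi> (B p q) - B' (\<phi> p) (\<phi> q) = 0"
    by (rule derivation_along_zero[OF d]) (subst swap, simp add: g)+
  then show ?thesis by simp
qed

lemma biderivation_unique:
  assumes "biderivation B" "biderivation B'"
    "B Y3 Z3 = B' Y3 Z3" "B X3 Y3 = B' X3 Y3" "B X3 Z3 = B' X3 Z3"
  shows "B p q = B' p q"
  using biderivation_intertwine[OF assms(1,2), of id] assms(3-) by simp

definition jacobiator :: "(poly3 \<Rightarrow> poly3 \<Rightarrow> poly3) \<Rightarrow> poly3 \<Rightarrow> poly3 \<Rightarrow> poly3 \<Rightarrow> poly3" where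
  "jacobiator B p q r = B p (B q r) + B q (B r p) + B r (B p q)"

text \<open>The Jacobiator of a biderivation is an alternating triderivation, so it is determined by its
  value on the three generators.\<close>

lemma jacobiator_eq_0:
  assumes B: "biderivation B" and gens: "jacobiator B X3 Y3 Z3 = 0"
  shows "jacobiator B p q r = 0"
proof -
  note b = biderivationD[OF B]
  have d: "derivation_along id (\<lambda>p. jacobiator B p q r)" for q r
    unfolding derivation_along_def
  proof (intro conjI allI)
    fix p p' c
    show "jacobiator B (const3 c) q r = 0" by (simp add: jacobiator_def b(4,7,8,9,10,11,12))
    show "jacobiator B (p + p') q r = jacobiator B p q r + jacobiator B p' q r"
      by (simp add: jacobiator_def b(2,5))
    \<comment> \<open>The deviation from the Leibniz rule consists of two terms, each with a factor
      that skew symmetry makes zero.\<close>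
    have "jacobiator B (p * p') q r = id p * jacobiator B p' q r + jacobiator B p q r * id p' +
       (B q p + B p q) * B r p' + (B q p' + B p' q) * B r p"
      by (simp only: jacobiator_def b(2,3,5,6) id_apply) (simp only: distrib_left distrib_right mult_ac add_ac)
    then show "jacobiator B (p * p') q r = id p * jacobiator B p' q r + jacobiator B p q r * id p'"
      using b(1)[of p q] b(1)[of p' q] by simp
  qed
  have cyc: "jacobiator B p q r = jacobiator B q r p" for p q r by (simp add: jacobiator_def)
  have alt: "jacobiator B p p r = 0" for p r
    using b(1)[of r p] by (simp add: jacobiator_def b(8,10,12))
  have anti: "jacobiator B q p r = - jacobiator B p q r" for p q r
    using b(1)[of p r] b(1)[of r q] b(1)[of q p] by (simp add: jacobiator_def b(10))
  have alt': "jacobiator B p q q = 0" "jacobiator B p q p = 0" for p q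
    using alt cyc by metis+
  have g3: "jacobiator B p q r = 0" if "p \<in> {X3, Y3, Z3}" "q \<in> {X3, Y3, Z3}" "r \<in> {X3, Y3, Z3}" for p q r
  proof -
    have "jacobiator B Y3 Z3 X3 = 0" "jacobiator B Z3 X3 Y3 = 0" using gens cyc by metis+
    moreover from this gens have "jacobiator B Y3 X3 Z3 = 0" "jacobiator B Z3 Y3 X3 = 0" "jacobiator B X3 Z3 Y3 = 0"
      using anti[of Y3 X3 Z3] anti[of Z3 Y3 X3] anti[of X3 Z3 Y3] by simp_all
    ultimately show ?thesis using that gens alt alt' by auto
  qed
  have g2: "jacobiator B p q r = 0" if "q \<in> {X3, Y3, Z3}" "r \<in> {X3, Y3, Z3}" for p q r
    by (rule derivation_along_zero[OF d[of q r]]) (use g3 that in auto)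
  have g1: "jacobiator B p q r = 0" if "r \<in> {X3, Y3, Z3}" for p q r
    unfolding cyc[of p q r]
    by (rule derivation_along_zero[OF d[of r p]])
      (use g2[of X3 r p] g2[of Y3 r p] g2[of Z3 r p] cyc[of p X3 r] cyc[of p Y3 r] cyc[of p Z3 r] that in simp)+
  show ?thesis
    unfolding cyc[of r p q, symmetric]
    by (rule derivation_along_zero[OF d[of p q]])
      (use g1[of X3 p q] g1[of Y3 p q] g1[of Z3 p q] cyc[of X3 p q] cyc[of Y3 p q] cyc[of Z3 p q] in simp)+
qed

section \<open>Partial derivatives and the bracket with prescribed values on generators\<close>

lemma map_poly_derivation:
  fixes d :: "'a :: comm_ring_1 \<Rightarrow> 'a"
  assumes d: "\<And>a b. d (a + b) = d a + d b" "\<And>a b. d (a * b) = a * d b + d a * b"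
  shows "map_poly d (p + q) = map_poly d p + map_poly d q"
    and "map_poly d (p * q) = p * map_poly d q + map_poly d p * q"
proof -
  have d0: "d 0 = 0" using d(1)[of 0 0] by simp
  show add: "map_poly d (p + q) = map_poly d p + map_poly d q" for p q
    by (rule poly_eqI) (simp add: coeff_map_poly d0 d)
  have smult: "map_poly d (smult a q) = smult a (map_poly d q) + smult (d a) q" for a q
    by (rule poly_eqI) (simp add: coeff_map_poly d0 d)
  show "map_poly d (p * q) = p * map_poly d q + map_poly d p * q"
  proof (induction p)
    case (pCons a p)
    have "map_poly d (pCons 0 (p * q)) = pCons 0 (map_poly d (p * q))" by (simp add: map_poly_pCons d0)
    moreover have "map_poly d (pCons a p) = pCons (d a) (map_poly d p)" by (simp add: map_poly_pCons d0)
    ultimately show ?case using pCons.IH by (simp add: add smult algebra_simps)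
  qed simp
qed

definition dX :: "poly3 \<Rightarrow> poly3" where "dX = pderiv"
definition dY :: "poly3 \<Rightarrow> poly3" where "dY = map_poly pderiv"
definition dZ :: "poly3 \<Rightarrow> poly3" where "dZ = map_poly (map_poly pderiv)"

lemma partial_derivations:
  "dX (p + q) = dX p + dX q" "dX (p * q) = p * dX q + dX p * q"
  "dY (p + q) = dY p + dY q" "dY (p * q) = p * dY q + dY p * q"
  "dZ (p + q) = dZ p + dZ q" "dZ (p * q) = p * dZ q + dZ p * q"
proof -
  have pd: "pderiv (a * b) = a * pderiv b + pderiv a * b" for a b :: "'a :: idom poly"
    by (simp add: pderiv_mult algebra_simps)
  show "dX (p + q) = dX p + dX q" "dX (p * q) = p * dX q + dX p * q"
    unfolding dX_def by (simp_all add: pderiv_add pd)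
  show "dY (p + q) = dY p + dY q" "dY (p * q) = p * dY q + dY p * q"
    unfolding dY_def by (rule map_poly_derivation; simp add: pderiv_add pd)+
  show "dZ (p + q) = dZ p + dZ q" "dZ (p * q) = p * dZ q + dZ p * q"
    unfolding dZ_def by (rule map_poly_derivation; rule map_poly_derivation; simp add: pderiv_add pd)+
qed

lemma partial_gens [simp]:
  "dX (const3 c) = 0" "dX X3 = 1" "dX Y3 = 0" "dX Z3 = 0"
  "dY (const3 c) = 0" "dY X3 = 0" "dY Y3 = 1" "dY Z3 = 0"
  "dZ (const3 c) = 0" "dZ X3 = 0" "dZ Y3 = 0" "dZ Z3 = 1"
  by (simp_all add: dX_def dY_def dZ_def const3_def X3_def Y3_def Z3_def map_poly_pCons pderiv_pCons one_pCons)

lemma partial_coeff: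
  "dX [:m:] = 0" "degree (dY [:m:]) = 0" "degree (dZ [:m:]) = 0"
  by (simp_all add: dX_def dY_def dZ_def map_poly_pCons pderiv_pCons)

text \<open>The bivector field with coefficients u, v, w on the pairs (Y, Z), (X, Y), (X,
  Z).\<close>

definition bracket3 :: "poly3 \<Rightarrow> poly3 \<Rightarrow> poly3 \<Rightarrow> poly3 \<Rightarrow> poly3 \<Rightarrow> poly3" where
  "bracket3 u v w p q = u * (dY p * dZ q - dZ p * dY q) + v * (dX p * dY q - dY p * dX q) +
     w * (dX p * dZ q - dZ p * dX q)"

lemma biderivation_bracket3: "biderivation (bracket3 u v w)"
  unfolding biderivation_def derivation_along_def
  by (auto simp: bracket3_def partial_derivations algebra_simps)

lemma bracket3_gens:
  "bracket3 u v w Y3 Z3 = u" "bracket3 u v w X3 Y3 = v" "bracket3 u v w X3 Z3 = w"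
  by (simp_all add: bracket3_def)

lemma eisen_in_quasimodular [simp]: "eisen p \<in> quasimodular_algebra"
  unfolding quasimodular_algebra_eq by blast

lemma eval3_numeral [simp]: "eval3 (numeral n) x y z = numeral n"
  by (simp add: eval3_def numeral_poly)

lemma numeral_fun_apply: "(numeral n :: 'a \<Rightarrow> complex) x = numeral n"
  by (induction n) (simp_all add: numeral.simps)

lemma power_fun_apply: "((f :: 'a \<Rightarrow> complex) ^ n) x = f x ^ n"
  by (induction n) simp_all

section \<open>Transfer of Poisson brackets between functions and polynomials\<close>

lemma poisson_bracket_on_eisenI:
  assumes B: "biderivation B" and jac: "\<And>p q r. jacobiator B p q r = 0"
    and b: "\<And>p q. b (eisen p) (eisen q) = eisen (B p q)"
  shows "poisson_bracket_on quasimodular_algebra b"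
proof -
  note d = biderivationD[OF B]
  have c: "B (const3 c * p) q = const3 c * B p q" "B p (const3 c * q) = const3 c * B p q" for c p q
    by (simp_all add: d(3,4,6,7))
  have j: "eisen (B p (B q r)) + eisen (B q (B r p)) + eisen (B r (B p q)) = 0" for p q r
    unfolding eisen_hom(1)[symmetric] using jac[of p q r] by (simp add: jacobiator_def eisen_hom)
  show ?thesis
    unfolding poisson_bracket_on_def quasimodular_algebra_eq ball_simps(9)
  proof (intro conjI allI ballI UNIV_I)
    fix p q r c
    show "b (eisen p) (eisen q) \<in> range eisen" unfolding b by blast
    show "b (eisen p + eisen q) (eisen r) = b (eisen p) (eisen r) + b (eisen q) (eisen r)"
      unfolding b eisen_hom(1)[symmetric] d(2) ..
    show "b (eisen p) (eisen q + eisen r) = b (eisen p) (eisen q) + b (eisen p) (eisen r)"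
      unfolding b eisen_hom(1)[symmetric] d(5) ..
    show "b (cscale c (eisen p)) (eisen q) = cscale c (b (eisen p) (eisen q))"
      unfolding eisen_gens(4)[symmetric] b c ..
    show "b (eisen p) (cscale c (eisen q)) = cscale c (b (eisen p) (eisen q))"
      unfolding eisen_gens(4)[symmetric] b c ..
    show "b (eisen p) (eisen q) = - b (eisen q) (eisen p)"
      unfolding b eisen_hom(3)[symmetric] by (rule arg_cong[OF d(1)])
    show "b (eisen p * eisen q) (eisen r) = eisen p * b (eisen q) (eisen r) + b (eisen p) (eisen r) * eisen q"
      unfolding eisen_hom(2)[symmetric] b d(3) eisen_hom(1) ..
    show "b (eisen p) (eisen q * eisen r) = b (eisen p) (eisen q) * eisen r + eisen q * b (eisen p) (eisen r)"
      unfolding eisen_hom(2)[symmetric] b eisen_hom(1)[symmetric] by (simp only: d(6) add.commute)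
    show "b (eisen p) (b (eisen q) (eisen r)) + b (eisen q) (b (eisen r) (eisen p)) + b (eisen r) (b (eisen p) (eisen q)) = 0"
      unfolding b by (rule j)
  qed
qed

lemma poisson_bracket_onD:
  assumes "poisson_bracket_on A b"
  shows "f \<in> A \<Longrightarrow> g \<in> A \<Longrightarrow> b f g \<in> A"
    and "f \<in> A \<Longrightarrow> g \<in> A \<Longrightarrow> h \<in> A \<Longrightarrow> b (f + g) h = b f h + b g h"
    and "f \<in> A \<Longrightarrow> g \<in> A \<Longrightarrow> b (cscale c f) g = cscale c (b f g)"
    and "f \<in> A \<Longrightarrow> g \<in> A \<Longrightarrow> b f g = - b g f"
    and "f \<in> A \<Longrightarrow> g \<in> A \<Longrightarrow> h \<in> A \<Longrightarrow> b (f * g) h = f * b g h + b f h * g"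
    and "f \<in> A \<Longrightarrow> g \<in> A \<Longrightarrow> h \<in> A \<Longrightarrow> b f (b g h) + b g (b h f) + b h (b f g) = 0"
proof -
  note C = assms[unfolded poisson_bracket_on_def]
  show "f \<in> A \<Longrightarrow> g \<in> A \<Longrightarrow> b f g \<in> A"
    by (rule C[THEN conjunct1, rule_format])
  show "f \<in> A \<Longrightarrow> g \<in> A \<Longrightarrow> h \<in> A \<Longrightarrow> b (f + g) h = b f h + b g h"
    by (rule C[THEN conjunct2, THEN conjunct1, rule_format])
  show "f \<in> A \<Longrightarrow> g \<in> A \<Longrightarrow> b (cscale c f) g = cscale c (b f g)"
    by (rule C[THEN conjunct2, THEN conjunct2, THEN conjunct2, THEN conjunct1, rule_format])
  show "f \<in> A \<Longrightarrow> g \<in> A \<Longrightarrow> b f g = - b g f"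
    by (rule C[THEN conjunct2, THEN conjunct2, THEN conjunct2, THEN conjunct2, THEN conjunct2, THEN conjunct1, rule_format])
  show "f \<in> A \<Longrightarrow> g \<in> A \<Longrightarrow> h \<in> A \<Longrightarrow> b (f * g) h = f * b g h + b f h * g"
    by (rule C[THEN conjunct2, THEN conjunct2, THEN conjunct2, THEN conjunct2, THEN conjunct2, THEN conjunct2, THEN conjunct1, rule_format])
  show "f \<in> A \<Longrightarrow> g \<in> A \<Longrightarrow> h \<in> A \<Longrightarrow> b f (b g h) + b g (b h f) + b h (b f g) = 0"
    by (rule C[THEN conjunct2, THEN conjunct2, THEN conjunct2, THEN conjunct2, THEN conjunct2, THEN conjunct2, THEN conjunct2, THEN conjunct2, rule_format])
qed

text \<open>Closure of the algebra under b allows B to be chosen, and injectivity of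
  \<open>eisen\<close> turns each axiom for b into one for B.\<close>

lemma poisson_bracket_on_eisenE:
  assumes "poisson_bracket_on quasimodular_algebra b"
  obtains B where "biderivation B" "\<And>p q r. jacobiator B p q r = 0"
    "\<And>p q. b (eisen p) (eisen q) = eisen (B p q)"
proof -
  note A = poisson_bracket_onD[OF assms]
  have "\<exists>r. b (eisen p) (eisen q) = eisen r" for p q
    using A(1)[OF eisen_in_quasimodular eisen_in_quasimodular, of p q]
    unfolding quasimodular_algebra_eq by (rule imageE) (rule exI)
  then obtain B where b: "\<And>p q. b (eisen p) (eisen q) = eisen (B p q)" by metis
  have "eisen (B (p + q) r) = eisen (B p r + B q r)" for p q r
    unfolding eisen_hom(1) b[symmetric] by (rule A(2); rule eisen_in_quasimodular)
  then have add: "B (p + q) r = B p r + B q r" for p q r by simp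
  have "eisen (B (p * q) r) = eisen (p * B q r + B p r * q)" for p q r
    unfolding eisen_hom(1,2) b[symmetric] by (rule A(5); rule eisen_in_quasimodular)
  then have mult: "B (p * q) r = p * B q r + B p r * q" for p q r by simp
  have "eisen (B (const3 c * p) r) = eisen (const3 c * B p r)" for c p r
    unfolding eisen_gens(4) b[symmetric] by (rule A(3); rule eisen_in_quasimodular)
  then have scale: "B (const3 c * p) r = const3 c * B p r" for c p r by simp
  have "eisen (B p q) = eisen (- B q p)" for p q
    unfolding eisen_hom(3) b[symmetric] by (rule A(4); rule eisen_in_quasimodular)
  then have skew: "B p q = - B q p" for p q by (rule injD[OF inj_eisen])
  have "B 1 r = 0" for r using mult[of 1 1 r] by simp
  then have const: "B (const3 c) r = 0" for c r using scale[of c 1 r] by simp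
  have "biderivation B" unfolding biderivation_def derivation_along_def id_apply
    by (intro conjI allI add mult const skew)
  moreover have "eisen (jacobiator B p q r) = 0" for p q r
    unfolding jacobiator_def eisen_hom(1) b[symmetric] by (rule A(6); rule eisen_in_quasimodular)
  then have "eisen (jacobiator B p q r) = eisen 0" for p q r by (simp only: eisen_hom)
  then have "jacobiator B p q r = 0" for p q r by simp
  ultimately show ?thesis using that b by metis
qed

text \<open>The definite description is meaningful only if some Poisson bracket has the three
  values; this is where the Jacobi identity on generators comes in. Uniqueness holds inside the
  algebra by \<open>biderivation_unique\<close> and outside by the convention that the bracket is
  zero there.\<close>

lemma bracket_of_values_eisen:
  assumes jac: "jacobiator (bracket3 u v w) X3 Y3 Z3 = 0"
  shows "bracket_of_values (eisen u) (eisen v) (eisen w) (eisen p) (eisen q) = eisen (bracket3 u v w p q)"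
proof -
  define b where "b = (\<lambda>f g. if f \<in> quasimodular_algebra \<and> g \<in> quasimodular_algebra
     then eisen (bracket3 u v w (inv eisen f) (inv eisen g)) else 0)"
  have b: "b (eisen p) (eisen q) = eisen (bracket3 u v w p q)" for p q
    by (simp add: b_def inv_f_f[OF inj_eisen])
  have "bracket_of_values (eisen u) (eisen v) (eisen w) = b"
    unfolding bracket_of_values_def
  proof (rule the_equality)
    have "poisson_bracket_on quasimodular_algebra b"
      using poisson_bracket_on_eisenI[OF biderivation_bracket3 jacobiator_eq_0[OF biderivation_bracket3 jac] b] .
    then show "poisson_bracket_on quasimodular_algebra b \<and> b E4 E6 = eisen u \<and> b E2 E4 = eisen v \<and> b E2 E6 = eisen w \<and>
      (\<forall>f g. f \<notin> quasimodular_algebra \<or> g \<notin> quasimodular_algebra \<longrightarrow> b f g = 0)"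
      using b[of Y3 Z3] b[of X3 Y3] b[of X3 Z3]
      by (simp only: bracket3_gens eisen_gens) (auto simp: b_def)
  next
    fix b' assume b': "poisson_bracket_on quasimodular_algebra b' \<and> b' E4 E6 = eisen u \<and> b' E2 E4 = eisen v \<and> b' E2 E6 = eisen w \<and>
      (\<forall>f g. f \<notin> quasimodular_algebra \<or> g \<notin> quasimodular_algebra \<longrightarrow> b' f g = 0)"
    note c = conjunct2[OF b']
    note c2 = conjunct2[OF c]
    note c3 = conjunct2[OF c2]
    note c4 = conjunct2[OF c3]
    obtain B where B: "biderivation B" "\<And>p q r. jacobiator B p q r = 0"
        "\<And>p q. b' (eisen p) (eisen q) = eisen (B p q)"
      by (rule poisson_bracket_on_eisenE[OF conjunct1[OF b']], rule that)
    have "eisen (B Y3 Z3) = eisen u" "eisen (B X3 Y3) = eisen v" "eisen (B X3 Z3) = eisen w"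
      unfolding B(3)[symmetric] eisen_gens by (rule conjunct1[OF c] conjunct1[OF c2] conjunct1[OF c3])+
    then have BV: "B Y3 Z3 = u" "B X3 Y3 = v" "B X3 Z3 = w"
      by (simp_all only: eisen_eq_iff)
    have e: "B p q = bracket3 u v w p q" for p q
      by (rule biderivation_unique[OF B(1) biderivation_bracket3]) (simp_all only: bracket3_gens BV)
    show "b' = b"
    proof (intro ext)
      fix f g z
      show "b' f g z = b f g z"
      proof (cases "f \<in> quasimodular_algebra \<and> g \<in> quasimodular_algebra")
        case True
        then obtain p q where "f = eisen p" "g = eisen q" unfolding quasimodular_algebra_eq by blast
        then show ?thesis by (simp only: b B(3) e)
      next
        case False
        then have "b' f g = 0" using c4 by blast
        moreover have "b f g = 0" using False unfolding b_def by (simp only: if_False)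
        ultimately show ?thesis by simp
      qed
    qed
  qed
  then show ?thesis by (simp add: b)
qed

definition Delta3 :: poly3 where "Delta3 = Y3 ^ 3 - Z3 ^ 2"

text \<open>The coefficient \<open>3/2 \<alpha>\<close> is the only one compatible with the Jacobi identity.\<close>

definition weight_bracket :: "complex \<Rightarrow> complex \<Rightarrow> complex \<Rightarrow> poly3 \<Rightarrow> poly3 \<Rightarrow> poly3" where
  "weight_bracket \<alpha> \<beta> \<delta> = bracket3 (const3 (- 2) * Delta3)
     (const3 \<alpha> * (Z3 * X3) + const3 \<beta> * Y3 ^ 2) (const3 (3/2 * \<alpha>) * (Y3 ^ 2 * X3) + const3 \<delta> * (Y3 * Z3))"

lemma biderivation_weight_bracket: "biderivation (weight_bracket \<alpha> \<beta> \<delta>)"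
  unfolding weight_bracket_def by (rule biderivation_bracket3)

text \<open>The coefficient \<gamma> is kept free so that the classification can derive \<gamma> =
  3/2 \<alpha>. The three monomials are independent, so the Jacobi identity means that the three
  coefficients vanish.\<close>

lemma bracket3_jacobiator_gens:
  "jacobiator (bracket3 (const3 (- 2) * Delta3)
     (const3 \<alpha> * (Z3 * X3) + const3 \<beta> * Y3 ^ 2) (const3 \<gamma> * (Y3 ^ 2 * X3) + const3 \<delta> * (Y3 * Z3))) X3 Y3 Z3 =
   const3 (4 * \<gamma> - 6 * \<alpha>) * (X3 * Y3 ^ 2 * Z3) + const3 ((\<gamma> - 2) * \<beta> + 2 * \<delta>) * Y3 ^ 4 +
   const3 ((2 - \<alpha>) * \<delta> - 4 * \<beta>) * (Y3 * Z3 ^ 2)" (is "jacobiator ?B _ _ _ = _")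
proof -
  note b = biderivationD[OF biderivation_bracket3]
  let ?c = const3
  have XY: "?B X3 Y3 = ?c \<alpha> * (Z3 * X3) + ?c \<beta> * (Y3 * Y3)"
    and XZ: "?B X3 Z3 = ?c \<gamma> * (Y3 * Y3 * X3) + ?c \<delta> * (Y3 * Z3)"
    and YZ: "?B Y3 Z3 = ?c (-2) * (Y3 * Y3 * Y3 - Z3 * Z3)"
    by (simp_all add: bracket3_gens Delta3_def power2_eq_square power3_eq_cube mult.assoc)
  have ZX: "?B Z3 X3 = - ?B X3 Z3" and YX: "?B Y3 X3 = - ?B X3 Y3" and ZY: "?B Z3 Y3 = - ?B Y3 Z3"
    by (rule b(1))+
  have diff: "?B p (q - r) = ?B p q - ?B p r" for p q r
    using b(5)[of _ _ _ p q "- r"] b(10)[of _ _ _ p r] by simp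
  have 1: "?B X3 (?B Y3 Z3) = ?c (-2) * (Y3 * (Y3 * ?B X3 Y3 + ?B X3 Y3 * Y3) + ?B X3 Y3 * (Y3 * Y3) - (Z3 * ?B X3 Z3 + ?B X3 Z3 * Z3))"
    unfolding YZ by (simp only: b(5,6,7) diff) (simp add: algebra_simps)
  have 2: "?B Y3 (?B Z3 X3) = - (?c \<gamma> * (Y3 * Y3 * (- ?B X3 Y3)) + ?c \<delta> * (Y3 * ?B Y3 Z3))"
    unfolding ZX unfolding XZ by (simp only: b(5,6,7,8,10) YX) (simp add: algebra_simps)
  have 3: "?B Z3 (?B X3 Y3) = ?c \<alpha> * (Z3 * (- ?B X3 Z3)) + ?c \<beta> * (Y3 * (- ?B Y3 Z3) + (- ?B Y3 Z3) * Y3)"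
    unfolding XY by (simp only: b(5,6,7,8,10) ZX ZY) (simp add: algebra_simps)
  show ?thesis
    unfolding jacobiator_def 1 2 3
    \<comment> \<open>The polynomial identity is checked on function values, where the constant
      polynomials become numbers.\<close>
    by (simp only: XY XZ YZ, rule injD[OF inj_eisen], rule ext)
      (simp add: eisen_def power2_eq_square power3_eq_cube algebra_simps eval_nat_numeral)
qed

lemma weight_bracket_jacobiator:
  assumes "(3/2 * \<alpha> - 2) * \<beta> + 2 * \<delta> = 0" "(2 - \<alpha>) * \<delta> = 4 * \<beta>"
  shows "jacobiator (weight_bracket \<alpha> \<beta> \<delta>) p q r = 0"
  by (rule jacobiator_eq_0[OF biderivation_weight_bracket])
    (use assms in \<open>simp add: weight_bracket_def bracket3_jacobiator_gens const3_hom(4)\<close>)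

text \<open>The coefficients \<alpha>, \<beta>, \<delta> in the sense of
  \<open>weight_bracket\<close>, read off from the statement.\<close>

fun model_coeffs :: "bracket_label \<Rightarrow> complex \<times> complex \<times> complex" where
  "model_coeffs Curly = (- 2/3, 1/3, 1/2)"
| "model_coeffs Angle = (4, 1, - 2)"
| "model_coeffs (Round \<alpha>) = (\<alpha>, 0, 0)"

lemma model_coeffs_jacobi:
  assumes "model_coeffs i = (\<alpha>, \<beta>, \<delta>)"
  shows "(3/2 * \<alpha> - 2) * \<beta> + 2 * \<delta> = 0" "(2 - \<alpha>) * \<delta> = 4 * \<beta>"
proof -
  have "(3/2 * \<alpha> - 2) * \<beta> + 2 * \<delta> = 0 \<and> (2 - \<alpha>) * \<delta> = 4 * \<beta>"
    using assms by (cases i) (auto, (metis mult.commute)+)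
  then show "(3/2 * \<alpha> - 2) * \<beta> + 2 * \<delta> = 0" "(2 - \<alpha>) * \<delta> = 4 * \<beta>" by blast+
qed

lemma model_bracket_eisen:
  assumes "model_coeffs i = (\<alpha>, \<beta>, \<delta>)"
  shows "model_bracket i (eisen p) (eisen q) = eisen (weight_bracket \<alpha> \<beta> \<delta> p q)"
proof -
  have u: "- 2 * Delta = eisen (const3 (- 2) * Delta3)"
    by (auto simp: eisen_def Delta_def Delta3_def fun_eq_iff numeral_fun_apply power_fun_apply)
  have "model_bracket i = bracket_of_values (eisen (const3 (- 2) * Delta3))
     (eisen (const3 \<alpha> * (Z3 * X3) + const3 \<beta> * Y3 ^ 2)) (eisen (const3 (3/2 * \<alpha>) * (Y3 ^ 2 * X3) + const3 \<delta> * (Y3 * Z3)))"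
    using assms unfolding u[symmetric]
    by (cases i; simp only: model_bracket.simps curly_bracket_def angle_bracket_def round_bracket_def;
        intro arg_cong2[where f = "bracket_of_values (- 2 * Delta)"])
      (auto simp: eisen_def fun_eq_iff cscale_def numeral_fun_apply power_fun_apply power2_eq_square algebra_simps)
  then show ?thesis
    using bracket_of_values_eisen[OF weight_bracket_jacobiator[OF model_coeffs_jacobi[OF assms], unfolded weight_bracket_def]]
    by (simp add: weight_bracket_def)
qed

section \<open>The models are admissible\<close>

text \<open>The monomial form of \<open>quasimodular_forms\<close>: a span of monomials is easier to
  multiply and to induct over than sums of modular forms times powers of E_2.\<close>

definition weight_depth_span :: "int \<Rightarrow> nat \<Rightarrow> uhp_fun set" where
  "weight_depth_span k s = cfun.span {E2 ^ c * E4 ^ a * E6 ^ b | a b c. 2 * int c + 4 * int a + 6 * int b = k \<and> c \<le> s}"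

lemma weight_depth_span_mono: "s \<le> t \<Longrightarrow> weight_depth_span k s \<subseteq> weight_depth_span k t"
  unfolding weight_depth_span_def by (rule cfun.span_mono) (blast intro: order_trans)

lemma weight_depth_span_base:
  "2 * int c + 4 * int a + 6 * int b = k \<Longrightarrow> c \<le> s \<Longrightarrow> E2 ^ c * E4 ^ a * E6 ^ b \<in> weight_depth_span k s"
  unfolding weight_depth_span_def by (rule cfun.span_base) blast

lemma weight_depth_span_mult:
  assumes "f \<in> weight_depth_span k s" "g \<in> weight_depth_span l t"
  shows "f * g \<in> weight_depth_span (k + l) (s + t)"
  unfolding weight_depth_span_def[of "k + l"]
proof (rule cfun_span_mult[OF _ assms[unfolded weight_depth_span_def]], safe)
  fix a b c a' b' c' :: nat
  assume "c \<le> s" "c' \<le> t"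
  then have "E2 ^ (c + c') * E4 ^ (a + a') * E6 ^ (b + b') \<in> weight_depth_span (2 * int c + 4 * int a + 6 * int b + (2 * int c' + 4 * int a' + 6 * int b')) (s + t)"
    by (intro weight_depth_span_base) auto
  moreover have "E2 ^ (c + c') * E4 ^ (a + a') * E6 ^ (b + b') = E2 ^ c * E4 ^ a * E6 ^ b * (E2 ^ c' * E4 ^ a' * E6 ^ b')"
    by (simp only: power_add mult_ac)
  ultimately show "E2 ^ c * E4 ^ a * E6 ^ b * (E2 ^ c' * E4 ^ a' * E6 ^ b')
       \<in> cfun.span {E2 ^ ca * E4 ^ aa * E6 ^ ba |aa ba ca. 2 * int ca + 4 * int aa + 6 * int ba = 2 * int c + 4 * int a + 6 * int b + (2 * int c' + 4 * int a' + 6 * int b') \<and> ca \<le> s + t}"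
    by (simp only: weight_depth_span_def)
qed

lemma modular_forms_eq: "modular_forms k = weight_depth_span k 0"
proof -
  have "{E4 ^ a * E6 ^ b |a b. 4 * int a + 6 * int b = k} =
     {E2 ^ c * E4 ^ a * E6 ^ b | a b c. 2 * int c + 4 * int a + 6 * int b = k \<and> c \<le> 0}"
    by (intro Collect_cong) (simp del: times_fun_apply)
  then show ?thesis unfolding modular_forms_def weight_depth_span_def by (rule arg_cong)
qed

lemma quasimodular_forms_eq: "quasimodular_forms k s = weight_depth_span k s"
proof
  show "quasimodular_forms k s \<subseteq> weight_depth_span k s"
  proof
    fix f assume "f \<in> quasimodular_forms k s"
    then obtain h where h: "f = (\<Sum>j\<le>s. h j * E2 ^ j)" "\<And>j. j \<le> s \<Longrightarrow> h j \<in> modular_forms (k - 2 * int j)"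
      unfolding quasimodular_forms_def by blast
    have "h j * E2 ^ j \<in> weight_depth_span k s" if "j \<le> s" for j
    proof -
      have "E2 ^ j * E4 ^ 0 * E6 ^ 0 \<in> weight_depth_span (2 * int j) j" by (rule weight_depth_span_base) auto
      then have "E2 ^ j \<in> weight_depth_span (2 * int j) j" by (simp only: power_0 mult_1_right)
      from weight_depth_span_mult[OF h(2)[OF that, unfolded modular_forms_eq] this]
      have "h j * E2 ^ j \<in> weight_depth_span k j" by (simp only: diff_add_cancel add_0)
      then show ?thesis using weight_depth_span_mono[OF that] by blast
    qed
    then show "f \<in> weight_depth_span k s" unfolding h(1)
      unfolding weight_depth_span_def by (intro cfun.span_sum) auto
  qed
  show "weight_depth_span k s \<subseteq> quasimodular_forms k s"
    unfolding weight_depth_span_def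
  proof (rule cfun.span_minimal)
    have m0: "0 \<in> modular_forms k" and madd: "f \<in> modular_forms k \<Longrightarrow> g \<in> modular_forms k \<Longrightarrow> f + g \<in> modular_forms k"
      and msc: "f \<in> modular_forms k \<Longrightarrow> cscale c f \<in> modular_forms k" for k f g c
      unfolding modular_forms_def by (rule cfun.span_zero cfun.span_add cfun.span_scale; assumption)+
    show "{E2 ^ c * E4 ^ a * E6 ^ b |a b c. 2 * int c + 4 * int a + 6 * int b = k \<and> c \<le> s} \<subseteq> quasimodular_forms k s"
    proof safe
      fix a b c assume k: "k = 2 * int c + 4 * int a + 6 * int b" and c: "c \<le> s"
      define h where "h = (\<lambda>j. if j = c then E4 ^ a * E6 ^ b else 0)"
      have "E4 ^ a * E6 ^ b \<in> modular_forms (4 * int a + 6 * int b)"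
        unfolding modular_forms_def by (rule cfun.span_base) blast
      then have M: "h j \<in> modular_forms (2 * int c + 4 * int a + 6 * int b - 2 * int j)" for j
        using m0 by (cases "j = c") (simp_all add: h_def del: times_fun_apply zero_fun_apply)
      have S: "(\<Sum>j\<le>s. h j * E2 ^ j) = E2 ^ c * E4 ^ a * E6 ^ b"
      proof -
        have "(\<Sum>j\<le>s. h j * E2 ^ j) = (\<Sum>j\<le>s. if j = c then E4 ^ a * E6 ^ b * E2 ^ c else 0)"
          by (rule sum.cong) (auto simp: h_def)
        also have "\<dots> = E4 ^ a * E6 ^ b * E2 ^ c" using c by (subst sum.delta) auto
        finally show ?thesis by (simp only: mult_ac)
      qed
      show "E2 ^ c * E4 ^ a * E6 ^ b \<in> quasimodular_forms (2 * int c + 4 * int a + 6 * int b) s"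
        unfolding quasimodular_forms_def mem_Collect_eq
        by (intro exI[of _ h] conjI allI impI S[symmetric] M)
    qed
    show "cfun.subspace (quasimodular_forms k s)"
      unfolding cfun.subspace_def quasimodular_forms_def
    proof safe
      show "\<exists>h. 0 = (\<Sum>j\<le>s. h j * E2 ^ j) \<and> (\<forall>j\<le>s. h j \<in> modular_forms (k - 2 * int j))"
        using m0 by (intro exI[of _ "\<lambda>_. 0"]) auto
    next
      fix h h' assume "\<forall>j\<le>s. h j \<in> modular_forms (k - 2 * int j)" "\<forall>j\<le>s. h' j \<in> modular_forms (k - 2 * int j)"
      then show "\<exists>g. (\<Sum>j\<le>s. h j * E2 ^ j) + (\<Sum>j\<le>s. h' j * E2 ^ j) = (\<Sum>j\<le>s. g j * E2 ^ j) \<and> (\<forall>j\<le>s. g j \<in> modular_forms (k - 2 * int j))"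
        using madd by (intro exI[of _ "\<lambda>j. h j + h' j"]) (simp add: sum.distrib[symmetric] distrib_right del: plus_fun_apply)
    next
      fix c h assume h: "\<forall>j\<le>s. h j \<in> modular_forms (k - 2 * int j)"
      have "cscale c (h j * E2 ^ j) = cscale c (h j) * E2 ^ j" for j
        by (auto simp: cscale_def)
      then have S: "cscale c (\<Sum>j\<le>s. h j * E2 ^ j) = (\<Sum>j\<le>s. cscale c (h j) * E2 ^ j)"
        by (simp only: cfun.scale_sum_right)
      show "\<exists>g. cscale c (\<Sum>j\<le>s. h j * E2 ^ j) = (\<Sum>j\<le>s. g j * E2 ^ j) \<and> (\<forall>j\<le>s. g j \<in> modular_forms (k - 2 * int j))"
        by (intro exI[of _ "\<lambda>j. cscale c (h j)"] conjI allI impI S msc h[rule_format])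
    qed
  qed
qed

section \<open>The first Rankin-Cohen bracket as a biderivation on homogeneous forms\<close>

lemma RC1_mult:
  assumes "has_D f f'" "has_D g g'" "has_D h h'"
  shows "RC1 (k + l) m (f * g) h = f * RC1 l m g h + RC1 k m f h * g"
  unfolding RC1_def has_D_imp_D[OF assms(1)] has_D_imp_D[OF assms(2)] has_D_imp_D[OF assms(3)]
    has_D_imp_D[OF has_D_mult[OF assms(1,2)]]
  by (rule ext) (simp add: algebra_simps)

lemma RC1_skew: "RC1 k l f g = - RC1 l k g f"
  by (rule ext) (simp add: RC1_def)

lemma RC1_add:
  assumes "has_D f f'" "has_D g g'"
  shows "RC1 k m (f + g) h = RC1 k m f h + RC1 k m g h"
  unfolding RC1_def has_D_imp_D[OF assms(1)] has_D_imp_D[OF assms(2)] has_D_imp_D[OF has_D_add[OF assms]]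
  by (rule ext) (simp add: algebra_simps)

lemma RC1_cscale:
  assumes "has_D f f'"
  shows "RC1 k m (cscale c f) h = cscale c (RC1 k m f h)"
  unfolding RC1_def has_D_imp_D[OF assms(1)] has_D_imp_D[OF has_D_cscale[OF assms]]
  by (rule ext) (simp add: cscale_def algebra_simps)

lemma RC1_E4_E6: "RC1 4 6 E4 E6 = - 2 * Delta"
  unfolding RC1_def has_D_imp_D[OF ramanujan_E4] has_D_imp_D[OF ramanujan_E6] Delta_def
  by (rule ext) (simp add: cscale_def numeral_fun_apply power_fun_apply power2_eq_square power3_eq_cube field_simps)

lemma RC1_self: "RC1 k k f f = 0"
  by (rule ext) (simp add: RC1_def)

lemma weight_bracket_gens:
  "weight_bracket \<alpha> \<beta> \<delta> Y3 Z3 = const3 (- 2) * Delta3"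
  "weight_bracket \<alpha> \<beta> \<delta> X3 Y3 = const3 \<alpha> * (Z3 * X3) + const3 \<beta> * Y3 ^ 2"
  "weight_bracket \<alpha> \<beta> \<delta> X3 Z3 = const3 (3/2 * \<alpha>) * (Y3 ^ 2 * X3) + const3 \<delta> * (Y3 * Z3)"
  by (simp_all add: weight_bracket_def bracket3_gens)

lemma eisen_Delta3: "eisen (const3 (- 2) * Delta3) = - 2 * Delta"
  by (auto simp: eisen_def Delta_def Delta3_def fun_eq_iff numeral_fun_apply power_fun_apply)

text \<open>The differentiability clauses belong to the induction hypothesis, since the Leibniz rule
  for \<open>RC1\<close> depends on them. The weights k and l are parameters: a polynomial does not
  determine them when it is zero.\<close>

definition RC1_agrees :: "(poly3 \<Rightarrow> poly3 \<Rightarrow> poly3) \<Rightarrow> int \<Rightarrow> int \<Rightarrow> poly3 \<Rightarrow> poly3 \<Rightarrow> bool" where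
  "RC1_agrees B k l p q \<longleftrightarrow> eisen (B p q) = RC1 k l (eisen p) (eisen q) \<and>
     (\<exists>f'. has_D (eisen p) f') \<and> (\<exists>g'. has_D (eisen q) g')"

lemma RC1_agrees_skew: "biderivation B \<Longrightarrow> RC1_agrees B k l p q \<Longrightarrow> RC1_agrees B l k q p"
  unfolding RC1_agrees_def
  by (metis (no_types, lifting) RC1_skew biderivationD(1) eisen_hom(3))

lemma RC1_agrees_mult:
  assumes B: "biderivation B" and "RC1_agrees B k m p r" "RC1_agrees B l m q r"
  shows "RC1_agrees B (k + l) m (p * q) r"
proof -
  obtain f g h where D: "has_D (eisen p) f" "has_D (eisen q) g" "has_D (eisen r) h"
    using assms unfolding RC1_agrees_def by blast
  have "eisen (B (p * q) r) = RC1 (k + l) m (eisen (p * q)) (eisen r)"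
    unfolding biderivationD(3)[OF B] eisen_hom(1,2) RC1_mult[OF D]
    using assms(2,3) by (simp only: RC1_agrees_def)
  moreover have "has_D (eisen (p * q)) (f * eisen q + eisen p * g)"
    unfolding eisen_hom by (rule has_D_mult[OF D(1,2)])
  ultimately show ?thesis using D(3) unfolding RC1_agrees_def by blast
qed

lemma RC1_agrees_modular_forms:
  assumes B: "biderivation B" and gens: "RC1_agrees B 4 m Y3 r" "RC1_agrees B 6 m Z3 r"
    and f: "f \<in> modular_forms k"
  shows "\<exists>p. f = eisen p \<and> RC1_agrees B k m p r"
proof -
  note b = biderivationD[OF B]
  have one: "RC1_agrees B 0 m 1 r"
  proof -
    have "eisen (B 1 r) = RC1 0 m (eisen 1) (eisen r)"
      using b(4)[of 1 r] has_D_imp_D[OF has_D_1] by (simp add: RC1_def const3_hom(5) eisen_hom del: one_fun_apply)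
    moreover have "has_D (eisen 1) 0" unfolding eisen_hom by (rule has_D_1)
    ultimately show ?thesis using gens unfolding RC1_agrees_def by blast
  qed
  have pow: "RC1_agrees B (k * int n) m (p ^ n) r" if "RC1_agrees B k m p r" for k p n
  proof (induction n)
    case (Suc n)
    show ?case using RC1_agrees_mult[OF B that Suc] by (simp add: algebra_simps)
  qed (use one in simp)
  have D: "\<exists>h. has_D (eisen r) h" using gens unfolding RC1_agrees_def by blast
  show ?thesis using f unfolding modular_forms_def
  proof (induction rule: cfun.span_induct_alt)
    case base
    have "RC1_agrees B k m 0 r"
    proof -
      have "has_D (cscale 0 1) (cscale 0 0)" by (rule has_D_cscale[OF has_D_1])
      moreover have "cscale 0 (1 :: uhp_fun) = eisen 0" "cscale 0 (0 :: uhp_fun) = 0" by (auto simp: cscale_def eisen_def)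
      ultimately have d0: "has_D (eisen 0) 0" by simp
      have "eisen (B 0 r) = RC1 k m (eisen 0) (eisen r)"
        unfolding RC1_def has_D_imp_D[OF d0] b(11) by (rule ext) (simp add: eisen_def)
      with d0 D show ?thesis unfolding RC1_agrees_def by blast
    qed
    then show ?case using eisen_hom(6) by metis
  next
    case (step c x y)
    from step(1) obtain a b' where ab: "x = E4 ^ a * E6 ^ b'" "k = 4 * int a + 6 * int b'" by blast
    have x: "RC1_agrees B k m (Y3 ^ a * Z3 ^ b') r" "x = eisen (Y3 ^ a * Z3 ^ b')"
      unfolding ab by (intro RC1_agrees_mult[OF B] pow gens) (simp only: eisen_hom eisen_gens)
    obtain q where q: "y = eisen q" "RC1_agrees B k m q r" using step(2) by blast
    let ?p = "Y3 ^ a * Z3 ^ b'"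
    obtain f g where fg: "has_D (eisen ?p) f" "has_D (eisen q) g"
      using x q unfolding RC1_agrees_def by blast
    have e: "eisen (const3 c * ?p + q) = cscale c (eisen ?p) + eisen q" by (simp only: eisen_hom(1) eisen_gens)
    have "eisen (B (const3 c * ?p + q) r) = cscale c (eisen (B ?p r)) + eisen (B q r)"
      by (simp only: b(2) b(3)[of "const3 c"] b(4) mult_zero_left add_0_right eisen_hom(1) eisen_gens(4))
    also have "\<dots> = RC1 k m (eisen (const3 c * ?p + q)) (eisen r)"
      unfolding e RC1_add[OF has_D_cscale[OF fg(1)] fg(2)] RC1_cscale[OF fg(1)]
      using x(1) q(2) unfolding RC1_agrees_def by metis
    finally have "RC1_agrees B k m (const3 c * ?p + q) r"
      unfolding RC1_agrees_def using D has_D_add[OF has_D_cscale[OF fg(1)] fg(2)] e by metis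
    then show ?case using e x(2) q(1) by metis
  qed
qed

text \<open>One argument at a time: g is compared with E_4 and E_6 first, and after a swap f is
  compared with g.\<close>

lemma weight_bracket_RC1:
  assumes "f \<in> modular_forms k" "g \<in> modular_forms l"
  shows "\<exists>p q. f = eisen p \<and> g = eisen q \<and> eisen (weight_bracket \<alpha> \<beta> \<delta> p q) = RC1 k l f g"
proof -
  let ?B = "weight_bracket \<alpha> \<beta> \<delta>"
  note B = biderivation_weight_bracket[of \<alpha> \<beta> \<delta>]
  have d: "\<exists>f. has_D (eisen Y3) f" "\<exists>f. has_D (eisen Z3) f"
    unfolding eisen_gens using ramanujan_E4 ramanujan_E6 by blast+
  have YZ: "RC1_agrees ?B 4 6 Y3 Z3"
    unfolding RC1_agrees_def using d by (simp only: weight_bracket_gens(1) eisen_Delta3 eisen_gens(1-3) RC1_E4_E6)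
  have YY: "RC1_agrees ?B 4 4 Y3 Y3" and ZZ: "RC1_agrees ?B 6 6 Z3 Z3"
    unfolding RC1_agrees_def using d by (simp_all only: biderivationD(8)[OF B] RC1_self eisen_hom)
  note ZY = RC1_agrees_skew[OF B YZ]
  obtain q where q: "g = eisen q" "RC1_agrees ?B l 4 q Y3"
    using RC1_agrees_modular_forms[OF B YY ZY assms(2)] by blast
  obtain q' where q': "g = eisen q'" "RC1_agrees ?B l 6 q' Z3"
    using RC1_agrees_modular_forms[OF B YZ ZZ assms(2)] by blast
  have "q' = q" using q(1) q'(1) by simp
  then obtain p where "f = eisen p" "RC1_agrees ?B k l p q"
    using RC1_agrees_modular_forms[OF B RC1_agrees_skew[OF B q(2)] RC1_agrees_skew[OF B q'(2)[unfolded \<open>q' = q\<close>]] assms(1)]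
    by blast
  then show ?thesis using q(1) unfolding RC1_agrees_def by blast
qed

text \<open>For fixed g the bracket is a derivation that shifts the weight by m and the depth by t,
  so it suffices to test E_2, E_4, E_6. In the application m is the weight of g plus 2.\<close>

lemma weight_depth_span_bracket1:
  assumes P: "poisson_bracket_on quasimodular_algebra b" and g: "g \<in> quasimodular_algebra"
    and gens: "b E2 g \<in> weight_depth_span (2 + m) (1 + t)" "b E4 g \<in> weight_depth_span (4 + m) t"
      "b E6 g \<in> weight_depth_span (6 + m) t"
    and f: "f \<in> weight_depth_span k s"
  shows "f \<in> quasimodular_algebra \<and> b f g \<in> weight_depth_span (k + m) (s + t)"
proof -
  note A = poisson_bracket_onD[OF P]
  define H where "H k s f \<longleftrightarrow> f \<in> quasimodular_algebra \<and> f \<in> weight_depth_span k s \<and> b f g \<in> weight_depth_span (k + m) (s + t)"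
    for k s f
  have gen: "E2 \<in> quasimodular_algebra" "E4 \<in> quasimodular_algebra" "E6 \<in> quasimodular_algebra" "1 \<in> quasimodular_algebra"
    using eisen_in_quasimodular[of X3] eisen_in_quasimodular[of Y3] eisen_in_quasimodular[of Z3] eisen_in_quasimodular[of 1]
    by (simp_all only: eisen_gens eisen_hom)
  have qa: "x * y \<in> quasimodular_algebra" "x + y \<in> quasimodular_algebra" "cscale c x \<in> quasimodular_algebra"
    if "x \<in> quasimodular_algebra" "y \<in> quasimodular_algebra" for x y c
    using that unfolding quasimodular_algebra_eq
    by (auto simp flip: eisen_hom eisen_gens)
  have wadd: "x + y \<in> weight_depth_span k s" if "x \<in> weight_depth_span k s" "y \<in> weight_depth_span k s" for x y k s
    using that unfolding weight_depth_span_def by (rule cfun.span_add)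
  have wscale: "cscale c x \<in> weight_depth_span k s" if "x \<in> weight_depth_span k s" for x k s c
    using that unfolding weight_depth_span_def by (rule cfun.span_scale)
  have wzero: "0 \<in> weight_depth_span k s" for k s
    unfolding weight_depth_span_def by (rule cfun.span_zero)
  have mult: "H (k + k') (s + s') (x * y)" if "H k s x" "H k' s' y" for k k' s s' x y
  proof -
    have "x * b y g \<in> weight_depth_span (k + k' + m) (s + s' + t)"
      using weight_depth_span_mult[of x k s "b y g" "k' + m" "s' + t"] that unfolding H_def by (simp only: add.assoc)
    moreover have "b x g * y \<in> weight_depth_span (k + k' + m) (s + s' + t)"
      using weight_depth_span_mult[of "b x g" "k + m" "s + t" y k' s'] that unfolding H_def by (simp only: add_ac)
    ultimately show ?thesis using that A(5)[of x y g] g weight_depth_span_mult[of x k s y k' s'] wadd qa(1)[of x y]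
      unfolding H_def by metis
  qed
  have b0: "b 1 g = 0"
    using A(5)[OF gen(4) gen(4) g] by (simp only: mult_1_left mult_1_right) (metis add_cancel_right_right)
  have one: "H 0 0 1"
    unfolding H_def b0 using gen(4) wzero weight_depth_span_base[of 0 0 0 0 0] by (simp only: power_0 mult_1_left of_nat_0 mult_zero_right add_0 le_refl)
  have "E2 ^ 1 * E4 ^ 0 * E6 ^ 0 \<in> weight_depth_span 2 1" "E2 ^ 0 * E4 ^ 1 * E6 ^ 0 \<in> weight_depth_span 4 0"
    "E2 ^ 0 * E4 ^ 0 * E6 ^ 1 \<in> weight_depth_span 6 0"
    by (rule weight_depth_span_base; simp)+
  then have H: "H 2 1 E2" "H 4 0 E4" "H 6 0 E6"
    unfolding H_def using gen gens by (simp_all only: power_0 power_one_right mult_1_left mult_1_right add_0_left)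
  have pow: "H (k * int n) (s * n) (x ^ n)" if "H k s x" for k s x n
  proof (induction n)
    case 0
    show ?case using one by (simp only: power_0 of_nat_0 mult_zero_right)
  next
    case (Suc n)
    show ?case using mult[OF that Suc] by (simp only: power_Suc of_nat_Suc distrib_left mult_Suc_right mult_1_right)
  qed
  have mono: "H k s (E2 ^ c * E4 ^ a * E6 ^ d)" if "2 * int c + 4 * int a + 6 * int d = k" "c \<le> s" for k s c a d
  proof -
    have h: "H k c (E2 ^ c * E4 ^ a * E6 ^ d)"
      using mult[OF mult[OF pow[OF H(1), of c] pow[OF H(2), of a]] pow[OF H(3), of d]] that(1)
      by (simp only: mult_zero_left mult_1_left add_0_right)
    then show ?thesis using weight_depth_span_mono[OF that(2), of k] weight_depth_span_mono[of "c + t" "s + t" "k + m"] that(2)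
      unfolding H_def by auto
  qed
  have "H k s f" using f unfolding weight_depth_span_def[of k s]
  proof (induction rule: cfun.span_induct_alt)
    case base
    have "0 \<in> quasimodular_algebra" using eisen_in_quasimodular[of 0] by (simp only: eisen_hom)
    moreover from this have "b 0 g = 0" using A(2)[of 0 0 g] g by (metis add_0 add_cancel_right_right)
    ultimately show ?case unfolding H_def using wzero by metis
  next
    case (step c x y)
    then have x: "H k s x" using mono by blast
    show ?case using x step(2) A(2)[of "cscale c x" y g] A(3)[of x g c] g qa wadd wscale
      unfolding H_def by metis
  qed
  then show ?thesis unfolding H_def by blast
qed

text \<open>The one-sided bound is used twice: with a generator as second argument, and then, by
  skew symmetry, with an arbitrary g.\<close>

lemma weight_depth_span_bracket:
  assumes P: "poisson_bracket_on quasimodular_algebra b"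
    and gens: "b E4 E6 \<in> weight_depth_span 12 0" "b E2 E4 \<in> weight_depth_span 8 1" "b E2 E6 \<in> weight_depth_span 10 1"
    and f: "f \<in> weight_depth_span k s" and g: "g \<in> weight_depth_span l t"
  shows "b f g \<in> weight_depth_span (k + l + 2) (s + t)"
proof -
  note A = poisson_bracket_onD[OF P]
  have Q: "E2 \<in> quasimodular_algebra" "E4 \<in> quasimodular_algebra" "E6 \<in> quasimodular_algebra"
    using eisen_in_quasimodular[of X3] eisen_in_quasimodular[of Y3] eisen_in_quasimodular[of Z3]
    by (simp_all only: eisen_gens)
  have neg: "- x \<in> weight_depth_span k s" if "x \<in> weight_depth_span k s" for x k s
    using that unfolding weight_depth_span_def by (rule cfun.span_neg)
  have skew: "b y x \<in> weight_depth_span k s"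
    if "b x y \<in> weight_depth_span k s" "x \<in> quasimodular_algebra" "y \<in> quasimodular_algebra" for x y k s
    using neg[OF that(1)] A(4)[OF that(3,2)] by metis
  have self: "b x x \<in> weight_depth_span k s" if "x \<in> quasimodular_algebra" for x k s
  proof -
    have "b x x z = 0" for z
    proof -
      have "b x x z = (- b x x) z" by (rule fun_cong[OF A(4)[OF that that]])
      then show ?thesis by simp
    qed
    then have "b x x = 0" by (intro ext) simp
    then show ?thesis unfolding weight_depth_span_def by (metis cfun.span_zero)
  qed
  have 1: "x \<in> quasimodular_algebra \<and> b x E2 \<in> weight_depth_span (k + 4) (s + 1)"
    "x \<in> quasimodular_algebra \<and> b x E4 \<in> weight_depth_span (k + 6) (s + 0)"
    "x \<in> quasimodular_algebra \<and> b x E6 \<in> weight_depth_span (k + 8) (s + 0)"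
    if "x \<in> weight_depth_span k s" for x k s
    by (rule weight_depth_span_bracket1[OF P _ _ _ _ that]; use Q gens skew self in simp)+
  have gQ: "g \<in> quasimodular_algebra" using 1(1)[OF g] by blast
  have "b f g \<in> weight_depth_span (k + (l + 2)) (s + t)"
  proof (rule conjunct2[OF weight_depth_span_bracket1[OF P gQ _ _ _ f]])
    show "b E2 g \<in> weight_depth_span (2 + (l + 2)) (1 + t)"
      using skew[of g E2 "l + 4" "t + 1"] 1(1)[OF g] Q by (simp add: add.commute)
    show "b E4 g \<in> weight_depth_span (4 + (l + 2)) t"
      using skew[of g E4 "l + 6" t] 1(2)[OF g] Q by (simp add: add.commute)
    show "b E6 g \<in> weight_depth_span (6 + (l + 2)) t"
      using skew[of g E6 "l + 8" t] 1(3)[OF g] Q by (simp add: add.commute)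
  qed
  then show ?thesis by (simp only: add.assoc)
qed

lemma eisen_monomial: "eisen (X3 ^ c * Y3 ^ a * Z3 ^ b) = E2 ^ c * E4 ^ a * E6 ^ b"
  by (simp only: eisen_hom eisen_gens)

lemma eisen_weight_depth:
  "2 * int c + 4 * int a + 6 * int b = k \<Longrightarrow> c \<le> s \<Longrightarrow> eisen (X3 ^ c * Y3 ^ a * Z3 ^ b) \<in> weight_depth_span k s"
  unfolding eisen_monomial by (rule weight_depth_span_base)

lemma eisen_lincomb_weight_depth:
  assumes "eisen p \<in> weight_depth_span k s" "eisen q \<in> weight_depth_span k s"
  shows "eisen (const3 a * p + const3 b * q) \<in> weight_depth_span k s"
  using assms unfolding eisen_hom(1) eisen_gens(4) weight_depth_span_def
  by (intro cfun.span_add cfun.span_scale)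

theorem admissible_model_bracket: "admissible (model_bracket i)"
proof -
  obtain \<alpha> \<beta> \<delta> where i: "model_coeffs i = (\<alpha>, \<beta>, \<delta>)" by (metis prod_cases3)
  note m = model_bracket_eisen[OF i]
  have P: "poisson_bracket_on quasimodular_algebra (model_bracket i)"
    by (rule poisson_bracket_on_eisenI[OF biderivation_weight_bracket weight_bracket_jacobiator[OF model_coeffs_jacobi[OF i]] m])
  have W: "model_bracket i E4 E6 \<in> weight_depth_span 12 0" "model_bracket i E2 E4 \<in> weight_depth_span 8 1"
    "model_bracket i E2 E6 \<in> weight_depth_span 10 1"
  proof -
    have "eisen (const3 (- 2) * (X3 ^ 0 * Y3 ^ 3 * Z3 ^ 0) + const3 2 * (X3 ^ 0 * Y3 ^ 0 * Z3 ^ 2)) \<in> weight_depth_span 12 0"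
      by (intro eisen_lincomb_weight_depth eisen_weight_depth) auto
    also have "const3 (- 2) * (X3 ^ 0 * Y3 ^ 3 * Z3 ^ 0) + const3 2 * (X3 ^ 0 * Y3 ^ 0 * Z3 ^ 2) = const3 (- 2) * Delta3"
      by (simp add: Delta3_def const3_hom algebra_simps)
    finally show "model_bracket i E4 E6 \<in> weight_depth_span 12 0"
      using m[of Y3 Z3] by (simp only: weight_bracket_gens eisen_gens(1-3))
    have "eisen (const3 \<alpha> * (X3 ^ 1 * Y3 ^ 0 * Z3 ^ 1) + const3 \<beta> * (X3 ^ 0 * Y3 ^ 2 * Z3 ^ 0)) \<in> weight_depth_span 8 1"
      by (intro eisen_lincomb_weight_depth eisen_weight_depth) auto
    also have "const3 \<alpha> * (X3 ^ 1 * Y3 ^ 0 * Z3 ^ 1) + const3 \<beta> * (X3 ^ 0 * Y3 ^ 2 * Z3 ^ 0) = const3 \<alpha> * (Z3 * X3) + const3 \<beta> * Y3 ^ 2"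
      by (simp add: mult_ac)
    finally show "model_bracket i E2 E4 \<in> weight_depth_span 8 1"
      using m[of X3 Y3] by (simp only: weight_bracket_gens eisen_gens(1-3))
    have "eisen (const3 (3/2 * \<alpha>) * (X3 ^ 1 * Y3 ^ 2 * Z3 ^ 0) + const3 \<delta> * (X3 ^ 0 * Y3 ^ 1 * Z3 ^ 1)) \<in> weight_depth_span 10 1"
      by (intro eisen_lincomb_weight_depth eisen_weight_depth) auto
    also have "const3 (3/2 * \<alpha>) * (X3 ^ 1 * Y3 ^ 2 * Z3 ^ 0) + const3 \<delta> * (X3 ^ 0 * Y3 ^ 1 * Z3 ^ 1) =
      const3 (3/2 * \<alpha>) * (Y3 ^ 2 * X3) + const3 \<delta> * (Y3 * Z3)"
      by (simp add: mult_ac)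
    finally show "model_bracket i E2 E6 \<in> weight_depth_span 10 1"
      using m[of X3 Z3] by (simp only: weight_bracket_gens eisen_gens(1-3))
  qed
  show ?thesis unfolding admissible_def
  proof (intro conjI allI ballI impI P)
    fix k l f g assume "f \<in> modular_forms k" "g \<in> modular_forms l"
    then obtain p q where "f = eisen p" "g = eisen q" "eisen (weight_bracket \<alpha> \<beta> \<delta> p q) = RC1 k l f g"
      using weight_bracket_RC1 by blast
    then show "model_bracket i f g = RC1 k l f g" using m by metis
  next
    fix k l s t f g assume "f \<in> quasimodular_forms k s" "g \<in> quasimodular_forms l t"
    then show "model_bracket i f g \<in> quasimodular_forms (k + l + 2) (s + t)"
      unfolding quasimodular_forms_eq by (rule weight_depth_span_bracket[OF P W])
  qed
qed

section \<open>Classification\<close>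

text \<open>Meant for depth 1 in the weights 8 and 10, where only two monomials exist.\<close>

lemma weight_depth_span_two:
  assumes "f \<in> weight_depth_span k s"
    and "\<And>a b c. 2 * int c + 4 * int a + 6 * int b = k \<Longrightarrow> c \<le> s \<Longrightarrow> X3 ^ c * Y3 ^ a * Z3 ^ b \<in> {p, q}"
  shows "\<exists>\<alpha> \<beta>. f = eisen (const3 \<alpha> * p + const3 \<beta> * q)"
  using assms(1) unfolding weight_depth_span_def
proof (induction rule: cfun.span_induct_alt)
  case base
  have "0 = eisen (const3 0 * p + const3 0 * q)" by (simp only: const3_hom mult_zero_left add_0 eisen_hom)
  then show ?case by blast
next
  case (step c x y)
  then obtain \<alpha> \<beta> where y: "y = eisen (const3 \<alpha> * p + const3 \<beta> * q)" by blast
  from step(1) obtain a b d where "x = eisen (X3 ^ d * Y3 ^ a * Z3 ^ b)" "2 * int d + 4 * int a + 6 * int b = k" "d \<le> s"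
    unfolding eisen_monomial by blast
  with assms(2) consider "x = eisen p" | "x = eisen q" by blast
  then show ?case
  proof cases
    case 1
    have "cscale c x + y = eisen (const3 (c + \<alpha>) * p + const3 \<beta> * q)"
      unfolding 1 y by (simp only: const3_hom eisen_gens[symmetric] eisen_hom[symmetric] distrib_right add.assoc)
    then show ?thesis by blast
  next
    case 2
    have "cscale c x + y = eisen (const3 \<alpha> * p + const3 (c + \<beta>) * q)"
      unfolding 2 y by (simp only: const3_hom eisen_gens[symmetric] eisen_hom[symmetric] distrib_right add_ac)
    then show ?thesis by blast
  qed
qed

lemma admissible_weight_bracket:
  assumes "admissible b"
  obtains \<alpha> \<beta> \<delta> where "\<And>p q. b (eisen p) (eisen q) = eisen (weight_bracket \<alpha> \<beta> \<delta> p q)"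
    "(3/2 * \<alpha> - 2) * \<beta> + 2 * \<delta> = 0" "(2 - \<alpha>) * \<delta> = 4 * \<beta>"
proof -
  have P: "poisson_bracket_on quasimodular_algebra b"
    and RC: "\<And>k l f g. f \<in> modular_forms k \<Longrightarrow> g \<in> modular_forms l \<Longrightarrow> b f g = RC1 k l f g"
    and W: "\<And>k l s t f g. even k \<Longrightarrow> even l \<Longrightarrow> f \<in> weight_depth_span k s \<Longrightarrow> g \<in> weight_depth_span l t \<Longrightarrow>
       b f g \<in> weight_depth_span (k + l + 2) (s + t)"
    using assms unfolding admissible_def quasimodular_forms_eq by metis+
  obtain B where B: "biderivation B" "\<And>p q r. jacobiator B p q r = 0"
      "\<And>p q. b (eisen p) (eisen q) = eisen (B p q)"
    by (rule poisson_bracket_on_eisenE[OF P], rule that)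
  have E: "E2 \<in> weight_depth_span 2 1" "E4 \<in> weight_depth_span 4 0" "E6 \<in> weight_depth_span 6 0"
    using eisen_weight_depth[of 1 0 0 2 1] eisen_weight_depth[of 0 1 0 4 0] eisen_weight_depth[of 0 0 1 6 0]
    by (simp_all add: eisen_gens)
  have "eisen (B Y3 Z3) = eisen (const3 (- 2) * Delta3)"
    using RC[of E4 4 E6 6] E(2,3) unfolding modular_forms_eq eisen_Delta3 B(3)[symmetric] eisen_gens(2,3) RC1_E4_E6 by blast
  then have YZ: "B Y3 Z3 = const3 (- 2) * Delta3" by (rule injD[OF inj_eisen])
  have "eisen (B X3 Y3) \<in> weight_depth_span 8 1"
    using W[OF _ _ E(1,2)] unfolding B(3)[symmetric] eisen_gens by simp
  moreover have "X3 ^ c * Y3 ^ a * Z3 ^ b \<in> {Z3 * X3, Y3 ^ 2}" if "2 * int c + 4 * int a + 6 * int b = 8" "c \<le> 1" for a b c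
  proof -
    have "c = 0 \<or> c = 1" using that by auto
    then have "c = 0 \<and> a = 2 \<and> b = 0 \<or> c = 1 \<and> a = 0 \<and> b = 1" using that by presburger
    then show ?thesis by auto
  qed
  ultimately obtain \<alpha> \<beta> where "eisen (B X3 Y3) = eisen (const3 \<alpha> * (Z3 * X3) + const3 \<beta> * Y3 ^ 2)"
    using weight_depth_span_two by blast
  then have XY: "B X3 Y3 = const3 \<alpha> * (Z3 * X3) + const3 \<beta> * Y3 ^ 2" by (rule injD[OF inj_eisen])
  have "eisen (B X3 Z3) \<in> weight_depth_span 10 1"
    using W[OF _ _ E(1,3)] unfolding B(3)[symmetric] eisen_gens by simp
  moreover have "X3 ^ c * Y3 ^ a * Z3 ^ b \<in> {Y3 ^ 2 * X3, Y3 * Z3}" if "2 * int c + 4 * int a + 6 * int b = 10" "c \<le> 1" for a b c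
  proof -
    have "c = 0 \<or> c = 1" using that by auto
    then have "c = 0 \<and> a = 1 \<and> b = 1 \<or> c = 1 \<and> a = 2 \<and> b = 0" using that by presburger
    then show ?thesis by auto
  qed
  ultimately obtain \<gamma> \<delta> where "eisen (B X3 Z3) = eisen (const3 \<gamma> * (Y3 ^ 2 * X3) + const3 \<delta> * (Y3 * Z3))"
    using weight_depth_span_two by blast
  then have XZ: "B X3 Z3 = const3 \<gamma> * (Y3 ^ 2 * X3) + const3 \<delta> * (Y3 * Z3)" by (rule injD[OF inj_eisen])
  have Bb: "B p q = bracket3 (const3 (- 2) * Delta3) (const3 \<alpha> * (Z3 * X3) + const3 \<beta> * Y3 ^ 2)
      (const3 \<gamma> * (Y3 ^ 2 * X3) + const3 \<delta> * (Y3 * Z3)) p q" for p q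
    by (rule biderivation_unique[OF B(1) biderivation_bracket3]) (simp_all only: bracket3_gens YZ XY XZ)
  then have "B = bracket3 (const3 (- 2) * Delta3) (const3 \<alpha> * (Z3 * X3) + const3 \<beta> * Y3 ^ 2)
      (const3 \<gamma> * (Y3 ^ 2 * X3) + const3 \<delta> * (Y3 * Z3))" by blast
  with B(2)[of X3 Y3 Z3] have J: "const3 (4 * \<gamma> - 6 * \<alpha>) * (X3 * Y3 ^ 2 * Z3) + const3 ((\<gamma> - 2) * \<beta> + 2 * \<delta>) * Y3 ^ 4 +
   const3 ((2 - \<alpha>) * \<delta> - 4 * \<beta>) * (Y3 * Z3 ^ 2) = 0" by (simp only: bracket3_jacobiator_gens)
  have ev: "(4 * \<gamma> - 6 * \<alpha>) * (x * y ^ 2 * z) + ((\<gamma> - 2) * \<beta> + 2 * \<delta>) * y ^ 4 + ((2 - \<alpha>) * \<delta> - 4 * \<beta>) * (y * z ^ 2) = 0" for x y z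
    using arg_cong[OF J, of "\<lambda>p. eval3 p x y z"] by simp
  \<comment> \<open>The three points isolate the coefficients one after another: at (0, 1, 0) only
    y^4 survives, at (0, 1, 1) only y z^2 is added, and at (1, 1, 1) the last monomial.\<close>
  have 1: "(\<gamma> - 2) * \<beta> + 2 * \<delta> = 0" using ev[of 0 1 0] by simp
  have 2: "(2 - \<alpha>) * \<delta> - 4 * \<beta> = 0" using ev[of 0 1 1] 1 by simp
  have 3: "4 * \<gamma> - 6 * \<alpha> = 0" using ev[of 1 1 1] 1 2 by simp
  have "\<gamma> = (4 * \<gamma> - 6 * \<alpha>) / 4 + 3/2 * \<alpha>" by (simp add: field_simps)
  then have g: "\<gamma> = 3/2 * \<alpha>" unfolding 3 by simp
  show ?thesis
  proof (rule that)
    show "b (eisen p) (eisen q) = eisen (weight_bracket \<alpha> \<beta> \<delta> p q)" for p q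
      unfolding B(3) Bb weight_bracket_def g ..
    show "(3/2 * \<alpha> - 2) * \<beta> + 2 * \<delta> = 0" using 1 unfolding g .
    show "(2 - \<alpha>) * \<delta> = 4 * \<beta>" using 2 by simp
  qed
qed

section \<open>Isomorphisms in terms of polynomials\<close>

definition const_alg_hom :: "(poly3 \<Rightarrow> poly3) \<Rightarrow> bool" where
  "const_alg_hom \<phi> \<longleftrightarrow> (\<forall>p q. \<phi> (p + q) = \<phi> p + \<phi> q) \<and> (\<forall>p q. \<phi> (p * q) = \<phi> p * \<phi> q) \<and> (\<forall>c. \<phi> (const3 c) = const3 c)"

text \<open>Conjugation by \<open>eisen\<close>. Preserving 1 and scalar multiples becomes fixing
  the constants, and preserving modular forms becomes preserving degree 0.\<close>

lemma modular_isomorphic_eisen_iff: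
  assumes b1: "\<And>p q. b1 (eisen p) (eisen q) = eisen (B1 p q)" and b2: "\<And>p q. b2 (eisen p) (eisen q) = eisen (B2 p q)"
  shows "modular_isomorphic b1 b2 \<longleftrightarrow> (\<exists>\<phi>. const_alg_hom \<phi> \<and> bij \<phi> \<and> (\<forall>p. degree p = 0 \<longrightarrow> degree (\<phi> p) = 0) \<and>
    (\<forall>p q. \<phi> (B1 p q) = B2 (\<phi> p) (\<phi> q)))" (is "_ = ?R")
proof
  assume "modular_isomorphic b1 b2"
  then obtain F where F: "poisson_iso_on quasimodular_algebra b1 b2 F" "F ` modular_algebra \<subseteq> modular_algebra"
    unfolding modular_isomorphic_def by blast
  from F(1) have bij: "bij_betw F quasimodular_algebra quasimodular_algebra" and one: "F 1 = 1"
    and add: "\<And>f g. f \<in> quasimodular_algebra \<Longrightarrow> g \<in> quasimodular_algebra \<Longrightarrow> F (f + g) = F f + F g"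
    and mult: "\<And>f g. f \<in> quasimodular_algebra \<Longrightarrow> g \<in> quasimodular_algebra \<Longrightarrow> F (f * g) = F f * F g"
    and scale: "\<And>f c. f \<in> quasimodular_algebra \<Longrightarrow> F (cscale c f) = cscale c (F f)"
    and br: "\<And>f g. f \<in> quasimodular_algebra \<Longrightarrow> g \<in> quasimodular_algebra \<Longrightarrow> F (b1 f g) = b2 (F f) (F g)"
    unfolding poisson_iso_on_def by metis+
  define \<phi> where "\<phi> p = inv eisen (F (eisen p))" for p
  have \<phi>: "eisen (\<phi> p) = F (eisen p)" for p
    using bij_betwE[OF bij] eisen_in_quasimodular[of p] unfolding \<phi>_def quasimodular_algebra_eq
    by (metis f_inv_into_f)
  have e: "eisen (\<phi> (p + q)) = eisen (\<phi> p + \<phi> q)" "eisen (\<phi> (p * q)) = eisen (\<phi> p * \<phi> q)"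
    "eisen (\<phi> (const3 c)) = eisen (const3 c)" "eisen (\<phi> (B1 p q)) = eisen (B2 (\<phi> p) (\<phi> q))" for p q c
  proof -
    show "eisen (\<phi> (p + q)) = eisen (\<phi> p + \<phi> q)" unfolding eisen_hom \<phi> by (rule add; rule eisen_in_quasimodular)
    show "eisen (\<phi> (p * q)) = eisen (\<phi> p * \<phi> q)" unfolding eisen_hom \<phi> by (rule mult; rule eisen_in_quasimodular)
    show "eisen (\<phi> (const3 c)) = eisen (const3 c)" unfolding \<phi> eisen_gens
      using scale[of 1 c] eisen_in_quasimodular[of 1] one by (simp only: eisen_hom)
    show "eisen (\<phi> (B1 p q)) = eisen (B2 (\<phi> p) (\<phi> q))" unfolding \<phi> b1[symmetric] b2[symmetric]
      by (rule br; rule eisen_in_quasimodular)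
  qed
  have "const_alg_hom \<phi>" "\<forall>p q. \<phi> (B1 p q) = B2 (\<phi> p) (\<phi> q)" unfolding const_alg_hom_def
    by (intro conjI allI injD[OF inj_eisen] e)+
  moreover have "bij \<phi>"
  proof (rule bijI)
    show "inj \<phi>"
    proof (rule injI)
      fix p q assume "\<phi> p = \<phi> q"
      then have "F (eisen p) = F (eisen q)" by (simp only: \<phi>[symmetric])
      then show "p = q" using bij_betw_imp_inj_on[OF bij] eisen_in_quasimodular by (metis inj_onD eisen_eq_iff)
    qed
    show "surj \<phi>"
    proof (rule surjI)
      fix q
      show "\<phi> (inv eisen (inv_into quasimodular_algebra F (eisen q))) = q"
      proof (rule injD[OF inj_eisen])
        have im: "eisen q \<in> F ` quasimodular_algebra" using bij_betw_imp_surj_on[OF bij] eisen_in_quasimodular by metis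
        have "inv_into quasimodular_algebra F (eisen q) \<in> range eisen"
          using inv_into_into[OF im] unfolding quasimodular_algebra_eq .
        then show "eisen (\<phi> (inv eisen (inv_into quasimodular_algebra F (eisen q)))) = eisen q"
          unfolding \<phi> using f_inv_into_f[OF im] by (metis f_inv_into_f)
      qed
    qed
  qed
  moreover have "degree (\<phi> p) = 0" if "degree p = 0" for p
  proof -
    have "eisen p \<in> modular_algebra" using that unfolding modular_algebra_eq by blast
    then have "eisen (\<phi> p) \<in> modular_algebra" unfolding \<phi> using F(2) by blast
    then obtain q where "degree q = 0" "eisen (\<phi> p) = eisen q" unfolding modular_algebra_eq by blast
    then show ?thesis by (simp only: eisen_eq_iff)
  qed
  ultimately show ?R by blast
next
  assume ?R
  then obtain \<phi> where \<phi>: "const_alg_hom \<phi>" "bij \<phi>" "\<And>p. degree p = 0 \<Longrightarrow> degree (\<phi> p) = 0"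
    "\<And>p q. \<phi> (B1 p q) = B2 (\<phi> p) (\<phi> q)" by blast
  note h = \<phi>(1)[unfolded const_alg_hom_def, THEN conjunct1, rule_format]
    \<phi>(1)[unfolded const_alg_hom_def, THEN conjunct2, THEN conjunct1, rule_format]
    \<phi>(1)[unfolded const_alg_hom_def, THEN conjunct2, THEN conjunct2, rule_format]
  define F where "F f = eisen (\<phi> (inv eisen f))" for f
  have F: "F (eisen p) = eisen (\<phi> p)" for p by (simp only: F_def inv_f_f[OF inj_eisen])
  have "poisson_iso_on quasimodular_algebra b1 b2 F"
    unfolding poisson_iso_on_def
  proof (intro conjI allI ballI)
    show "bij_betw F quasimodular_algebra quasimodular_algebra"
    proof (rule bij_betwI[of _ _ _ "\<lambda>f. eisen (inv \<phi> (inv eisen f))"])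
      fix f assume "f \<in> quasimodular_algebra"
      then obtain p where p: "f = eisen p" unfolding quasimodular_algebra_eq by blast
      show "eisen (inv \<phi> (inv eisen (F f))) = f"
        unfolding p F by (simp only: inv_f_f[OF inj_eisen] inv_f_f[OF bij_is_inj[OF \<phi>(2)]])
      show "F (eisen (inv \<phi> (inv eisen f))) = f"
        unfolding p F by (simp only: inv_f_f[OF inj_eisen] surj_f_inv_f[OF bij_is_surj[OF \<phi>(2)]])
    qed (auto simp: F_def)
    have "eisen (\<phi> 1) = eisen 1" using h(3)[of 1] by (simp only: const3_hom)
    then show "F 1 = 1" using F[of 1] by (simp only: eisen_hom)
  next
    fix f g assume "f \<in> quasimodular_algebra" "g \<in> quasimodular_algebra"
    then obtain p q where p: "f = eisen p" "g = eisen q" unfolding quasimodular_algebra_eq by blast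
    show "F (f + g) = F f + F g" unfolding p eisen_hom(1)[symmetric] F h(1) ..
    show "F (f * g) = F f * F g" unfolding p eisen_hom(2)[symmetric] F h(2) ..
    show "F (b1 f g) = b2 (F f) (F g)" unfolding p b1 F b2 \<phi>(4) ..
  next
    fix c f assume "f \<in> quasimodular_algebra"
    then obtain p where p: "f = eisen p" unfolding quasimodular_algebra_eq by blast
    show "F (cscale c f) = cscale c (F f)" unfolding p eisen_gens(4)[symmetric] F h(2,3) ..
  qed
  moreover have "F ` modular_algebra \<subseteq> modular_algebra"
    unfolding modular_algebra_eq using \<phi>(3) F by auto
  ultimately show "modular_isomorphic b1 b2" unfolding modular_isomorphic_def by blast
qed

text \<open>The isomorphism substitutes c X for X. This multiplies the terms linear in X by c, and
  the factor c in the first bracket does the same for the terms free of X.\<close>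

lemma weight_bracket_rescale:
  assumes b1: "\<And>p q. b1 (eisen p) (eisen q) = eisen (weight_bracket \<alpha> (c * \<beta>) (c * \<delta>) p q)"
    and b2: "\<And>p q. b2 (eisen p) (eisen q) = eisen (weight_bracket \<alpha> \<beta> \<delta> p q)" and c: "c \<noteq> 0"
  shows "modular_isomorphic b1 b2"
  unfolding modular_isomorphic_eisen_iff[of b1 "weight_bracket \<alpha> (c * \<beta>) (c * \<delta>)" b2 "weight_bracket \<alpha> \<beta> \<delta>", OF b1 b2]
proof (intro exI conjI allI impI)
  define \<phi> :: "complex \<Rightarrow> poly3 \<Rightarrow> poly3" where "\<phi> = (\<lambda>c p. pcompose p [:0, [:[:c:]:]:])"
  have h: "\<phi> c (p + q) = \<phi> c p + \<phi> c q" "\<phi> c (p * q) = \<phi> c p * \<phi> c q" "\<phi> c (const3 a) = const3 a" for p q a c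
    by (simp_all add: \<phi>_def pcompose_add pcompose_mult const3_def)
  have g: "\<phi> c X3 = const3 c * X3" "\<phi> c Y3 = Y3" "\<phi> c Z3 = Z3" for c
    by (simp_all add: \<phi>_def X3_def Y3_def Z3_def const3_def pcompose_pCons)
  show "const_alg_hom (\<phi> c)" unfolding const_alg_hom_def using h by blast
  have comp: "\<phi> a (\<phi> b p) = p" if "a * b = 1" for a b p
  proof -
    have "pcompose [:0, [:[:b:]:]:] [:0, [:[:a:]:]:] = [:0, 1 :: complex poly poly:]"
      using that by (simp add: pcompose_pCons mult.commute one_pCons)
    then show ?thesis unfolding \<phi>_def by (simp add: pcompose_assoc[symmetric] pcompose_idR)
  qed
  show "bij (\<phi> c)"
    by (rule bij_betw_byWitness[of _ "\<phi> (1 / c)"]) (use c in \<open>auto simp: comp\<close>)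
  show "degree (\<phi> c p) = 0" if "degree p = 0" for p
    using that by (auto simp: \<phi>_def elim: degree_eq_zeroE)
  have p: "\<phi> c (p ^ n) = \<phi> c p ^ n" for p n
    using h(3)[of c 1] by (induction n) (simp_all add: h const3_hom)
  show "\<phi> c (weight_bracket \<alpha> (c * \<beta>) (c * \<delta>) p q) = weight_bracket \<alpha> \<beta> \<delta> (\<phi> c p) (\<phi> c q)" for p q
  proof (rule biderivation_intertwine[OF biderivation_weight_bracket biderivation_weight_bracket h])
    note b = biderivationD[OF biderivation_weight_bracket]
    have "\<phi> c (const3 (- 2) * Delta3) = const3 (- 2) * Delta3"
    proof -
      have e: "Delta3 = Y3 ^ 3 + const3 (- 1) * Z3 ^ 2" by (simp add: Delta3_def const3_hom)
      show ?thesis unfolding e by (simp only: h g p)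
    qed
    then show "\<phi> c (weight_bracket \<alpha> (c * \<beta>) (c * \<delta>) Y3 Z3) = weight_bracket \<alpha> \<beta> \<delta> (\<phi> c Y3) (\<phi> c Z3)"
      by (simp only: g weight_bracket_gens)
    show "\<phi> c (weight_bracket \<alpha> (c * \<beta>) (c * \<delta>) X3 Y3) = weight_bracket \<alpha> \<beta> \<delta> (\<phi> c X3) (\<phi> c Y3)"
      by (simp only: g b(3,4) weight_bracket_gens h p const3_hom mult_zero_left add_0_right) (simp add: algebra_simps)
    show "\<phi> c (weight_bracket \<alpha> (c * \<beta>) (c * \<delta>) X3 Z3) = weight_bracket \<alpha> \<beta> \<delta> (\<phi> c X3) (\<phi> c Z3)"
      by (simp only: g b(3,4) weight_bracket_gens h p const3_hom mult_zero_left add_0_right) (simp add: algebra_simps)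
  qed
qed

theorem admissible_modular_isomorphic_model:
  assumes "admissible b"
  shows "\<exists>i. modular_isomorphic b (model_bracket i)"
proof -
  obtain \<alpha> \<beta> \<delta> where b: "\<And>p q. b (eisen p) (eisen q) = eisen (weight_bracket \<alpha> \<beta> \<delta> p q)"
    and 1: "(3/2 * \<alpha> - 2) * \<beta> + 2 * \<delta> = 0" and 2: "(2 - \<alpha>) * \<delta> = 4 * \<beta>"
    using admissible_weight_bracket[OF assms] by metis
  have "\<exists>i c \<beta>' \<delta>'. model_coeffs i = (\<alpha>, \<beta>', \<delta>') \<and> \<beta> = c * \<beta>' \<and> \<delta> = c * \<delta>' \<and> c \<noteq> 0" (is ?ex)
  proof -
    have ex: ?ex if "model_coeffs i = (\<alpha>, \<beta>', \<delta>')" "\<beta> = c * \<beta>'" "\<delta> = c * \<delta>'" "c \<noteq> 0" for i c \<beta>' \<delta>'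
      using that by blast
    show ?ex
    proof (cases "\<beta> = 0")
      case True
      then show ?thesis using 1 by (intro ex[of "Round \<alpha>" 0 0 1]) auto
    next
      case False
      have "\<delta> = ((3/2 * \<alpha> - 2) * \<beta> + 2 * \<delta>) / 2 + (1 - 3/4 * \<alpha>) * \<beta>" by (simp add: field_simps)
      then have d: "\<delta> = (1 - 3/4 * \<alpha>) * \<beta>" unfolding 1 by simp
      \<comment> \<open>The first Jacobi condition expresses \<delta> through \<beta>; inserting
        this into the second one leaves \<beta> times a quadratic polynomial in \<alpha>.\<close>
      have "\<beta> * ((\<alpha> - 4) * (3 * \<alpha> + 2)) = 4 * ((2 - \<alpha>) * ((1 - 3/4 * \<alpha>) * \<beta>) - 4 * \<beta>)"
        by (simp add: field_simps)
      also have "\<dots> = 0" using 2 unfolding d by simp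
      finally have "\<alpha> = 4 \<or> 3 * \<alpha> + 2 = 0" using False by auto
      moreover have "\<alpha> = (3 * \<alpha> + 2) / 3 - 2 / 3" by (simp add: field_simps)
      ultimately consider "\<alpha> = 4" | "\<alpha> = - 2 / 3" by fastforce
      then show ?thesis
      proof cases
        case 1
        then show ?thesis using False d by (intro ex[of Angle 1 "- 2" \<beta>]) auto
      next
        case 2
        \<comment> \<open>The scale is 3 \<beta> because the model has 1/3 in place of \<beta>; then
          \<delta> = 3/2 \<beta> matches its 1/2.\<close>
        then show ?thesis using False d by (intro ex[of Curly "1/3" "1/2" "3 * \<beta>"]) auto
      qed
    qed
  qed
  then obtain i c \<beta>' \<delta>' where i: "model_coeffs i = (\<alpha>, \<beta>', \<delta>')" "\<beta> = c * \<beta>'" "\<delta> = c * \<delta>'" "c \<noteq> 0" by blast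
  show ?thesis
    using weight_bracket_rescale[OF b[unfolded i(2,3)] model_bracket_eisen[OF i(1)] i(4)] by blast
qed

section \<open>Modular isomorphisms\<close>

definition modular_iso3 :: "(poly3 \<Rightarrow> poly3) \<Rightarrow> (poly3 \<Rightarrow> poly3 \<Rightarrow> poly3) \<Rightarrow> (poly3 \<Rightarrow> poly3 \<Rightarrow> poly3) \<Rightarrow> bool" where
  "modular_iso3 \<phi> B1 B2 \<longleftrightarrow> const_alg_hom \<phi> \<and> bij \<phi> \<and> (\<forall>p. degree p = 0 \<longrightarrow> degree (\<phi> p) = 0) \<and>
    (\<forall>p q. \<phi> (B1 p q) = B2 (\<phi> p) (\<phi> q))"

lemma const_alg_homD:
  assumes "const_alg_hom \<phi>"
  shows "\<phi> (p + q) = \<phi> p + \<phi> q" "\<phi> (p * q) = \<phi> p * \<phi> q" "\<phi> (const3 c) = const3 c" "\<phi> 0 = 0" "\<phi> 1 = 1"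
    "\<phi> (- p) = - \<phi> p" "\<phi> (p - q) = \<phi> p - \<phi> q" "\<phi> (p ^ n) = \<phi> p ^ n"
proof -
  show add: "\<phi> (p + q) = \<phi> p + \<phi> q" and mult: "\<phi> (p * q) = \<phi> p * \<phi> q" and const: "\<phi> (const3 c) = const3 c" for p q c
    using assms unfolding const_alg_hom_def by blast+
  show z: "\<phi> 0 = 0" and o: "\<phi> 1 = 1" using const[of 0] const[of 1] by (simp_all add: const3_hom)
  show m: "\<phi> (- p) = - \<phi> p" for p using add[of p "- p"] z by (simp add: eq_neg_iff_add_eq_0 add.commute)
  show "\<phi> (p - q) = \<phi> p - \<phi> q" using add[of p "- q"] m by simp
  show "\<phi> (p ^ n) = \<phi> p ^ n" by (induction n) (simp_all add: o mult)
qed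

text \<open>Since \<^term>\<open>\<phi>\<close> maps the coefficient ring into itself, it multiplies the degree in the outermost
  variable by the degree of the image of that variable, which is therefore \<open>1\<close> by surjectivity.\<close>

lemma modular_iso3_degree:
  assumes "modular_iso3 \<phi> B1 B2"
  shows "degree (\<phi> X3) = 1" "degree (\<phi> p) = degree p"
proof -
  have hom: "const_alg_hom \<phi>" and bij: "bij \<phi>" and deg: "\<And>p. degree p = 0 \<Longrightarrow> degree (\<phi> p) = 0"
    using assms unfolding modular_iso3_def by blast+
  note h = const_alg_homD[OF hom]
  define \<mu> where "\<mu> m = coeff (\<phi> [:m:]) 0" for m
  have \<mu>: "\<phi> [:m:] = [:\<mu> m:]" for m
    using deg[of "[:m:]"] degree_eq_zeroE[of "\<phi> [:m:]"] unfolding \<mu>_def by force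
  have \<mu>0: "\<mu> m = 0 \<longleftrightarrow> m = 0" for m
  proof
    assume "\<mu> m = 0"
    then have "\<phi> [:m:] = \<phi> 0" by (simp add: \<mu> h)
    from injD[OF bij_is_inj[OF bij] this] show "m = 0" by simp
  qed (use \<mu>[of 0] h(4) in simp)
  have comp: "\<phi> p = pcompose (map_poly \<mu> p) (\<phi> X3)" for p
  proof (induction p)
    case (pCons m p)
    have "\<phi> (pCons m p) = \<phi> ([:m:] + X3 * p)" by (simp add: X3_def)
    also have "\<dots> = [:\<mu> m:] + \<phi> X3 * pcompose (map_poly \<mu> p) (\<phi> X3)" by (simp only: h \<mu> pCons.IH)
    also have "\<dots> = pcompose (map_poly \<mu> (pCons m p)) (\<phi> X3)" by (simp add: map_poly_pCons \<mu>0 pcompose_pCons)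
    finally show ?case .
  qed (simp add: h)
  have dm: "degree (map_poly \<mu> p) = degree p" for p
    by (rule degree_map_poly) (simp add: \<mu>0)
  have d: "degree (\<phi> p) = degree p * degree (\<phi> X3)" for p
    unfolding comp[of p] by (simp only: degree_pcompose dm)
  obtain p0 where "\<phi> p0 = X3" using bij_is_surj[OF bij] by (metis surjD)
  then have "degree p0 * degree (\<phi> X3) = 1" using d[of p0] by (simp add: X3_def)
  then show 1: "degree (\<phi> X3) = 1" by simp
  show "degree (\<phi> p) = degree p" using d[of p] 1 by simp
qed

text \<open>An isomorphism is only required to map modular forms into modular forms; that its
  inverse does so too rests on the exact preservation of the degree.\<close>

lemma modular_iso3_inv:
  assumes "modular_iso3 \<phi> B1 B2"
  shows "modular_iso3 (inv \<phi>) B2 B1"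
proof -
  have hom: "const_alg_hom \<phi>" and bij: "bij \<phi>" and br: "\<And>p q. \<phi> (B1 p q) = B2 (\<phi> p) (\<phi> q)"
    using assms unfolding modular_iso3_def by blast+
  note h = const_alg_homD[OF hom]
  have i: "\<phi> (inv \<phi> p) = p" for p by (rule surj_f_inv_f[OF bij_is_surj[OF bij]])
  have j: "inv \<phi> p = q" if "p = \<phi> q" for p q unfolding that by (rule inv_f_f[OF bij_is_inj[OF bij]])
  show ?thesis unfolding modular_iso3_def const_alg_hom_def
  proof (intro conjI allI impI)
    show "inv \<phi> (p + q) = inv \<phi> p + inv \<phi> q" "inv \<phi> (p * q) = inv \<phi> p * inv \<phi> q"
      "inv \<phi> (const3 c) = const3 c" "inv \<phi> (B2 p q) = B1 (inv \<phi> p) (inv \<phi> q)" for p q c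
      by (rule j; simp only: h i br)+
    show "bij (inv \<phi>)" by (rule bij_imp_bij_inv[OF bij])
    show "degree (inv \<phi> p) = 0" if "degree p = 0" for p
      using modular_iso3_degree(2)[OF assms, of "inv \<phi> p"] that by (simp add: i)
  qed
qed

lemma unit_poly3: "(p :: poly3) * q = 1 \<Longrightarrow> \<exists>c. p = const3 c \<and> c \<noteq> 0"
proof -
  assume pq: "p * q = 1"
  then have "is_unit p" by (metis dvd_triv_left)
  then obtain m where m: "p = [:m:]" "is_unit m" unfolding is_unit_poly_iff by blast
  then obtain n where n: "m = [:n:]" "is_unit n" unfolding is_unit_poly_iff[of m] by blast
  then obtain c where c: "n = [:c:]" unfolding is_unit_poly_iff[of n] by blast
  have "p = const3 c" unfolding m n c const3_def ..
  moreover have "c \<noteq> 0" using pq \<open>p = const3 c\<close> by (auto simp: const3_hom)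
  ultimately show ?thesis by blast
qed

text \<open>Without X in either argument only the term with - 2 \<open>Delta3\<close> survives:
  \<open>Delta3\<close> times a Jacobian determinant in the other two variables.\<close>

lemma weight_bracket_coeff:
  assumes "degree p = 0" "degree q = 0"
  shows "\<exists>J. degree J = 0 \<and> weight_bracket \<alpha> \<beta> \<delta> p q = Delta3 * J"
proof -
  obtain m n where mn: "p = [:m:]" "q = [:n:]" using assms by (metis degree_eq_zeroE)
  obtain a b c d where ab: "dY p = [:a:]" "dZ q = [:b:]" "dZ p = [:c:]" "dY q = [:d:]"
    using partial_coeff(2,3) unfolding mn by (metis degree_eq_zeroE)
  have "weight_bracket \<alpha> \<beta> \<delta> p q = Delta3 * (const3 (- 2) * (dY p * dZ q - dZ p * dY q))"
    using partial_coeff(1) unfolding weight_bracket_def bracket3_def mn by (simp add: mult_ac)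
  moreover have "degree (const3 (- 2) * (dY p * dZ q - dZ p * dY q)) = 0"
    unfolding ab by (simp add: const3_def)
  ultimately show ?thesis by blast
qed

lemma Delta3_nonzero [simp]: "Delta3 \<noteq> 0"
proof
  assume "Delta3 = 0"
  then have "eval3 Delta3 0 1 0 = 0" by simp
  then show False by (simp add: Delta3_def)
qed

lemma partial_Delta3: "dX Delta3 = 0" "dY Delta3 = const3 3 * Y3 ^ 2" "dZ Delta3 = const3 (- 2) * Z3"
proof -
  have e: "Delta3 = Y3 * (Y3 * Y3) + const3 (- 1) * (Z3 * Z3)"
    by (simp add: Delta3_def const3_hom power2_eq_square power3_eq_cube)
  have c: "const3 3 = 1 + 1 + 1" "const3 (- 2) = const3 (- 1) + const3 (- 1)"
    using const3_hom(1)[of 1 1] const3_hom(1)[of 2 1] const3_hom(1)[of "- 1" "- 1"] by (simp_all add: const3_hom)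
  show "dX Delta3 = 0" "dY Delta3 = const3 3 * Y3 ^ 2" "dZ Delta3 = const3 (- 2) * Z3"
    unfolding e c by (simp_all add: partial_derivations power2_eq_square algebra_simps)
qed

lemma X3_linear_zero:
  assumes "X3 * p + r = 0" "degree p = 0" "degree r = 0"
  shows "p = 0" "r = 0"
proof -
  obtain a b where "p = [:a:]" "r = [:b:]" using assms by (metis degree_eq_zeroE)
  then show "p = 0" "r = 0" using assms(1) by (simp_all add: X3_def)
qed

lemma degree_0_ring:
  assumes "degree (p :: poly3) = 0" "degree q = 0"
  shows "degree (p * q) = 0" "degree (p + q) = 0" "degree (p - q) = 0"
proof -
  obtain a b where ab: "p = [:a:]" "q = [:b:]" using assms by (metis degree_eq_zeroE)
  show "degree (p * q) = 0" "degree (p + q) = 0" "degree (p - q) = 0" unfolding ab by simp_all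
qed

lemma degree_0_power: "degree (p :: poly3) = 0 \<Longrightarrow> degree (p ^ n) = 0"
  using degree_power_le[of p n] by simp

text \<open>Divisibility alone gives \<phi>(\<open>Delta3\<close>) = J \<open>Delta3\<close> with a
  polynomial J. The same for the inverse shows that J is a unit, hence a constant.\<close>

lemma modular_iso3_Delta3:
  assumes iso: "modular_iso3 \<phi> (weight_bracket \<alpha> \<beta> \<delta>) (weight_bracket \<alpha>' \<beta>' \<delta>')"
  shows "\<exists>\<kappa>. \<kappa> \<noteq> 0 \<and> \<phi> Delta3 = const3 \<kappa> * Delta3"
proof -
  have dvd: "\<exists>J. const3 (- 2) * \<phi> Delta3 = Delta3 * J"
    if "modular_iso3 \<phi> (weight_bracket \<alpha> \<beta> \<delta>) (weight_bracket \<alpha>' \<beta>' \<delta>')" for \<phi> \<alpha> \<beta> \<delta> \<alpha>' \<beta>' \<delta>'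
  proof -
    have hom: "const_alg_hom \<phi>" and deg: "\<And>p. degree p = 0 \<Longrightarrow> degree (\<phi> p) = 0"
      and br: "\<And>p q. \<phi> (weight_bracket \<alpha> \<beta> \<delta> p q) = weight_bracket \<alpha>' \<beta>' \<delta>' (\<phi> p) (\<phi> q)"
      using that unfolding modular_iso3_def by blast+
    have "const3 (- 2) * \<phi> Delta3 = weight_bracket \<alpha>' \<beta>' \<delta>' (\<phi> Y3) (\<phi> Z3)"
      unfolding br[symmetric] weight_bracket_gens const_alg_homD[OF hom] ..
    moreover have "degree (\<phi> Y3) = 0" "degree (\<phi> Z3) = 0" by (simp_all add: deg)
    ultimately show ?thesis using weight_bracket_coeff by metis
  qed
  obtain J1 where J1: "const3 (- 2) * \<phi> Delta3 = Delta3 * J1" using dvd[OF iso] by blast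
  obtain J2 where J2: "const3 (- 2) * inv \<phi> Delta3 = Delta3 * J2" using dvd[OF modular_iso3_inv[OF iso]] by blast
  have hom: "const_alg_hom \<phi>" and bij: "bij \<phi>" using iso unfolding modular_iso3_def by blast+
  note h = const_alg_homD[OF hom]
  have "\<phi> (const3 (- 2) * inv \<phi> Delta3) = \<phi> (Delta3 * J2)" by (rule arg_cong[OF J2])
  then have "const3 (- 2) * Delta3 = \<phi> Delta3 * \<phi> J2"
    by (simp only: h surj_f_inv_f[OF bij_is_surj[OF bij]])
  then have "const3 (- 2) * (const3 (- 2) * Delta3) = (const3 (- 2) * \<phi> Delta3) * \<phi> J2"
    by (simp only: mult.assoc)
  then have "Delta3 * const3 4 = Delta3 * (J1 * \<phi> J2)"
    unfolding J1 using const3_hom(2)[of "- 2" "- 2"] by (simp add: mult_ac)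
  then have "const3 4 = J1 * \<phi> J2" by simp
  then have "J1 * (\<phi> J2 * const3 (1/4)) = 1"
    using const3_hom(2)[of 4 "1/4"] by (simp add: mult.assoc[symmetric] const3_hom)
  then obtain c where c: "J1 = const3 c" "c \<noteq> 0" using unit_poly3 by blast
  have "\<phi> Delta3 = (const3 (- 1/2) * const3 (- 2)) * \<phi> Delta3"
    unfolding const3_hom(2)[symmetric] by (simp add: const3_hom(5))
  also have "\<dots> = const3 (- 1/2) * (Delta3 * const3 c)" by (simp only: mult.assoc J1 c(1))
  also have "\<dots> = (const3 (- 1/2) * const3 c) * Delta3" by (simp only: mult_ac)
  also have "\<dots> = const3 (- c / 2) * Delta3" unfolding const3_hom(2)[symmetric] by simp
  finally have "\<phi> Delta3 = const3 (- c / 2) * Delta3" .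
  then show ?thesis using c(2) by (intro exI[of _ "- c / 2"]) simp
qed

lemma modular_iso3_coeffs:
  assumes iso: "modular_iso3 \<phi> (weight_bracket \<alpha> \<beta> \<delta>) (weight_bracket \<alpha>' \<beta>' \<delta>')"
  shows "\<alpha> = \<alpha>'" "\<beta>' = 0 \<Longrightarrow> \<delta>' = 0 \<Longrightarrow> \<beta> = 0"
proof -
  let ?B = "weight_bracket \<alpha> \<beta> \<delta>" and ?B' = "weight_bracket \<alpha>' \<beta>' \<delta>'"
  note b = biderivationD[OF biderivation_weight_bracket]
  have hom: "const_alg_hom \<phi>" and bij: "bij \<phi>" and deg: "\<And>p. degree p = 0 \<Longrightarrow> degree (\<phi> p) = 0"
    and br: "\<And>p q. \<phi> (?B p q) = ?B' (\<phi> p) (\<phi> q)"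
    using iso unfolding modular_iso3_def by blast+
  note h = const_alg_homD[OF hom]
  note c2 = const3_hom(2)[symmetric]
  define y z where "y = \<phi> Y3" and "z = \<phi> Z3"
  have dyz: "degree y = 0" "degree z = 0" unfolding y_def z_def by (simp_all add: deg)
  have z0: "z \<noteq> 0"
  proof
    assume "z = 0"
    then have "Z3 = 0" using bij_is_inj[OF bij] h(4) unfolding z_def by (metis injD)
    then show False by (simp add: Z3_def)
  qed
  have cdX: "dX p = 0" if "degree p = 0" for p using that by (metis degree_eq_zeroE partial_coeff(1))

  obtain w0 w1 where w: "\<phi> X3 = [:w0, w1:]"
    using modular_iso3_degree(1)[OF iso] by (metis degree1_coeffs)
  \<comment> \<open>A preimage of X has degree 1, and comparing leading coefficients gives w1 m1 =
    1. So the leading coefficient of the image of X is a nonzero constant l.\<close>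
  obtain p0 where p0: "\<phi> p0 = X3" using bij_is_surj[OF bij] by (metis surjD)
  have "degree p0 = 1" using modular_iso3_degree(2)[OF iso, of p0] p0 by (simp add: X3_def)
  then obtain a0 a1 where a: "p0 = [:a0, a1:]" by (metis degree1_coeffs)
  obtain m0 m1 where m: "\<phi> [:a0:] = [:m0:]" "\<phi> [:a1:] = [:m1:]"
    using deg[of "[:a0:]"] deg[of "[:a1:]"] by (metis degree_eq_zeroE degree_pCons_0)
  have "X3 = \<phi> ([:a0:] + X3 * [:a1:])" using p0 by (simp add: a X3_def)
  also have "\<dots> = [:m0:] + [:w0, w1:] * [:m1:]" by (simp only: h m w)
  finally have "w1 * m1 = 1" by (simp add: X3_def mult.commute)
  moreover have "[:w1:] * [:m1:] = ([:w1 * m1:] :: poly3)" by (simp add: mult.commute)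
  ultimately have "[:w1:] * [:m1:] = (1 :: poly3)" by (simp only: one_pCons)
  then obtain l where l: "[:w1:] = const3 l" "l \<noteq> 0" using unit_poly3 by blast
  have X: "\<phi> X3 = const3 l * X3 + [:w0:]" unfolding w l(1)[symmetric] by (simp add: X3_def)
  \<comment> \<open>The preimage of the constant term; it serves to pull the final equation back to
    the source.\<close>
  define v where "v = inv \<phi> [:w0:]"
  have v: "\<phi> v = [:w0:]" unfolding v_def by (rule surj_f_inv_f[OF bij_is_surj[OF bij]])
  have dv: "degree v = 0" using modular_iso3_degree(2)[OF iso, of v] v by simp

  obtain \<kappa> where \<kappa>: "\<kappa> \<noteq> 0" "\<phi> Delta3 = const3 \<kappa> * Delta3" using modular_iso3_Delta3[OF iso] by blast
  \<comment> \<open>On polynomials in E_4 and E_6, bracketing with \<open>Delta3\<close> and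
    dividing by it gives 4 E_6 d/dE_4 + 6 E_4^2 d/dE_6, which is - 12 times the Serre derivative,
    whatever \<alpha>, \<beta>, \<delta> are.\<close>
  have Delta: "?B' p Delta3 = Delta3 * (const3 4 * (Z3 * dY p + const3 (3/2) * Y3 ^ 2 * dZ p))"
    "weight_bracket \<alpha> \<beta> \<delta> p Delta3 = Delta3 * (const3 4 * (Z3 * dY p + const3 (3/2) * Y3 ^ 2 * dZ p))"
    if "degree p = 0" for p
  proof -
    have "const3 4 = const3 (- 2) * const3 (- 2)" "const3 4 * const3 (3/2) = - (const3 (- 2) * const3 3)"
      by (simp_all add: c2 const3_hom(3)[symmetric])
    then have "bracket3 (const3 (- 2) * Delta3) u v p Delta3 = Delta3 * (const3 4 * (Z3 * dY p + const3 (3/2) * Y3 ^ 2 * dZ p))" for u v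
      unfolding bracket3_def partial_Delta3 cdX[OF that] distrib_left mult.assoc[symmetric]
      by (simp add: algebra_simps)
    then show "?B' p Delta3 = Delta3 * (const3 4 * (Z3 * dY p + const3 (3/2) * Y3 ^ 2 * dZ p))"
      "?B p Delta3 = Delta3 * (const3 4 * (Z3 * dY p + const3 (3/2) * Y3 ^ 2 * dZ p))"
      unfolding weight_bracket_def by blast+
  qed
  \<comment> \<open>Both sides acquire the same \<kappa>, so the derivation commutes with \<phi>
    exactly. Applied to E_4 it yields \<open>E\<close>.\<close>
  have "\<phi> (?B Y3 Delta3) = const3 \<kappa> * ?B' y Delta3"
    unfolding br \<kappa>(2) y_def by (simp only: b(6,7) mult_zero_left add_0_right)
  moreover have "?B Y3 Delta3 = Delta3 * (const3 4 * Z3)" unfolding Delta(2)[of Y3, simplified] by simp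
  ultimately have "const3 \<kappa> * (Delta3 * (const3 4 * z)) = const3 \<kappa> * (Delta3 * (const3 4 * (Z3 * dY y + const3 (3/2) * Y3 ^ 2 * dZ y)))"
    unfolding Delta(1)[OF dyz(1)] by (simp add: h \<kappa>(2) z_def mult_ac)
  then have E: "z = Z3 * dY y + const3 (3/2) * Y3 ^ 2 * dZ y" using \<kappa>(1) by simp
  define N where "N = const3 \<beta>' * Y3 ^ 2 * dY y + const3 \<delta>' * (Y3 * Z3) * dZ y"
  have dN: "degree N = 0"
  proof -
    have "degree (dY y) = 0" "degree (dZ y) = 0" using dyz(1) by (metis degree_eq_zeroE partial_coeff(2,3))+
    then show ?thesis unfolding N_def by (intro degree_0_ring degree_0_power) auto
  qed
  \<comment> \<open>The part of the bracket linear in X is \<alpha>' X times the right side of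
    \<open>E\<close>, that is, times z; \<open>N\<close> collects the rest.\<close>
  have BX: "?B' X3 y = const3 \<alpha>' * (X3 * z) + N"
    unfolding weight_bracket_def bracket3_def N_def E using cdX[OF dyz(1)] by (simp add: algebra_simps c2)

  have "\<phi> (?B X3 Y3) = const3 \<alpha> * (z * \<phi> X3) + const3 \<beta> * y ^ 2"
    by (simp only: weight_bracket_gens h y_def z_def)
  moreover have "\<phi> (?B X3 Y3) = const3 l * (const3 \<alpha>' * (X3 * z) + N) + ?B' [:w0:] y"
    unfolding br X y_def[symmetric] b(2,3,4) BX by simp
  ultimately have "const3 \<alpha> * (z * (const3 l * X3 + [:w0:])) + const3 \<beta> * y ^ 2 =
      const3 l * (const3 \<alpha>' * (X3 * z) + N) + ?B' [:w0:] y"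
    unfolding X by (rule trans[OF sym])
  \<comment> \<open>Sorting by powers of X: the linear coefficient compares \<alpha> with \<alpha>',
    the constant one concerns \<beta>.\<close>
  moreover have "x * ((k * a - k * a') * z) + (a * (z * u) + e - k * n - t) = 0"
    if "a * (z * (k * x + u)) + e = k * (a' * (x * z) + n) + t" for x k a a' z u e n t :: poly3
    using that by algebra
  moreover have "const3 (l * (\<alpha> - \<alpha>')) = const3 l * const3 \<alpha> - const3 l * const3 \<alpha>'"
    by (simp add: const3_def algebra_simps)
  ultimately have "X3 * (const3 (l * (\<alpha> - \<alpha>')) * z) +
     (const3 \<alpha> * (z * [:w0:]) + const3 \<beta> * y ^ 2 - const3 l * N - ?B' [:w0:] y) = 0"
    by metis
  moreover obtain J' where J': "degree J' = 0" "?B' [:w0:] y = Delta3 * J'"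
    using weight_bracket_coeff[of "[:w0:]" y \<alpha>' \<beta>' \<delta>'] dyz by auto
  have "degree Delta3 = 0" unfolding Delta3_def by (intro degree_0_ring degree_0_power) auto
  then have "degree (const3 \<alpha> * (z * [:w0:]) + const3 \<beta> * y ^ 2 - const3 l * N - ?B' [:w0:] y) = 0"
    unfolding J'(2) using J'(1) dyz dN by (intro degree_0_ring degree_0_power) auto
  moreover have "degree (const3 (l * (\<alpha> - \<alpha>')) * z) = 0" using dyz(2) by (intro degree_0_ring degree_0_power) auto
  ultimately have 1: "const3 (l * (\<alpha> - \<alpha>')) * z = 0"
    and 2: "const3 \<alpha> * (z * [:w0:]) + const3 \<beta> * y ^ 2 - const3 l * N - ?B' [:w0:] y = 0"
    using X3_linear_zero by blast+
  from 1 show "\<alpha> = \<alpha>'" using z0 l(2) by simp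
  assume "\<beta>' = 0" "\<delta>' = 0"
  then have "N = 0" by (simp add: N_def const3_hom)
  \<comment> \<open>As \<open>N\<close> vanishes, every term of the equation lies in the image of
    the modular forms in a way that \<phi> can be undone; the result speaks of the source bracket
    only.\<close>
  with 2 have "\<phi> (const3 \<alpha> * (Z3 * v) + const3 \<beta> * Y3 ^ 2 - ?B v Y3) = \<phi> 0"
    unfolding h br by (simp add: v y_def z_def del: mult_pCons_right mult_pCons_left)
  then have eq: "const3 \<alpha> * (Z3 * v) + const3 \<beta> * Y3 ^ 2 = ?B v Y3"
    using bij_is_inj[OF bij] by (metis injD eq_iff_diff_eq_0)
  obtain J where J: "?B v Y3 = Delta3 * J" using weight_bracket_coeff[OF dv, of Y3 \<alpha> \<beta> \<delta>] by auto
  \<comment> \<open>On the line E_2 = E_6 = 0 the equation reads \<beta> s^2 = s^3 r(s), because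
    \<open>Delta3\<close> becomes s^3 there. Cancelling s^2 and setting s = 0 gives \<beta> =
    0.\<close>
  obtain r where r: "\<And>s. eval3 J (poly 0 s) (poly [:0, 1:] s) (poly 0 s) = poly r s"
    using eval3_polynomial by blast
  have "poly (monom 1 2 * ([:\<beta>:] - [:0, 1:] * r)) s = 0" for s
  proof -
    have "\<beta> * s ^ 2 = s ^ 3 * poly r s"
      using arg_cong[OF eq[unfolded J], of "\<lambda>p. eval3 p 0 s 0"] r[of s] by (simp add: Delta3_def)
    then show ?thesis by (simp add: poly_monom power2_eq_square power3_eq_cube algebra_simps)
  qed
  then have "monom 1 2 * ([:\<beta>:] - [:0, 1:] * r) = 0" by (metis poly_all_0_iff_0)
  then have "[:\<beta>:] - [:0, 1:] * r = 0" by (metis monom_eq_0_iff one_neq_zero mult_eq_0_iff)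
  from arg_cong[OF this, of "\<lambda>p. poly p 0"] show "\<beta> = 0" by simp
qed

theorem theoremC:
  shows "(\<forall>i. admissible (model_bracket i)) \<and>
         (\<forall>b. admissible b \<longrightarrow> (\<exists>i. modular_isomorphic b (model_bracket i))) \<and>
         (\<forall>i j. i \<noteq> j \<longrightarrow> \<not> modular_isomorphic (model_bracket i) (model_bracket j))"
proof (intro conjI allI impI notI)
  show "admissible (model_bracket i)" for i by (rule admissible_model_bracket)
  show "\<exists>i. modular_isomorphic b (model_bracket i)" if "admissible b" for b
    by (rule admissible_modular_isomorphic_model[OF that])
  fix i j assume ij: "i \<noteq> j" "modular_isomorphic (model_bracket i) (model_bracket j)"
  define c where "c = (\<lambda>i. (fst (model_coeffs i), fst (snd (model_coeffs i)), snd (snd (model_coeffs i))))"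
  let ?B = "\<lambda>i. weight_bracket (fst (c i)) (fst (snd (c i))) (snd (snd (c i)))"
  have m: "model_bracket i (eisen p) (eisen q) = eisen (?B i p q)" for i p q
    by (rule model_bracket_eisen) (simp add: c_def)
  obtain \<phi> where \<phi>: "modular_iso3 \<phi> (?B i) (?B j)"
    using ij(2) unfolding modular_iso3_def
      modular_isomorphic_eisen_iff[of "model_bracket i" "?B i" "model_bracket j" "?B j", OF m m] by blast
  \<comment> \<open>Different labels with equal \<alpha> are a \<open>Round\<close> against
    \<open>Curly\<close> or \<open>Angle\<close>. The vanishing of \<beta> is needed in both
    directions, since either label may be the \<open>Round\<close> one.\<close>
  have "fst (c i) = fst (c j)"
    "fst (snd (c j)) = 0 \<Longrightarrow> snd (snd (c j)) = 0 \<Longrightarrow> fst (snd (c i)) = 0"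
    "fst (snd (c i)) = 0 \<Longrightarrow> snd (snd (c i)) = 0 \<Longrightarrow> fst (snd (c j)) = 0"
    using modular_iso3_coeffs[OF \<phi>] modular_iso3_coeffs(2)[OF modular_iso3_inv[OF \<phi>]] by blast+
  moreover have "- (2 / 3) \<noteq> (4 :: complex)" by (simp add: complex_eq_iff)
  ultimately show False using ij(1) by (cases i; cases j) (auto simp: c_def)
qed

end
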